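(* Let $f\in\mathbb{R}[\mathbf{x}]$ attain its minimum $f^*=\min_{x\in\mathbb{R}^n}f(x)$ on $\mathbb{R}^n$, and let $G\subset\mathbb{R}[\mathbf{x}]$ with $I_{grad}(f)\subset(G)\subset I_{min}(f)$. Then there exists $t_2\in\mathbb{N}$ such that for all $t\ge t_2$ and every $\Lambda^*\in\mathcal{L}_{G,t,\succcurlyeq}$ generic for $f$, we have $\Lambda^*(f)=f^*$ and $(\ker H^t_{\Lambda^*})=I_{min}(f)$.
   Context: $\mathbb{R}[\mathbf{x}]=\mathbb{R}[x_1,\dots,x_n]$; $\mathbb{R}[\mathbf{x}]_t$ is the space of polynomials of degree $\le t$; $(S)$ is the ideal generated by $S$. $I_{grad}(f)=(\partial f/\partial x_1,\dots,\partial f/\partial x_n)$; $I_{min}(f)$ is the ideal of all polynomials vanishing at every $\mathbf{x}^*\in\mathbb{R}^n$ with $f(\mathbf{x}^* )=f^*$. For $G\subset\mathbb{R}[\mathbf{x}]$ and $d\in\mathbb{N}$, $\langle G\,|\,d\rangle=\{\sum_{g\in G,\deg g\le d}p_g g\mid p_g\in\mathbb{R}[\mathbf{x}]_{d-\deg g}\}$ (finite sums). For $t$ with $2t\ge\deg f$ define $\mathcal{L}_{G,t,\succcurlyeq}=\{\Lambda\in(\mathbb{R}[\mathbf{x}]_{2t})^*\mid\Lambda(g)=0\ \forall g\in\langle G\,|\,2t\rangle,\ \Lambda(1)=1,\ \Lambda(p^2)\ge0\ \forall p\in\mathbb{R}[\mathbf{x}]_t\}$ and $f^\mu_{G,t}=\inf\{\Lambda(f)\mid\Lambda\in\mathcal{L}_{G,t,\succcurlyeq}\}$.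 $H_\Lambda^t:\mathbb{R}[\mathbf{x}]_t\to(\mathbb{R}[\mathbf{x}]_t)^*$ is $p\mapsto(q\mapsto\Lambda(pq))$, so $\ker H_\Lambda^t=\{p\in\mathbb{R}[\mathbf{x}]_t\mid\Lambda(pq)=0\ \forall q\in\mathbb{R}[\mathbf{x}]_t\}$. A form $\Lambda^*\in\mathcal{L}_{G,t,\succcurlyeq}$ is generic for $f$ if $\Lambda^*(f)=f^\mu_{G,t}$ and $\mathrm{rank}\,H^t_{\Lambda^*}$ is maximal among all $\mathrm{rank}\,H^t_\Lambda$ with $\Lambda\in\mathcal{L}_{G,t,\succcurlyeq}$, $\Lambda(f)=f^\mu_{G,t}$. *)

theory Defs
  imports
    "HOL-Analysis.Analysis"
    "HOL-Library.Poly_Mapping"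
    "HOL-Library.Function_Algebras"
begin

text \<open>
  Polynomials in the variables \<open>x\<^sub>i\<close>, \<open>i :: 'n\<close>, are finitely supported maps from exponent vectors
  to real coefficients; the ring structure is the convolution structure on \<open>poly_mapping\<close>.
  The number of variables is \<open>CARD('n)\<close>.
\<close>

type_synonym 'n rpoly = "('n \<Rightarrow>\<^sub>0 nat) \<Rightarrow>\<^sub>0 real"

definition scal :: "real \<Rightarrow> 'n rpoly \<Rightarrow> 'n rpoly" where
  "scal c p = Poly_Mapping.single 0 c * p"

definition peval :: "'n::finite rpoly \<Rightarrow> real ^ 'n \<Rightarrow> real" where
  "peval p x = (\<Sum>m\<in>Poly_Mapping.keys p.
     Poly_Mapping.lookup p m * (\<Prod>i\<in>UNIV. (x $ i) ^ Poly_Mapping.lookup m i))"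

text \<open>Total degree; the zero polynomial gets degree 0.\<close>

definition pdegree :: "'n::finite rpoly \<Rightarrow> nat" where
  "pdegree p = Max (insert 0 ((\<lambda>m. \<Sum>i\<in>UNIV. Poly_Mapping.lookup m i) ` Poly_Mapping.keys p))"

definition polys_upto :: "nat \<Rightarrow> 'n::finite rpoly set" where
  "polys_upto d = {p. pdegree p \<le> d}"

text \<open>
  If \<open>x\<^sub>i\<close> does not occur in the monomial \<open>m\<close>, the subtraction truncates, but then the coefficient
  of the corresponding term is 0.
\<close>

definition pdiff :: "'n \<Rightarrow> 'n rpoly \<Rightarrow> 'n rpoly" where
  "pdiff i p = (\<Sum>m\<in>Poly_Mapping.keys p.
     Poly_Mapping.single (m - Poly_Mapping.single i 1)
       (real (Poly_Mapping.lookup m i) * Poly_Mapping.lookup p m))"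

text \<open>The ideal generated by a set is its span in the ring viewed as a module over itself.\<close>

lemma module_times: "module ((*) :: 'a::comm_ring_1 \<Rightarrow> 'a \<Rightarrow> 'a)"
  by unfold_locales (simp_all add: algebra_simps)

definition gen_ideal :: "'a::comm_ring_1 set \<Rightarrow> 'a set" where
  "gen_ideal S = module.span (*) S"

definition I_grad :: "'n::finite rpoly \<Rightarrow> 'n rpoly set" where
  "I_grad f = gen_ideal (range (\<lambda>i. pdiff i f))"

text \<open>
  The minimum of \<open>f\<close> over the whole space; meaningful only for \<open>f\<close> bounded below, and used only
  for \<open>f\<close> attaining its minimum.
\<close>

definition min_value :: "'n::finite rpoly \<Rightarrow> real" where
  "min_value f = (INF x. peval f x)"

definition I_min :: "'n::finite rpoly \<Rightarrow> 'n rpoly set" where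
  "I_min f = {p. \<forall>x. peval f x = min_value f \<longrightarrow> peval p x = 0}"

text \<open>The truncated ideal \<open>\<langle>G | d\<rangle>\<close>; \<open>G\<close> may be infinite, the sums are finite.\<close>

definition trunc_ideal :: "'n::finite rpoly set \<Rightarrow> nat \<Rightarrow> 'n rpoly set" where
  "trunc_ideal G d = {\<Sum>g\<in>F. c g * g | F c.
     finite F \<and> F \<subseteq> {g \<in> G. pdegree g \<le> d} \<and> (\<forall>g\<in>F. c g \<in> polys_upto (d - pdegree g))}"

text \<open>
  The dual space of \<open>polys_upto d\<close>. A functional is represented by its extension by 0 outside
  \<open>polys_upto d\<close>, so that representatives are unique and the dual space is a linear subspace
  of the function space with pointwise operations.
\<close>

definition dual_upto :: "nat \<Rightarrow> ('n::finite rpoly \<Rightarrow> real) set" where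
  "dual_upto d = {\<Lambda>.
     (\<forall>p\<in>polys_upto d. \<forall>q\<in>polys_upto d. \<Lambda> (p + q) = \<Lambda> p + \<Lambda> q) \<and>
     (\<forall>c. \<forall>p\<in>polys_upto d. \<Lambda> (scal c p) = c * \<Lambda> p) \<and>
     (\<forall>p. p \<notin> polys_upto d \<longrightarrow> \<Lambda> p = 0)}"

definition moment_forms :: "'n::finite rpoly set \<Rightarrow> nat \<Rightarrow> ('n rpoly \<Rightarrow> real) set" where
  "moment_forms G t = {\<Lambda> \<in> dual_upto (2 * t).
     (\<forall>g\<in>trunc_ideal G (2 * t). \<Lambda> g = 0) \<and>
     \<Lambda> 1 = 1 \<and>
     (\<forall>p\<in>polys_upto t. \<Lambda> (p ^ 2) \<ge> 0)}"

text \<open>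
  The infimum is taken in the extended reals: it is \<open>-\<infinity>\<close> if the values are unbounded below and
  \<open>\<infinity>\<close> if there is no admissible form.
\<close>

definition f_mu :: "'n::finite rpoly set \<Rightarrow> nat \<Rightarrow> 'n rpoly \<Rightarrow> ereal" where
  "f_mu G t f = (INF \<Lambda>\<in>moment_forms G t. ereal (\<Lambda> f))"

text \<open>
  The Hankel operator from \<open>polys_upto t\<close> to \<open>dual_upto t\<close>; only its values on
  \<open>polys_upto t\<close> matter.
\<close>

definition hankel :: "nat \<Rightarrow> ('n::finite rpoly \<Rightarrow> real) \<Rightarrow> 'n rpoly \<Rightarrow> ('n rpoly \<Rightarrow> real)" where
  "hankel t \<Lambda> p = (\<lambda>q. if q \<in> polys_upto t then \<Lambda> (p * q) else 0)"

definition hankel_ker :: "nat \<Rightarrow> ('n::finite rpoly \<Rightarrow> real) \<Rightarrow> 'n rpoly set" where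
  "hankel_ker t \<Lambda> = {p \<in> polys_upto t. hankel t \<Lambda> p = (\<lambda>q. 0)}"

definition fun_scale :: "real \<Rightarrow> ('a \<Rightarrow> real) \<Rightarrow> ('a \<Rightarrow> real)" where
  "fun_scale c \<phi> = (\<lambda>x. c * \<phi> x)"

lemma vector_space_fun_scale: "vector_space fun_scale"
  by unfold_locales (auto simp: fun_scale_def fun_eq_iff algebra_simps)

definition hankel_rank :: "nat \<Rightarrow> ('n::finite rpoly \<Rightarrow> real) \<Rightarrow> nat" where
  "hankel_rank t \<Lambda> = vector_space.dim fun_scale (hankel t \<Lambda> ` polys_upto t)"

definition generic_form ::
  "'n::finite rpoly set \<Rightarrow> nat \<Rightarrow> 'n rpoly \<Rightarrow> ('n rpoly \<Rightarrow> real) \<Rightarrow> bool" where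
  "generic_form G t f \<Lambda> \<longleftrightarrow>
     \<Lambda> \<in> moment_forms G t \<and> ereal (\<Lambda> f) = f_mu G t f \<and>
     (\<forall>\<Lambda>'\<in>moment_forms G t. ereal (\<Lambda>' f) = f_mu G t f \<longrightarrow> hankel_rank t \<Lambda>' \<le> hankel_rank t \<Lambda>)"

end

theory Submission
  imports Defs "HOL-Algebra.Algebraic_Closure_Type"
begin

text \<open>
  Let \<open>u = f - f*\<close>, where \<open>f*\<close> is the minimum of \<open>f\<close>. The proof rests on two families of polynomial
  identities in which the order \<open>t\<close> does not occur.

  \<^item> There are finitely many reals \<open>c \<ge> 0\<close> such that \<open>b\<close>, the product of the \<open>u - c\<close>, satisfies
    \<open>b ^ (2 ^ j) + \<sigma> \<in> I_grad f\<close> for some \<open>j\<close> and some sum of squares \<open>\<sigma>\<close>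
    (\<open>critical_value_certificate\<close>).
  \<^item> Every \<open>p \<in> I_min f\<close> satisfies \<open>p ^ (2 ^ j) + \<sigma> = g + q * u\<close> with \<open>\<sigma>\<close> a sum of squares and
    \<open>g \<in> I_grad f\<close> (\<open>I_min_certificate\<close>).

  Now let \<open>\<Lambda>\<close> be an admissible form of an order \<open>t\<close> that exceeds all degrees occurring here.
  By the Cauchy-Schwarz inequality \<open>\<Lambda> (p * p) = 0\<close> implies \<open>\<Lambda> (p * q) = 0\<close>, so such \<open>p\<close> behave
  like the elements of a real radical ideal, and the first identity gives \<open>\<Lambda> (b * q) = 0\<close>.
  Modulo \<open>b\<close> the polynomial \<open>u\<close> equals \<open>\<delta> * u^2 + w^2\<close> with \<open>\<delta> > 0\<close>: interpolate the square root of
  \<open>c - \<delta> * c^2\<close> at the finitely many \<open>c\<close>. Hence \<open>\<Lambda> u = \<delta> * \<Lambda> (u^2) + \<Lambda> (w^2) \<ge> 0\<close>, that is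
  \<open>f* \<le> \<Lambda> f\<close>; evaluation at a minimiser attains this bound. If \<open>\<Lambda> f = f*\<close> then \<open>\<Lambda> (u^2) = 0\<close>, and
  the second identity puts \<open>p\<close> into the kernel of the Hankel operator. Applied to a finite set of
  generators of \<open>I_min f\<close> (Hilbert's basis theorem) this yields one inclusion, for every optimal form.
  For the other one, average a generic form with the evaluation at a minimiser \<open>x\<close>. The average is
  optimal, its kernel is contained in both kernels, and by maximality of the rank it is
  the kernel of the generic form (\<open>hankel_kernel_genericity\<close>); hence the elements of this kernel
  vanish at \<open>x\<close>.

  Both families of identities come from Zorn's lemma: if there is no such identity, then some prime cone
  of the polynomial ring has the ideal in its support, but none of the polynomials \<open>u - c\<close>, respectively not \<open>p\<close>
  (\<open>prime_cone_certificate\<close>). This is excluded by two properties of every prime cone, collected in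
  \<open>prime_cone_real\<close>. Let \<open>K\<close> be the real closure of its residue field and \<open>\<xi>\<close> the point of \<open>K^n\<close> given by the
  classes of the variables.

  \<^item> The signs that finitely many polynomials take at \<open>\<xi>\<close> are also taken at a point of \<open>\<real>^n\<close>
    (Artin and Lang). The variables are eliminated one by one: by Cohen and Hoermander the sign table of
    finitely many univariate polynomials over a real closed field depends only on the signs of finitely
    many polynomials in the coefficients (\<open>sign_table_elimination\<close>, \<open>sign_specialization\<close>).
  \<^item> If all \<open>\<partial>f/\<partial>x_i\<close> vanish at \<open>\<xi>\<close> then \<open>f(\<xi>)\<close> is a real number. Were it transcendental
    over \<open>\<real>\<close>, the derivation \<open>d/df\<close> would extend to a ring containing all \<open>\<xi>_i\<close>
    (\<open>derivation_extend\<close>), and the chain rule would give \<open>1 = D (f(\<xi>)) = 0\<close>. So \<open>f(\<xi>)\<close> is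
    algebraic over \<open>\<real>\<close>, and as an element of an ordered field it is real. This
    replaces the finiteness of the set of critical values.
\<close>

hide_const (open) Polynomials.degree Polynomials.lead_coeff up_ring.coeff up_ring.monom Coset.order Divisibility.irreducible

section \<open>Polynomials over real closed fields\<close>

text \<open>
  The intermediate value property of polynomials characterises the real closed fields among the ordered ones.
  Polynomial functions are written out as sums, since the parameter of a class cannot occur inside
  the type of polynomials over it.
\<close>

class real_closed = linordered_field +
  assumes sum_ivt: "a < b \<Longrightarrow> (\<Sum>k\<le>n. f k * a ^ k) < 0 \<Longrightarrow> 0 < (\<Sum>k\<le>n. f k * b ^ k) \<Longrightarrow>
    \<exists>c. a < c \<and> c < b \<and> (\<Sum>k\<le>n. f k * c ^ k) = 0"

lemma poly_ivt_up:
  fixes p :: "'a::real_closed poly"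
  assumes "a < b" "poly p a < 0" "0 < poly p b"
  shows "\<exists>c. a < c \<and> c < b \<and> poly p c = 0"
  using sum_ivt[where a=a and b=b and n="degree p" and f="coeff p"] assms by (simp add: poly_altdef)

lemma poly_ivt:
  fixes p :: "'a::real_closed poly"
  assumes "a < b" "poly p a * poly p b < 0"
  shows "\<exists>c. a < c \<and> c < b \<and> poly p c = 0"
  using poly_ivt_up[of a b p] poly_ivt_up[of a b "- p"] assms by (auto simp: mult_less_0_iff)

instance real :: real_closed
proof
  fix a b :: real and f n
  assume ab: "a < b" and "(\<Sum>k\<le>n. f k * a ^ k) < 0" "0 < (\<Sum>k\<le>n. f k * b ^ k)"
  moreover have "poly (\<Sum>k\<le>n. monom (f k) k) x = (\<Sum>k\<le>n. f k * x ^ k)" for x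
    by (simp add: poly_sum poly_monom)
  ultimately show "\<exists>c>a. c < b \<and> (\<Sum>k\<le>n. f k * c ^ k) = 0"
    using poly_IVT_pos[of a b "\<Sum>k\<le>n. monom (f k) k"] by auto
qed

text \<open>
  Between two consecutive roots, split off the root factors: \<open>p = (x - a)^m * (x - c)^n * q\<close> where \<open>q\<close> has
  constant sign. Then \<open>p'\<close> is \<open>(x - a)^(m-1) * (x - c)^(n-1)\<close> times a polynomial with values of opposite sign at
  \<open>a\<close> and \<open>c\<close>.
\<close>

lemma poly_rolle:
  fixes p :: "'a::real_closed poly"
  assumes "a < b" "poly p a = 0" "poly p b = 0"
  shows "\<exists>c. a < c \<and> c < b \<and> poly (pderiv p) c = 0"
proof (cases "p = 0")
  case True
  then show ?thesis using dense[OF assms(1)] by auto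
next
  case False
  \<comment> \<open>the root \<open>c\<close> following \<open>a\<close> replaces \<open>b\<close>, so that \<open>p\<close> has no root between\<close>
  define B where "B = {x. poly p x = 0 \<and> a < x}"
  have "finite B" using poly_roots_finite[OF False] by (auto simp: B_def)
  moreover have "b \<in> B" using assms by (auto simp: B_def)
  ultimately obtain c where c: "c \<in> B" "\<And>x. x \<in> B \<Longrightarrow> c \<le> x"
    by (metis Min_in Min_le empty_iff)
  then have ac: "a < c" "poly p c = 0" "c \<le> b" and no: "\<And>x. a < x \<Longrightarrow> x < c \<Longrightarrow> poly p x \<noteq> 0"
    using \<open>b \<in> B\<close> by (force simp: B_def)+
  obtain r where r: "p = [:- a, 1:] ^ order a p * r" "\<not> [:- a, 1:] dvd r"
    using order_decomp[OF False] by blast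
  have r0: "r \<noteq> 0" using r(2) by auto
  have "poly p c = (c - a) ^ order a p * poly r c" by (subst r(1)) (simp add: poly_power)
  then have pc: "poly r c = 0" using ac by simp
  obtain q where q: "r = [:- c, 1:] ^ order c r * q" "\<not> [:- c, 1:] dvd q"
    using order_decomp[OF r0] by blast
  obtain m where m: "order a p = Suc m" using assms(2) False by (metis order_root not0_implies_Suc)
  obtain n where n: "order c r = Suc n" using pc r0 by (metis order_root not0_implies_Suc)
  have p: "p = [:- a, 1:] ^ Suc m * ([:- c, 1:] ^ Suc n * q)" using r(1) q(1) m n by simp
  have qa: "poly q a \<noteq> 0" using r(2) q(1) by (metis dvd_mult poly_eq_0_iff_dvd)
  have qc: "poly q c \<noteq> 0" using q(2) by (metis poly_eq_0_iff_dvd)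
  have qpos: "poly q a * poly q c > 0"
  proof (rule ccontr)
    assume "\<not> ?thesis"
    then have "poly q a * poly q c < 0" using qa qc by (metis linorder_neqE_linordered_idom mult_eq_0_iff)
    from poly_ivt[OF ac(1) this] show False using no p by (metis mult_zero_right poly_mult)
  qed
  define q1 where "q1 = (of_nat (Suc m) * [:- c, 1:] + of_nat (Suc n) * [:- a, 1:]) * q + [:- a, 1:] * [:- c, 1:] * pderiv q"
  have d: "pderiv p = [:- a, 1:] ^ m * [:- c, 1:] ^ n * q1"
  proof -
    have A: "pderiv (A ^ Suc k) = of_nat (Suc k) * A ^ k" if "pderiv A = 1" for A :: "'a poly" and k
      using that by (simp add: pderiv_power_Suc of_nat_poly del: power_Suc of_nat_Suc)
    have 1: "pderiv [:- a, 1:] = (1 :: 'a poly)" "pderiv [:- c, 1:] = (1 :: 'a poly)"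
      by (simp_all add: pderiv_pCons)
    show ?thesis
      unfolding p q1_def pderiv_mult A[OF 1(1)] A[OF 1(2)]
      unfolding power_Suc distrib_left distrib_right
      by (simp only: ac_simps 1 mult_1_left mult_1_right)
  qed
  have "poly q1 a = - (of_nat (Suc m) * (c - a) * poly q a)" "poly q1 c = of_nat (Suc n) * (c - a) * poly q c"
    by (simp_all add: q1_def algebra_simps of_nat_poly)
  then have "poly q1 a * poly q1 c = - ((of_nat (Suc m) * of_nat (Suc n)) * (c - a)^2 * (poly q a * poly q c))"
    by (simp only: power2_eq_square mult_minus_left mult_minus_right ac_simps)
  moreover have "0 < (of_nat (Suc m) * of_nat (Suc n) :: 'a) * (c - a)^2 * (poly q a * poly q c)"
    using ac(1) by (intro mult_pos_pos[OF mult_pos_pos qpos]) (auto intro!: mult_pos_pos simp del: of_nat_Suc)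
  ultimately have "poly q1 a * poly q1 c < 0" by linarith
  from poly_ivt[OF ac(1) this] obtain x where "a < x" "x < c" "poly q1 x = 0" by auto
  then show ?thesis using d ac by (intro exI[of _ x]) auto
qed

text \<open>
  Rolle's theorem for \<open>p\<close> minus the line through its values at \<open>a\<close> and \<open>b\<close>.
\<close>

lemma poly_strict_mono:
  fixes p :: "'a::real_closed poly"
  assumes "a < b" "\<And>x. a < x \<Longrightarrow> x < b \<Longrightarrow> 0 < poly (pderiv p) x"
  shows "poly p a < poly p b"
proof -
  define s where "s = (poly p b - poly p a) / (b - a)"
  define g where "g = p - [:poly p a - s * a, s:]"
  have "s * (b - a) = poly p b - poly p a" using assms(1) by (simp add: s_def)
  then have "poly g a = 0" "poly g b = 0" by (auto simp: g_def algebra_simps)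
  from poly_rolle[OF assms(1) this] obtain c where c: "a < c" "c < b" "poly (pderiv g) c = 0" by auto
  then have "poly (pderiv p) c = s" by (simp add: g_def pderiv_diff pderiv_pCons)
  then have "0 < s" using assms(2) c by metis
  then show ?thesis using assms(1) by (simp add: s_def field_simps)
qed

lemma poly_eventually_gt:
  fixes p :: "'a::linordered_field poly"
  assumes "degree p > 0" "lead_coeff p > 0"
  shows "\<exists>N. \<forall>x\<ge>N. v < poly p x"
  using assms
proof (induction p arbitrary: v)
  case 0
  then show ?case by simp
next
  case (pCons a q)
  then have q0: "q \<noteq> 0" by auto
  show ?case
  proof (cases "degree q = 0")
    case True
    then obtain c where c: "q = [:c:]" by (meson degree_eq_zeroE)
    then have c0: "c > 0" using pCons.prems q0 by auto
    show ?thesis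
    proof (intro exI[of _ "(v - a) / c + 1"] allI impI)
      fix x assume "(v - a) / c + 1 \<le> x"
      then have "(v - a) / c < x" by simp
      then show "v < poly (pCons a q) x" using c0 c by (simp add: field_simps)
    qed
  next
    case False
    then obtain N where N: "\<And>x. N \<le> x \<Longrightarrow> 1 < poly q x" using pCons.IH[of 1] pCons.prems q0 by auto
    show ?thesis
    proof (intro exI[of _ "max N (max 1 (v - a + 1))"] allI impI)
      fix x assume "max N (max 1 (v - a + 1)) \<le> x"
      then have x: "N \<le> x" "1 \<le> x" "v - a + 1 \<le> x" by auto
      have "x * 1 \<le> x * poly q x" using N[OF x(1)] x(2) by (intro mult_left_mono) auto
      then have "x \<le> x * poly q x" by simp
      then show "v < poly (pCons a q) x" using x(3) unfolding poly_pCons by linarith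
    qed
  qed
qed

text \<open>
  A negative leading coefficient of \<open>p\<close> is passed on to \<open>pderiv p\<close>, which would then be negative far out.
\<close>

lemma poly_unbounded_above:
  fixes p :: "'a::linordered_field poly"
  assumes "\<And>x. y < x \<Longrightarrow> 0 < poly (pderiv p) x"
  shows "\<exists>x>y. v < poly p x"
proof -
  have d: "degree p > 0"
  proof (rule ccontr)
    assume "\<not> ?thesis"
    then have "pderiv p = 0" by (simp add: pderiv_eq_0_iff)
    then show False using assms[of "y + 1"] by simp
  qed
  have "lead_coeff p > 0"
  proof (rule ccontr)
    assume n: "\<not> lead_coeff p > 0"
    then have n: "lead_coeff p < 0" using d by (metis degree_0 leading_coeff_0_iff linorder_neqE_linordered_idom order_less_irrefl)
    have lc: "lead_coeff (- pderiv p) = - (of_nat (degree p) * lead_coeff p)"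
      using d by (simp add: degree_pderiv coeff_pderiv)
    then have lc0: "lead_coeff (- pderiv p) > 0" using n d by (simp add: mult_less_0_iff)
    have "\<exists>N. \<forall>x\<ge>N. 0 < poly (- pderiv p) x"
    proof (cases "degree (- pderiv p) = 0")
      case True
      then obtain c where c: "- pderiv p = [:c:]" by (meson degree_eq_zeroE)
      show ?thesis using lc0 unfolding c by auto
    next
      case False
      then show ?thesis using poly_eventually_gt lc0 by blast
    qed
    then obtain N where N: "\<And>x. N \<le> x \<Longrightarrow> 0 < poly (- pderiv p) x" by blast
    have "y < max N (y + 1)" by (simp add: less_max_iff_disj)
    then show False using N[of "max N (y + 1)"] assms[of "max N (y + 1)"] by simp
  qed
  from poly_eventually_gt[OF d this, of v] obtain N where "\<And>x. N \<le> x \<Longrightarrow> v < poly p x" by blast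
  then show ?thesis by (intro exI[of _ "max N (y + 1)"]) (simp add: less_max_iff_disj)
qed

lemma poly_unbounded_below:
  fixes p :: "'a::linordered_field poly"
  assumes "\<And>x. x < y \<Longrightarrow> 0 < poly (pderiv p) x"
  shows "\<exists>x<y. poly p x < v"
proof -
  define q where "q = - (pcompose p [:0, -1:])"
  have "0 < poly (pderiv q) x" if "- y < x" for x
    using assms[of "- x"] that by (simp add: q_def pderiv_minus pderiv_pcompose pderiv_pCons poly_pcompose)
  from poly_unbounded_above[of "- y" q "- v"] this obtain x where "x > - y" "- v < poly q x" by blast
  then show ?thesis by (intro exI[of _ "- x"]) (auto simp: q_def poly_pcompose)
qed

section \<open>Signs on the gaps between roots\<close>

text \<open>
  The sign as an integer, so that signs in different fields can be compared.
\<close>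

definition sg :: "'a::linordered_idom \<Rightarrow> int" where
  "sg x = (if x = 0 then 0 else if 0 < x then 1 else - 1)"

lemma sg_simps [simp]: "sg x = 0 \<longleftrightarrow> x = 0" "0 = sg x \<longleftrightarrow> x = 0" "sg x = 1 \<longleftrightarrow> 0 < x" "sg x = - 1 \<longleftrightarrow> x < 0"
  "sg 0 = 0" "sg 1 = 1" "sg (- x) = - sg x"
  by (auto simp: sg_def)

lemma sg_mult: "sg (x * y) = sg x * sg y"
  by (auto simp: sg_def zero_less_mult_iff)

lemma sg_power: "sg (x ^ k) = sg x ^ k"
  by (induction k) (auto simp: sg_mult)

lemma sg_eqD:
  fixes x :: "'a::linordered_idom" and y :: "'b::linordered_idom"
  assumes "sg x = sg y"
  shows "x = 0 \<longleftrightarrow> y = 0" "0 < x \<longleftrightarrow> 0 < y" "x < 0 \<longleftrightarrow> y < 0" "0 \<le> x \<longleftrightarrow> 0 \<le> y" "x \<le> 0 \<longleftrightarrow> y \<le> 0"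
  using assms
  by (cases x "0::'a" rule: linorder_cases; cases y "0::'b" rule: linorder_cases; simp add: sg_def)+

lemma sg_cases: "sg x = 0 \<or> sg x = 1 \<or> sg x = - 1"
  by (auto simp: sg_def)

text \<open>
  The points that lie on the same side as \<open>y\<close> of every element of \<open>A\<close>: for finite \<open>A\<close> and \<open>y \<notin> A\<close> an open interval,
  possibly unbounded.
\<close>

definition gap :: "'a::linorder set \<Rightarrow> 'a \<Rightarrow> 'a set" where
  "gap A y = {x. \<forall>a\<in>A. (a < x \<longleftrightarrow> a < y) \<and> (x < a \<longleftrightarrow> y < a)}"

lemma gapI:
  fixes x y :: "'a::linorder"
  assumes "\<And>c. c \<in> A \<Longrightarrow> c < x \<and> c < y \<or> x < c \<and> y < c"
  shows "x \<in> gap A y"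
  unfolding gap_def mem_Collect_eq
proof (intro ballI)
  fix c assume "c \<in> A"
  from assms[OF this] show "(c < x \<longleftrightarrow> c < y) \<and> (x < c \<longleftrightarrow> y < c)" by auto
qed

lemma finite_between:
  fixes L U :: "'a::{linorder,dense_order,no_top,no_bot} set"
  assumes "finite L" "finite U" "\<And>l u. l \<in> L \<Longrightarrow> u \<in> U \<Longrightarrow> l < u"
  shows "\<exists>v. (\<forall>l\<in>L. l < v) \<and> (\<forall>u\<in>U. v < u)"
proof (cases "L = {} \<or> U = {}")
  case True
  then show ?thesis
  proof
    assume "L = {}"
    then show ?thesis using lt_ex[of "Min U"] assms(2) by (cases "U = {}") auto
  next
    assume "U = {}"
    then show ?thesis using gt_ex[of "Max L"] assms(1) by (cases "L = {}") auto
  qed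
next
  case False
  then have "Max L < Min U" using assms by auto
  from dense[OF this] False show ?thesis using assms(1,2) by auto
qed

lemma lower_neighbor:
  fixes A :: "'a::linorder set"
  assumes "finite A" "x \<in> A" "x < y"
  obtains a where "a \<in> A" "a < y" "\<And>c. c \<in> A \<Longrightarrow> c < y \<Longrightarrow> c \<le> a"
proof -
  let ?B = "{a\<in>A. a < y}"
  have "finite ?B" "?B \<noteq> {}" using assms by auto
  then show ?thesis using that[of "Max ?B"] Max_in[of ?B] by auto
qed

lemma upper_neighbor:
  fixes A :: "'a::linorder set"
  assumes "finite A" "x \<in> A" "y < x"
  obtains a where "a \<in> A" "y < a" "\<And>c. c \<in> A \<Longrightarrow> y < c \<Longrightarrow> a \<le> c"
proof -
  let ?B = "{a\<in>A. y < a}"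
  have "finite ?B" "?B \<noteq> {}" using assms by auto
  then show ?thesis using that[of "Min ?B"] Min_in[of ?B] by auto
qed

text \<open>
  On a gap where \<open>p\<close> increases, the values of \<open>p\<close> fill the interval between the values at the two endpoints; a missing
  endpoint imposes no bound.
\<close>

lemma gap_value:
  fixes p :: "'a::real_closed poly"
  assumes A: "finite A" "y \<notin> A" and pos: "\<And>x. x \<in> gap A y \<Longrightarrow> 0 < poly (pderiv p) x"
    and lo: "\<And>a. a \<in> A \<Longrightarrow> a < y \<Longrightarrow> (\<forall>c\<in>A. \<not> (a < c \<and> c < y)) \<Longrightarrow> poly p a < v"
    and up: "\<And>a. a \<in> A \<Longrightarrow> y < a \<Longrightarrow> (\<forall>c\<in>A. \<not> (y < c \<and> c < a)) \<Longrightarrow> v < poly p a"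
  shows "\<exists>x\<in>gap A y. poly p x = v"
proof -
  obtain l where l: "l < y" "poly p l < v" "\<And>x. l < x \<Longrightarrow> x \<le> y \<Longrightarrow> x \<in> gap A y"
  proof (cases "\<exists>x\<in>A. x < y")
    case True
    then obtain a where a: "a \<in> A" "a < y" "\<And>c. c \<in> A \<Longrightarrow> c < y \<Longrightarrow> c \<le> a"
      using lower_neighbor[OF A(1)] by metis
    show ?thesis
    proof (rule that[of a])
      have "\<forall>c\<in>A. \<not> (a < c \<and> c < y)"
        using a(3) leD by blast
      then show "poly p a < v" by (rule lo[OF a(1,2)])
      fix x assume x: "a < x" "x \<le> y"
      show "x \<in> gap A y"
      proof (rule gapI)
        fix c assume c: "c \<in> A"
        with A(2) have "c < y \<or> y < c" by (metis linorder_neqE)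
        then show "c < x \<and> c < y \<or> x < c \<and> y < c" using a(3)[OF c] x by auto
      qed
    qed (rule a)
  next
    case False
    then have g: "x \<in> gap A y" if "x \<le> y" for x
      using that A(2) False by (intro gapI) (metis linorder_neqE order.strict_trans1 order.strict_trans2)
    have "\<exists>l<y. poly p l < v"
      by (rule poly_unbounded_below) (use g pos in auto)
    then show ?thesis using that g by auto
  qed
  obtain u where u: "y < u" "v < poly p u" "\<And>x. x < u \<Longrightarrow> y \<le> x \<Longrightarrow> x \<in> gap A y"
  proof (cases "\<exists>x\<in>A. y < x")
    case True
    then obtain a where a: "a \<in> A" "y < a" "\<And>c. c \<in> A \<Longrightarrow> y < c \<Longrightarrow> a \<le> c"
      using upper_neighbor[OF A(1)] by metis
    show ?thesis
    proof (rule that[of a])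
      have "\<forall>c\<in>A. \<not> (y < c \<and> c < a)" using a(3) leD by blast
      then show "v < poly p a" by (rule up[OF a(1,2)])
      fix x assume x: "x < a" "y \<le> x"
      show "x \<in> gap A y"
      proof (rule gapI)
        fix c assume c: "c \<in> A"
        with A(2) have "c < y \<or> y < c" by (metis linorder_neqE)
        then show "c < x \<and> c < y \<or> x < c \<and> y < c" using a(3)[OF c] x by auto
      qed
    qed (rule a)
  next
    case False
    then have g: "x \<in> gap A y" if "y \<le> x" for x
      using that A(2) False by (intro gapI) (metis linorder_neqE order.strict_trans1 order.strict_trans2)
    have "\<exists>l>y. v < poly p l"
      by (rule poly_unbounded_above) (use g pos in auto)
    then show ?thesis using that g by auto
  qed
  have "\<exists>c. l < c \<and> c < u \<and> poly (p - [:v:]) c = 0"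
    by (rule poly_ivt_up) (use l u in auto)
  then obtain c where "l < c" "c < u" "poly p c = v" by auto
  then show ?thesis using l(3)[of c] u(3)[of c] by (metis linear)
qed

text \<open>
  Consider two gaps, over two real closed fields, on which \<open>p\<close> and \<open>p'\<close> increase, and suppose that
  each endpoint of the second gap corresponds to one of the first with equal sign. A sign taken by \<open>p\<close> on the first gap is
  then taken by \<open>p'\<close> on the second, because the signs at the endpoints decide which signs occur between them.
\<close>

lemma gap_sign_point_up:
  fixes p :: "'a::real_closed poly" and p' :: "'b::real_closed poly"
  assumes A: "finite A" "y \<notin> A" and pos: "\<And>x. x \<in> gap A y \<Longrightarrow> 0 < poly (pderiv p) x"
    and A': "finite A'" "y' \<notin> A'" and pos': "\<And>x. x \<in> gap A' y' \<Longrightarrow> 0 < poly (pderiv p') x"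
    and lo: "\<And>a'. a' \<in> A' \<Longrightarrow> a' < y' \<Longrightarrow> (\<forall>c\<in>A'. \<not> (a' < c \<and> c < y')) \<Longrightarrow>
        \<exists>a. a < y \<and> (\<forall>c\<in>A. \<not> (a < c \<and> c < y)) \<and> sg (poly p a) = sg (poly p' a')"
    and up: "\<And>a'. a' \<in> A' \<Longrightarrow> y' < a' \<Longrightarrow> (\<forall>c\<in>A'. \<not> (y' < c \<and> c < a')) \<Longrightarrow>
        \<exists>a. y < a \<and> (\<forall>c\<in>A. \<not> (y < c \<and> c < a)) \<and> sg (poly p a) = sg (poly p' a')"
  shows "\<exists>x\<in>gap A' y'. sg (poly p' x) = sg (poly p y)"
proof -
  \<comment> \<open>at most one lower and one upper endpoint, collected in sets because either may be missing\<close>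
  define L where "L = {a'\<in>A'. a' < y' \<and> (\<forall>c\<in>A'. \<not> (a' < c \<and> c < y'))}"
  define U where "U = {a'\<in>A'. y' < a' \<and> (\<forall>c\<in>A'. \<not> (y' < c \<and> c < a'))}"
  have lowI: "x \<in> gap A y" if "a < x" "x < y" "\<forall>c\<in>A. \<not> (a < c \<and> c < y)" for x a
    using that A(2) by (intro gapI) (metis linorder_neqE order.strict_trans)
  have upI: "x \<in> gap A y" if "y < x" "x < a" "\<forall>c\<in>A. \<not> (y < c \<and> c < a)" for x a
    using that A(2) by (intro gapI) (metis linorder_neqE order.strict_trans)
  have L: "0 \<le> poly p' a \<Longrightarrow> 0 < poly p y" if "a \<in> L" for a
  proof -
    obtain b where b: "b < y" "\<forall>c\<in>A. \<not> (b < c \<and> c < y)" "sg (poly p b) = sg (poly p' a)"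
      using lo[of a] \<open>a \<in> L\<close> unfolding L_def by blast
    have "poly p b < poly p y" using b by (intro poly_strict_mono pos lowI[of b]) auto
    then show "0 \<le> poly p' a \<Longrightarrow> 0 < poly p y" using sg_eqD(4)[OF b(3)] by linarith
  qed
  have U: "poly p' a \<le> 0 \<Longrightarrow> poly p y < 0" if "a \<in> U" for a
  proof -
    obtain b where b: "y < b" "\<forall>c\<in>A. \<not> (y < c \<and> c < b)" "sg (poly p b) = sg (poly p' a)"
      using up[of a] \<open>a \<in> U\<close> unfolding U_def by blast
    have "poly p y < poly p b" using b by (intro poly_strict_mono pos upI[of _ b]) auto
    then show "poly p' a \<le> 0 \<Longrightarrow> poly p y < 0" using sg_eqD(5)[OF b(3)] by linarith
  qed
  have LU: "poly p' a < poly p' b" if ab: "a \<in> L" "b \<in> U" for a b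
  proof (rule poly_strict_mono)
    show "a < b" using ab by (auto simp: L_def U_def)
    fix x assume "a < x" "x < b"
    have "x \<in> gap A' y'"
    proof (rule gapI)
      fix c assume c: "c \<in> A'"
      with A'(2) have "c < y' \<or> y' < c" by (metis linorder_neqE)
      moreover have "\<not> (a < c \<and> c < y')" "\<not> (y' < c \<and> c < b)" using ab c by (auto simp: L_def U_def)
      ultimately have "c \<le> a \<or> b \<le> c" by auto
      moreover have "a < y'" "y' < b" using ab by (auto simp: L_def U_def)
      ultimately show "c < x \<and> c < y' \<or> x < c \<and> y' < c" using \<open>a < x\<close> \<open>x < b\<close> by auto
    qed
    then show "0 < poly (pderiv p') x" by (rule pos')
  qed
  have L2: "poly p' a < 0" if "a \<in> L" "\<not> 0 < poly p y" for a using L[OF that(1)] that(2) not_le by blast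
  have U2: "0 < poly p' a" if "a \<in> U" "\<not> poly p y < 0" for a using U[OF that(1)] that(2) not_le by blast
  \<comment> \<open>a value \<open>v\<close> between the bounds \<open>L'\<close> and \<open>U'\<close> has the required sign\<close>
  define L' where "L' = poly p' ` L \<union> (if 0 < poly p y then {0} else {})"
  define U' where "U' = poly p' ` U \<union> (if poly p y < 0 then {0} else {})"
  have fin: "finite L'" "finite U'" using A'(1) by (auto simp: L'_def U'_def L_def U_def)
  have "\<exists>v. sg v = sg (poly p y) \<and> (\<forall>a\<in>L. poly p' a < v) \<and> (\<forall>a\<in>U. v < poly p' a)"
  proof (cases "poly p y = 0")
    case True
    then show ?thesis using L2 U2 by (intro exI[of _ 0]) auto
  next
    case False
    have "l < u" if "l \<in> L'" "u \<in> U'" for l u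
      using that LU L2 U2 False unfolding L'_def U'_def by (auto split: if_splits)
    from finite_between[OF fin this] obtain v where v: "\<forall>l\<in>L'. l < v" "\<forall>u\<in>U'. v < u" by blast
    have "sg v = sg (poly p y)" using v False
      by (auto simp: L'_def U'_def sg_def split: if_splits)
    then show ?thesis using v by (auto simp: L'_def U'_def)
  qed
  then obtain v where v: "sg v = sg (poly p y)" "\<And>a. a \<in> L \<Longrightarrow> poly p' a < v" "\<And>a. a \<in> U \<Longrightarrow> v < poly p' a" by blast
  have "\<exists>x\<in>gap A' y'. poly p' x = v"
    by (rule gap_value[OF A']) (use v pos' in \<open>auto simp: L_def U_def\<close>)
  then show ?thesis using v(1) by metis
qed

section \<open>Matching sign tables over two real closed fields\<close>

text \<open>
  Two families of univariate polynomials over two real closed fields have the same sign table. Instead of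
  listing roots and intervals, the relation \<open>\<rho>\<close> associates points that occupy the same position in both tables: it is total on
  both sides, preserves the signs of all members, and respects the position relative to each root. In particular it is
  a bijection between roots, while points of corresponding intervals may be related arbitrarily. In this form a table
  restricts to subfamilies for free.
\<close>

definition table_match ::
  "('a::real_closed \<Rightarrow> 'b::real_closed \<Rightarrow> bool) \<Rightarrow> 'i set \<Rightarrow> ('i \<Rightarrow> 'a poly) \<Rightarrow> ('i \<Rightarrow> 'b poly) \<Rightarrow> bool" where
  "table_match \<rho> I P P' \<longleftrightarrow> (\<forall>y. \<exists>y'. \<rho> y y') \<and> (\<forall>y'. \<exists>y. \<rho> y y') \<and>
     (\<forall>i\<in>I. \<forall>y y'. \<rho> y y' \<longrightarrow> sg (poly (P i) y) = sg (poly (P' i) y')) \<and>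
     (\<forall>i\<in>I. \<forall>a a' y y'. P i \<noteq> 0 \<longrightarrow> poly (P i) a = 0 \<longrightarrow> \<rho> a a' \<longrightarrow> \<rho> y y' \<longrightarrow>
        (a < y \<longleftrightarrow> a' < y') \<and> (y < a \<longleftrightarrow> y' < a'))"

lemma table_matchD:
  assumes "table_match \<rho> I P P'"
  shows "\<exists>y'. \<rho> y y'" "\<exists>y. \<rho> y y'"
    "i \<in> I \<Longrightarrow> \<rho> y y' \<Longrightarrow> sg (poly (P i) y) = sg (poly (P' i) y')"
    "i \<in> I \<Longrightarrow> P i \<noteq> 0 \<Longrightarrow> poly (P i) a = 0 \<Longrightarrow> \<rho> a a' \<Longrightarrow> \<rho> y y' \<Longrightarrow>
       (a < y \<longleftrightarrow> a' < y') \<and> (y < a \<longleftrightarrow> y' < a')"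
  using assms unfolding table_match_def by blast+

text \<open>
  The field is infinite, so a polynomial all of whose signs are \<open>0\<close> vanishes.
\<close>

lemma table_match_zero_iff:
  assumes "table_match \<rho> I P P'" "i \<in> I"
  shows "P i = 0 \<longleftrightarrow> P' i = 0"
proof -
  have "(\<forall>y. poly (P i) y = 0) \<longleftrightarrow> (\<forall>y. poly (P' i) y = 0)"
    using table_matchD(1,2)[OF assms(1)] table_matchD(3)[OF assms] by (metis sg_eqD(1))
  then show ?thesis by (simp add: poly_all_0_iff_0)
qed

lemma table_match_root_iff:
  assumes "table_match \<rho> I P P'" "i \<in> I" "\<rho> a a'"
  shows "poly (P i) a = 0 \<longleftrightarrow> poly (P' i) a' = 0"
  using table_matchD(3)[OF assms] by (rule sg_eqD(1))

lemma table_match_sym: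
  assumes "table_match \<rho> I P P'"
  shows "table_match (\<lambda>y' y. \<rho> y y') I P' P"
  unfolding table_match_def
proof (intro conjI allI ballI impI)
  fix y y' show "\<exists>y'. \<rho> y' y" "\<exists>y. \<rho> y' y" using table_matchD(1,2)[OF assms] by blast+
next
  fix i y y' assume "i \<in> I" "\<rho> y' y"
  then show "sg (poly (P' i) y) = sg (poly (P i) y')" using table_matchD(3)[OF assms] by metis
next
  fix i a a' y y' assume *: "i \<in> I" "P' i \<noteq> 0" "poly (P' i) a = 0" "\<rho> a' a" "\<rho> y' y"
  have "P i \<noteq> 0" "poly (P i) a' = 0"
    using table_match_zero_iff[OF assms *(1)] table_match_root_iff[OF assms *(1,4)] * by auto
  from table_matchD(4)[OF assms *(1) this *(4,5)] show "a < y \<longleftrightarrow> a' < y'" "y < a \<longleftrightarrow> y' < a'" by auto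
qed

definition roots_of :: "'i set \<Rightarrow> ('i \<Rightarrow> 'a::comm_ring_1 poly) \<Rightarrow> 'a set" where
  "roots_of N P = {a. \<exists>i\<in>N. P i \<noteq> 0 \<and> poly (P i) a = 0}"

lemma finite_roots_of:
  fixes P :: "'i \<Rightarrow> 'a::idom poly"
  shows "finite N \<Longrightarrow> finite (roots_of N P)"
proof -
  assume "finite N"
  moreover have "roots_of N P = (\<Union>i\<in>{i\<in>N. P i \<noteq> 0}. {a. poly (P i) a = 0})" by (auto simp: roots_of_def)
  ultimately show ?thesis by (auto intro: poly_roots_finite)
qed

text \<open>
  A change of sign would produce a root inside the gap.
\<close>

lemma gap_const_sg:
  fixes q :: "'a::real_closed poly"
  assumes "\<And>a. poly q a = 0 \<Longrightarrow> a \<in> A" "y \<notin> A" "x \<in> gap A y"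
  shows "sg (poly q x) = sg (poly q y)"
proof (rule ccontr)
  assume ne: "sg (poly q x) \<noteq> sg (poly q y)"
  have "x \<notin> A" using assms(2,3) unfolding gap_def by (metis (mono_tags, lifting) linorder_neqE mem_Collect_eq order_less_irrefl)
  then have nz: "poly q x \<noteq> 0" "poly q y \<noteq> 0" using assms by auto
  then have "poly q x * poly q y < 0" using ne by (auto simp: sg_def mult_less_0_iff split: if_splits)
  moreover have "x \<noteq> y" using ne by auto
  ultimately obtain c where "poly q c = 0" "x < c \<and> c < y \<or> y < c \<and> c < x"
    using poly_ivt[of x y q] poly_ivt[of y x q] by (metis linorder_neqE mult.commute)
  then show False using assms(1)[of c] assms(3) unfolding gap_def by auto
qed

lemma table_match_roots_of:
  assumes tm: "table_match \<rho> J P P'" and N: "N \<subseteq> J" and "\<rho> a a'"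
  shows "a \<in> roots_of N P \<longleftrightarrow> a' \<in> roots_of N P'"
proof -
  have "P i \<noteq> 0 \<and> poly (P i) a = 0 \<longleftrightarrow> P' i \<noteq> 0 \<and> poly (P' i) a' = 0" if "i \<in> N" for i
    using table_match_zero_iff[OF tm, of i] table_match_root_iff[OF tm _ \<open>\<rho> a a'\<close>, of i] that N by auto
  then show ?thesis by (auto simp: roots_of_def)
qed

lemma table_match_cut:
  assumes tm: "table_match \<rho> J P P'" and N: "N \<subseteq> J" and "a \<in> roots_of N P" "\<rho> a a'" "\<rho> y y'"
  shows "a < y \<longleftrightarrow> a' < y'" "y < a \<longleftrightarrow> y' < a'"
proof -
  obtain i where "i \<in> N" "P i \<noteq> 0" "poly (P i) a = 0" using assms(3) by (auto simp: roots_of_def)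
  with table_matchD(4)[OF tm _ _ _ assms(4,5)] N show "a < y \<longleftrightarrow> a' < y'" "y < a \<longleftrightarrow> y' < a'" by blast+
qed

text \<open>
  The relation for the family \<open>N\<close> enlarged by \<open>p\<close>: points must have the same position relative to the roots of
  the members of \<open>N\<close> only, so roots of other polynomials that \<open>\<rho>\<close> took into account are forgotten.
\<close>

definition refine_rel ::
  "('a::real_closed \<Rightarrow> 'b::real_closed \<Rightarrow> bool) \<Rightarrow> 'i set \<Rightarrow> ('i \<Rightarrow> 'a poly) \<Rightarrow> ('i \<Rightarrow> 'b poly) \<Rightarrow>
     'a poly \<Rightarrow> 'b poly \<Rightarrow> 'a \<Rightarrow> 'b \<Rightarrow> bool" where
  "refine_rel \<rho> N P P' p p' y y' \<longleftrightarrow> (\<forall>i\<in>N. sg (poly (P i) y) = sg (poly (P' i) y')) \<and>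
     sg (poly p y) = sg (poly p' y') \<and>
     (\<forall>a\<in>roots_of N P. \<forall>a'. \<rho> a a' \<longrightarrow> (a < y \<longleftrightarrow> a' < y') \<and> (y < a \<longleftrightarrow> y' < a'))"

text \<open>
  A root of a member of \<open>N\<close> keeps its partner. Any other point \<open>y\<close> lies in a gap without roots of the derivative, where \<open>p\<close> is strictly monotone;
  the partner is found in the corresponding gap, with the sign of \<open>p\<close> prescribed by \<open>gap_sign_point_up\<close>.
\<close>

lemma refine_rel_total:
  assumes tm: "table_match \<rho> J P P'" and N: "N \<subseteq> J" "finite N"
    and d: "d \<in> N" "P d = pderiv p" "P' d = pderiv p'" "pderiv p \<noteq> 0"
    and H: "\<And>a a'. a \<in> roots_of N P \<Longrightarrow> \<rho> a a' \<Longrightarrow> sg (poly p a) = sg (poly p' a')"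
  shows "\<exists>y'. refine_rel \<rho> N P P' p p' y y'"
proof -
  define A where "A = roots_of N P"
  define A' where "A' = roots_of N P'"
  have fin: "finite A" "finite A'" using finite_roots_of N(2) by (auto simp: A_def A'_def)
  note AA = table_match_roots_of[OF tm N(1), folded A_def A'_def]
  note cut = table_match_cut[OF tm N(1), folded A_def]
  obtain z where z: "\<rho> y z" using table_matchD(1)[OF tm] by blast
  have sgN: "sg (poly (P i) y) = sg (poly (P' i) z)" if "i \<in> N" for i
    using table_matchD(3)[OF tm _ z] that N by blast
  have d': "pderiv p' \<noteq> 0" using table_match_zero_iff[OF tm, of d] d N by auto
  show ?thesis
  proof (cases "y \<in> A")
    case True
    then show ?thesis using sgN H[of y z] cut z unfolding refine_rel_def A_def by blast
  next
    case False
    then have zA: "z \<notin> A'" using AA[OF z] by simp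
    have rA: "poly (P i) a = 0 \<Longrightarrow> a \<in> A" if "i \<in> N" "P i \<noteq> 0" for a i
      using that by (auto simp: A_def roots_of_def)
    have rA': "poly (P' i) a = 0 \<Longrightarrow> a \<in> A'" if "i \<in> N" "P' i \<noteq> 0" for a i
      using that by (auto simp: A'_def roots_of_def)
    have lo: "\<exists>a. a < y \<and> (\<forall>c\<in>A. \<not> (a < c \<and> c < y)) \<and> sg (poly p a) = sg (poly p' a')"
      if a': "a' \<in> A'" "a' < z" "\<forall>c\<in>A'. \<not> (a' < c \<and> c < z)" for a'
    proof -
      obtain a where a: "\<rho> a a'" using table_matchD(2)[OF tm] by blast
      then have aA: "a \<in> A" using AA a' by blast
      have "\<not> (a < c \<and> c < y)" if c: "c \<in> A" for c
      proof -
        obtain c' where c': "\<rho> c c'" using table_matchD(1)[OF tm] by blast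
        then have "c' \<in> A'" using AA c by blast
        then show ?thesis using a'(3) cut[OF aA a c'] cut[OF c c' z] by blast
      qed
      then show ?thesis using cut[OF aA a z] a'(2) H a aA A_def by blast
    qed
    have up: "\<exists>a. y < a \<and> (\<forall>c\<in>A. \<not> (y < c \<and> c < a)) \<and> sg (poly p a) = sg (poly p' a')"
      if a': "a' \<in> A'" "z < a'" "\<forall>c\<in>A'. \<not> (z < c \<and> c < a')" for a'
    proof -
      obtain a where a: "\<rho> a a'" using table_matchD(2)[OF tm] by blast
      then have aA: "a \<in> A" using AA a' by blast
      have "\<not> (y < c \<and> c < a)" if c: "c \<in> A" for c
      proof -
        obtain c' where c': "\<rho> c c'" using table_matchD(1)[OF tm] by blast
        then have "c' \<in> A'" using AA c by blast
        then show ?thesis using a'(3) cut[OF aA a c'] cut[OF c c' z] by blast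
      qed
      then show ?thesis using cut[OF aA a z] a'(2) H a aA A_def by blast
    qed
    have sd: "sg (poly (pderiv p) x) = sg (poly (pderiv p) y)" if "x \<in> gap A y" for x
      by (rule gap_const_sg[OF _ False that]) (use rA[of d] d in auto)
    have sd': "sg (poly (pderiv p') x) = sg (poly (pderiv p) y)" if "x \<in> gap A' z" for x
    proof -
      have "sg (poly (pderiv p') x) = sg (poly (pderiv p') z)"
        by (rule gap_const_sg[OF _ zA that]) (use rA'[of d] d d' in auto)
      then show ?thesis using sgN[OF d(1)] d by simp
    qed
    have "poly (pderiv p) y \<noteq> 0" using False rA[of d] d by auto
    then consider "0 < poly (pderiv p) y" | "poly (pderiv p) y < 0" by (metis linorder_neqE)
    then have "\<exists>x\<in>gap A' z. sg (poly p' x) = sg (poly p y)"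
    proof cases
      case 1
      show ?thesis
      proof (rule gap_sign_point_up[OF fin(1) False _ fin(2) zA _ lo up])
        show "0 < poly (pderiv p) x" if "x \<in> gap A y" for x using sg_eqD(2)[OF sd[OF that]] 1 by simp
        show "0 < poly (pderiv p') x" if "x \<in> gap A' z" for x using sg_eqD(2)[OF sd'[OF that]] 1 by simp
      qed
    next
      case 2
      have "\<exists>x\<in>gap A' z. sg (poly (- p') x) = sg (poly (- p) y)"
      proof (rule gap_sign_point_up[OF fin(1) False _ fin(2) zA])
        show "0 < poly (pderiv (- p)) x" if "x \<in> gap A y" for x
          using sg_eqD(3)[OF sd[OF that]] 2 by (simp add: pderiv_minus)
        show "0 < poly (pderiv (- p')) x" if "x \<in> gap A' z" for x
          using sg_eqD(3)[OF sd'[OF that]] 2 by (simp add: pderiv_minus)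
      qed (use lo up in auto)
      then show ?thesis by simp
    qed
    then obtain x where x: "x \<in> gap A' z" "sg (poly p' x) = sg (poly p y)" by blast
    have sx: "sg (poly (P i) y) = sg (poly (P' i) x)" if i: "i \<in> N" for i
    proof (cases "P' i = 0")
      case True
      then have "P i = 0" using table_match_zero_iff[OF tm, of i] i N(1) by auto
      then show ?thesis using True by simp
    next
      case P: False
      have "sg (poly (P' i) x) = sg (poly (P' i) z)"
        by (rule gap_const_sg[OF _ zA x(1)]) (use rA' P i in auto)
      then show ?thesis using sgN[OF i] by simp
    qed
    have cx: "(a < y \<longleftrightarrow> a' < x) \<and> (y < a \<longleftrightarrow> x < a')" if "a \<in> A" "\<rho> a a'" for a a'
    proof -
      have "a' \<in> A'" using AA that by blast
      then show ?thesis using x(1) cut[OF that z] unfolding gap_def by auto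
    qed
    show ?thesis
      unfolding refine_rel_def A_def[symmetric]
      by (rule exI[of _ x]) (simp add: x(2) sx cx)
  qed
qed

lemma refine_rel_flip:
  assumes tm: "table_match \<rho> J P P'" and N: "N \<subseteq> J"
  shows "refine_rel (\<lambda>y' y. \<rho> y y') N P' P p' p y' y \<longleftrightarrow> refine_rel \<rho> N P P' p p' y y'"
proof -
  have "(\<forall>a\<in>roots_of N P'. \<forall>a'. \<rho> a' a \<longrightarrow> (a < y' \<longleftrightarrow> a' < y) \<and> (y' < a \<longleftrightarrow> y < a')) \<longleftrightarrow>
    (\<forall>a\<in>roots_of N P. \<forall>a'. \<rho> a a' \<longrightarrow> (a < y \<longleftrightarrow> a' < y') \<and> (y < a \<longleftrightarrow> y' < a'))"
    using table_match_roots_of[OF tm N] by blast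
  moreover have "(\<forall>i\<in>N. sg (poly (P' i) y') = sg (poly (P i) y)) \<longleftrightarrow> (\<forall>i\<in>N. sg (poly (P i) y) = sg (poly (P' i) y'))"
    "sg (poly p' y') = sg (poly p y) \<longleftrightarrow> sg (poly p y) = sg (poly p' y')" by auto
  ultimately show ?thesis unfolding refine_rel_def by simp
qed

lemma monotone_sg:
  fixes p :: "'a::real_closed poly"
  assumes "poly p a = 0" "a \<notin> A" "y \<in> gap A a"
    and "\<And>x. x \<in> gap A a \<Longrightarrow> sg (poly (pderiv p) x) = s" "s \<noteq> 0"
  shows "sg (poly p y) = s * (if a < y then 1 else if y < a then - 1 else 0)"
proof -
  have g: "x \<in> gap A a" if "a < x \<and> x < y \<or> y < x \<and> x < a" for x
    using that assms(2,3) by (intro gapI) (auto simp: gap_def dest: order.strict_trans)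
  have *: "sg (poly q y) = (if a < y then 1 else if y < a then - 1 else 0)"
    if "poly q a = 0" "\<And>x. x \<in> gap A a \<Longrightarrow> 0 < poly (pderiv q) x" for q :: "'a poly"
    using poly_strict_mono[of a y q] poly_strict_mono[of y a q] g that
    by (cases a y rule: linorder_cases) (auto simp: sg_def)
  from sg_cases assms(4)[of y] assms(3,5) have "s = 1 \<or> s = - 1" by metis
  then show ?thesis
  proof
    assume "s = 1"
    then show ?thesis using *[of p] assms(1,4) by auto
  next
    assume "s = - 1"
    then show ?thesis using *[of "- p"] assms(1,4) by (auto simp: pderiv_minus)
  qed
qed

text \<open>
  The inductive step of Cohen and Hoermander: if the family contains the derivative of \<open>p\<close>, and \<open>\<rho>\<close> is known to preserve
  the sign of \<open>p\<close> at the roots of the other members, then the table extends by \<open>p\<close>, because \<open>p\<close> is monotone between these roots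
  and has at most one root in each gap.
\<close>

lemma table_match_step:
  assumes tm: "table_match \<rho> J P P'" and N: "N \<subseteq> J" "finite N"
    and d: "d \<in> N" "P d = pderiv (P k)" "P' d = pderiv (P' k)" "pderiv (P k) \<noteq> 0"
    and H: "\<And>a a'. a \<in> roots_of N P \<Longrightarrow> \<rho> a a' \<Longrightarrow> sg (poly (P k) a) = sg (poly (P' k) a')"
  shows "table_match (refine_rel \<rho> N P P' (P k) (P' k)) (insert k N) P P'"
proof -
  define R where "R = refine_rel \<rho> N P P' (P k) (P' k)"
  define A where "A = roots_of N P"
  define A' where "A' = roots_of N P'"
  note AA = table_match_roots_of[OF tm N(1), folded A_def A'_def]
  have d': "pderiv (P' k) \<noteq> 0" using table_match_zero_iff[OF tm, of d] d N by auto
  have RN: "sg (poly (P i) y) = sg (poly (P' i) y')" if "R y y'" "i \<in> insert k N" for y y' i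
    using that unfolding R_def refine_rel_def by blast
  have Rcut: "(a < y \<longleftrightarrow> a' < y') \<and> (y < a \<longleftrightarrow> y' < a')" if "R y y'" "a \<in> A" "\<rho> a a'" for y y' a a'
    using that unfolding R_def refine_rel_def A_def by blast
  \<comment> \<open>a point of \<open>A\<close> has only one partner, since a root is separated from all other points\<close>
  have R_\<rho>: "\<rho> a a'" if "R a a'" "a \<in> A" for a a'
  proof -
    obtain b where b: "\<rho> a b" using table_matchD(1)[OF tm] by blast
    from Rcut[OF that(1,2) b] have "b = a'" by (metis linorder_neqE order_less_irrefl)
    then show ?thesis using b by simp
  qed
  have RA: "a \<in> A \<longleftrightarrow> a' \<in> A'" if "R a a'" for a a'
  proof -
    have "P i \<noteq> 0 \<and> poly (P i) a = 0 \<longleftrightarrow> P' i \<noteq> 0 \<and> poly (P' i) a' = 0" if "i \<in> N" for i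
      using table_match_zero_iff[OF tm, of i] sg_eqD(1)[OF RN[OF \<open>R a a'\<close>, of i]] that N by auto
    then show ?thesis by (auto simp: A_def A'_def roots_of_def)
  qed
  have cutA: "(a < y \<longleftrightarrow> a' < y') \<and> (y < a \<longleftrightarrow> y' < a')" if "R a a'" "R y y'" "a \<in> A" for a a' y y'
    using Rcut[OF that(2,3)] R_\<rho>[OF that(1,3)] by blast
  have cutk: "(a < y \<longleftrightarrow> a' < y') \<and> (y < a \<longleftrightarrow> y' < a')"
    if a: "R a a'" "poly (P k) a = 0" and y: "R y y'" for a a' y y'
  proof (cases "a \<in> A \<or> y \<in> A")
    case True
    then show ?thesis using cutA[OF a(1) y] cutA[OF y a(1)] by blast
  next
    case False
    then have A': "a' \<notin> A'" "y' \<notin> A'" using RA a y by blast+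
    show ?thesis
    proof (cases "y \<in> gap A a")
      case True
      have "y' \<in> gap A' a'"
        unfolding gap_def mem_Collect_eq
      proof (intro ballI)
        fix c' assume c': "c' \<in> A'"
        obtain c where c: "\<rho> c c'" using table_matchD(2)[OF tm] by blast
        then have "c \<in> A" using AA c' by blast
        then show "(c' < y' \<longleftrightarrow> c' < a') \<and> (y' < c' \<longleftrightarrow> a' < c')"
          using Rcut[OF a(1) _ c] Rcut[OF y _ c] True unfolding gap_def by blast
      qed
      define s where "s = sg (poly (pderiv (P k)) a)"
      have "a \<notin> A" using False by simp
      have rA: "poly (pderiv (P k)) c = 0 \<Longrightarrow> c \<in> A" for c
        using d by (auto simp: A_def roots_of_def intro!: bexI[of _ d])
      have rA': "poly (pderiv (P' k)) c = 0 \<Longrightarrow> c \<in> A'" for c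
        using d d' by (auto simp: A'_def roots_of_def intro!: bexI[of _ d])
      have s0: "s \<noteq> 0" using rA \<open>a \<notin> A\<close> by (auto simp: s_def)
      have s': "sg (poly (pderiv (P' k)) a') = s" using RN[OF a(1), of d] d by (simp add: s_def)
      have 1: "sg (poly (P k) y) = s * (if a < y then 1 else if y < a then - 1 else 0)"
        by (rule monotone_sg[OF a(2) \<open>a \<notin> A\<close> True _ s0])
          (use gap_const_sg[OF rA \<open>a \<notin> A\<close>] in \<open>auto simp: s_def\<close>)
      have "poly (P' k) a' = 0" using RN[OF a(1), of k] a(2) by simp
      then have 2: "sg (poly (P' k) y') = s * (if a' < y' then 1 else if y' < a' then - 1 else 0)"
        by (rule monotone_sg[OF _ A'(1) \<open>y' \<in> gap A' a'\<close> _ s0])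
          (use gap_const_sg[OF rA' A'(1)] s' in auto)
      have "(if a < y then 1 else if y < a then - 1 else 0 :: int) = (if a' < y' then 1 else if y' < a' then - 1 else 0)"
        using 1 2 RN[OF y, of k] s0 by simp
      then show ?thesis by (auto split: if_splits)
    next
      case notgap: False
      then obtain c where c: "c \<in> A" "\<not> (c < y \<and> c < a \<or> y < c \<and> a < c)"
        using gapI[of A y a] by blast
      then have "c < y \<and> a < c \<or> y < c \<and> c < a" using False by (metis linorder_neqE)
      moreover obtain c' where c': "\<rho> c c'" using table_matchD(1)[OF tm] by blast
      ultimately show ?thesis using Rcut[OF a(1) c(1) c'] Rcut[OF y c(1) c'] by auto
    qed
  qed
  show ?thesis
    unfolding table_match_def R_def[symmetric]
  proof (intro conjI allI ballI)
    fix y show "\<exists>y'. R y y'" unfolding R_def by (rule refine_rel_total[OF tm N d H])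
  next
    fix y'
    have "\<exists>y. refine_rel (\<lambda>y' y. \<rho> y y') N P' P (P' k) (P k) y' y"
    proof (rule refine_rel_total[OF table_match_sym[OF tm] N d(1,3,2) d'])
      fix a a' assume "a \<in> roots_of N P'" "\<rho> a' a"
      then show "sg (poly (P' k) a) = sg (poly (P k) a')"
        using H[of a' a] AA[of a' a] by (simp add: A_def A'_def)
    qed
    then show "\<exists>y. R y y'" unfolding R_def refine_rel_flip[OF tm N(1)] .
  next
    fix i y y' assume "i \<in> insert k N"
    then show "R y y' \<longrightarrow> sg (poly (P i) y) = sg (poly (P' i) y')" using RN by blast
  next
    fix i a a' y y' assume i: "i \<in> insert k N"
    then show "P i \<noteq> 0 \<longrightarrow> poly (P i) a = 0 \<longrightarrow> R a a' \<longrightarrow> R y y' \<longrightarrow>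
         (a < y \<longleftrightarrow> a' < y') \<and> (y < a \<longleftrightarrow> y' < a')"
      using cutk cutA[of a a' y y'] unfolding A_def roots_of_def by blast
  qed
qed

section \<open>Elimination of a variable\<close>

definition is_subring :: "'c::comm_ring_1 set \<Rightarrow> bool" where
  "is_subring S \<longleftrightarrow> 1 \<in> S \<and> (\<forall>x\<in>S. \<forall>y\<in>S. x - y \<in> S \<and> x * y \<in> S)"

lemma is_subringD:
  assumes "is_subring S"
  shows "0 \<in> S" "1 \<in> S" "x \<in> S \<Longrightarrow> - x \<in> S" "x \<in> S \<Longrightarrow> y \<in> S \<Longrightarrow> x - y \<in> S"
    "x \<in> S \<Longrightarrow> y \<in> S \<Longrightarrow> x + y \<in> S" "x \<in> S \<Longrightarrow> y \<in> S \<Longrightarrow> x * y \<in> S"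
    "x \<in> S \<Longrightarrow> x ^ n \<in> S" "of_nat n \<in> S"
proof -
  have d: "x - y \<in> S" if "x \<in> S" "y \<in> S" for x y using assms that by (auto simp: is_subring_def)
  show 1: "1 \<in> S" using assms by (auto simp: is_subring_def)
  show 0: "0 \<in> S" using d[OF 1 1] by simp
  have m: "- x \<in> S" if "x \<in> S" for x using d[OF 0 that] by simp
  then show "x \<in> S \<Longrightarrow> - x \<in> S" .
  show "x \<in> S \<Longrightarrow> y \<in> S \<Longrightarrow> x - y \<in> S" by (rule d)
  have a: "x + y \<in> S" if "x \<in> S" "y \<in> S" for x y using d[OF that(1) m[OF that(2)]] by simp
  then show "x \<in> S \<Longrightarrow> y \<in> S \<Longrightarrow> x + y \<in> S" .
  have t: "x \<in> S \<Longrightarrow> y \<in> S \<Longrightarrow> x * y \<in> S" for x y using assms by (auto simp: is_subring_def)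
  then show "x \<in> S \<Longrightarrow> y \<in> S \<Longrightarrow> x * y \<in> S" .
  show "x \<in> S \<Longrightarrow> x ^ n \<in> S" by (induction n) (auto simp: 1 t)
  show "of_nat n \<in> S" by (induction n) (auto simp: 0 1 a)
qed

lemma is_subring_sum:
  assumes "is_subring S" "\<And>i. i \<in> I \<Longrightarrow> f i \<in> S"
  shows "sum f I \<in> S"
  using assms(2) by (induction I rule: infinite_finite_induct) (auto simp: is_subringD[OF assms(1)])

text \<open>
  The polynomial ring over a subring that is not a type of its own.
\<close>

definition polys_over :: "'c::comm_ring_1 set \<Rightarrow> 'c poly set" where
  "polys_over S = {p. \<forall>i. coeff p i \<in> S}"

lemma polys_overD: "p \<in> polys_over S \<Longrightarrow> coeff p i \<in> S"
  by (simp add: polys_over_def)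

text \<open>
  The formal derivative over a ring that may have zero divisors.
\<close>

definition fderiv :: "'c::comm_ring_1 poly \<Rightarrow> 'c poly" where
  "fderiv p = (\<Sum>i<degree p. monom (of_nat (Suc i) * coeff p (Suc i)) i)"

lemma coeff_fderiv: "coeff (fderiv p) n = of_nat (Suc n) * coeff p (Suc n)"
  by (auto simp: fderiv_def coeff_sum coeff_monom coeff_eq_0 if_distrib simp del: of_nat_Suc cong: if_cong)

lemma degree_fderiv_le: "degree (fderiv p) \<le> degree p - 1"
  by (rule degree_le) (auto simp: coeff_fderiv coeff_eq_0 simp del: of_nat_Suc)

lemma polys_over_closed:
  assumes S: "is_subring S"
  shows "0 \<in> polys_over S" "c \<in> S \<Longrightarrow> [:c:] \<in> polys_over S" "c \<in> S \<Longrightarrow> monom c n \<in> polys_over S"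
    "p \<in> polys_over S \<Longrightarrow> q \<in> polys_over S \<Longrightarrow> p + q \<in> polys_over S"
    "p \<in> polys_over S \<Longrightarrow> q \<in> polys_over S \<Longrightarrow> p - q \<in> polys_over S"
    "p \<in> polys_over S \<Longrightarrow> q \<in> polys_over S \<Longrightarrow> p * q \<in> polys_over S"
    "c \<in> S \<Longrightarrow> p \<in> polys_over S \<Longrightarrow> Polynomial.smult c p \<in> polys_over S"
    "p \<in> polys_over S \<Longrightarrow> fderiv p \<in> polys_over S"
    "c \<in> S \<Longrightarrow> p \<in> polys_over S \<Longrightarrow> pCons c p \<in> polys_over S"
  using is_subringD[OF S]
  by (auto simp: polys_over_def coeff_mult coeff_fderiv coeff_pCons intro!: is_subring_sum[OF S]
      split: nat.splits simp del: of_nat_Suc)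

lemma poly_in_subring:
  assumes "is_subring S" "p \<in> polys_over S" "x \<in> S"
  shows "poly p x \<in> S"
  unfolding poly_altdef
  by (intro is_subring_sum assms(1) is_subringD[OF assms(1)] polys_overD[OF assms(2)] assms(3))

lemma degree_diff_cancel_less:
  fixes p q :: "'c::comm_ring_1 poly"
  assumes "degree p = n" "degree q \<le> n" "coeff p n = coeff q n"
  shows "p - q = 0 \<or> degree (p - q) < n"
proof (cases "n = 0")
  case True
  then have "p - q = 0" using assms by (intro poly_eqI) (auto simp: coeff_eq_0 le_zero_eq elim!: degree_eq_zeroE)
  then show ?thesis by simp
next
  case False
  have "degree (p - q) \<le> n" using assms by (intro degree_diff_le) auto
  moreover have "coeff (p - q) n = 0" using assms by simp
  ultimately show ?thesis by (metis False leading_coeff_0_iff le_neq_implies_less)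
qed

text \<open>
  Division with remainder without inverses: the dividend is multiplied by a power of the leading coefficient of the divisor.
\<close>

lemma pseudo_division_over:
  assumes S: "is_subring S" and D: "D \<in> polys_over S" and P: "P \<in> polys_over S"
  shows "\<exists>k q r. q \<in> polys_over S \<and> r \<in> polys_over S \<and>
    Polynomial.smult (lead_coeff D ^ k) P = D * q + r \<and> (r = 0 \<or> degree r < degree D)"
  using P
\<comment> \<open>the zero polynomial comes before the nonzero constants, which also have degree \<open>0\<close>\<close>
proof (induction "if P = 0 then 0 else Suc (degree P)" arbitrary: P rule: less_induct)
  case less
  note cl = polys_over_closed[OF S] is_subringD[OF S]
  show ?case
  proof (cases "P = 0 \<or> degree P < degree D")
    case True
    then show ?thesis using less.prems cl
      by (intro exI[of _ 0] exI[of _ P]) auto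
  next
    case False
    define m where "m = monom (lead_coeff P) (degree P - degree D)"
    define P1 where "P1 = Polynomial.smult (lead_coeff D) P - D * m"
    have mS: "m \<in> polys_over S" unfolding m_def by (intro cl polys_overD[OF less.prems])
    have lD: "lead_coeff D \<in> S" using D polys_overD by blast
    have P1S: "P1 \<in> polys_over S" unfolding P1_def by (intro cl less.prems D mS lD)
    have co: "coeff (D * m) (degree P) = lead_coeff D * lead_coeff P"
    proof -
      have "degree P - (degree P - degree D) = degree D" using False by auto
      then have "coeff (m * D) (degree P) = lead_coeff P * lead_coeff D" by (simp add: m_def coeff_monom_mult)
      then show ?thesis by (simp only: mult.commute)
    qed
    have dm: "degree (D * m) \<le> degree P"
    proof -
      have "degree D \<le> degree P" using False by auto
      then show ?thesis
        using degree_mult_le[of D m] degree_monom_le[of "lead_coeff P" "degree P - degree D"]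
        unfolding m_def by linarith
    qed
    have dP1: "P1 = 0 \<or> degree P1 < degree P"
    proof -
      have "degree P1 \<le> degree P" unfolding P1_def using dm degree_smult_le by (intro degree_diff_le) auto
      moreover have c0: "coeff P1 (degree P) = 0" by (simp add: P1_def co)
      ultimately show ?thesis by (metis leading_coeff_0_iff le_neq_implies_less)
    qed
    then have "(if P1 = 0 then 0 else Suc (degree P1)) < (if P = 0 then 0 else Suc (degree P))"
      using False by auto
    from less.hyps[OF this P1S] obtain k q r where kqr: "q \<in> polys_over S" "r \<in> polys_over S"
      "Polynomial.smult (lead_coeff D ^ k) P1 = D * q + r" "r = 0 \<or> degree r < degree D" by blast
    have "Polynomial.smult (lead_coeff D ^ Suc k) P
        = Polynomial.smult (lead_coeff D ^ k) (P1 + D * m)"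
      by (simp add: P1_def mult.commute)
    also have "\<dots> = D * (q + Polynomial.smult (lead_coeff D ^ k) m) + r"
      by (simp add: smult_add_right kqr(3) algebra_simps)
    finally have "Polynomial.smult (lead_coeff D ^ Suc k) P = D * (q + Polynomial.smult (lead_coeff D ^ k) m) + r" .
    moreover have "q + Polynomial.smult (lead_coeff D ^ k) m \<in> polys_over S" by (intro cl kqr mS lD)
    ultimately show ?thesis using kqr(2,4) by blast
  qed
qed

definition is_ring_hom :: "('a::comm_ring_1 \<Rightarrow> 'b::comm_ring_1) \<Rightarrow> bool" where
  "is_ring_hom h \<longleftrightarrow> h 1 = 1 \<and> (\<forall>x y. h (x + y) = h x + h y) \<and> (\<forall>x y. h (x * y) = h x * h y)"

lemma is_ring_homD:
  assumes "is_ring_hom h"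
  shows "h 1 = 1" "h (x + y) = h x + h y" "h (x * y) = h x * h y" "h 0 = 0" "h (- x) = - h x"
    "h (x - y) = h x - h y" "h (x ^ n) = h x ^ n" "h (of_nat n) = of_nat n"
proof -
  show 1: "h 1 = 1" and a: "h (x + y) = h x + h y" and m: "h (x * y) = h x * h y" for x y
    using assms by (auto simp: is_ring_hom_def)
  show 0: "h 0 = 0" using a[of 0 0] by simp
  show n: "h (- x) = - h x" for x using a[of x "- x"] 0 by (simp add: add_eq_0_iff)
  show "h (x - y) = h x - h y" using a[of x "- y"] n by simp
  show "h (x ^ n) = h x ^ n" by (induction n) (auto simp: 1 m)
  show "h (of_nat n) = of_nat n" by (induction n) (auto simp: 0 1 a)
qed

lemma is_ring_hom_sum: "is_ring_hom h \<Longrightarrow> h (sum f I) = (\<Sum>i\<in>I. h (f i))"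
  by (induction I rule: infinite_finite_induct) (auto simp: is_ring_homD)

lemma is_ring_hom_prod: "is_ring_hom h \<Longrightarrow> h (prod f I) = (\<Prod>i\<in>I. h (f i))"
  by (induction I rule: infinite_finite_induct) (auto simp: is_ring_homD)

lemma is_ring_hom_comp: "is_ring_hom h \<Longrightarrow> is_ring_hom g \<Longrightarrow> is_ring_hom (\<lambda>x. g (h x))"
  by (simp add: is_ring_hom_def)

lemma map_poly_hom:
  assumes h: "is_ring_hom h"
  shows "coeff (map_poly h p) i = h (coeff p i)" "map_poly h (p + q) = map_poly h p + map_poly h q"
    "map_poly h (p - q) = map_poly h p - map_poly h q" "map_poly h (- p) = - map_poly h p"
    "map_poly h (p * q) = map_poly h p * map_poly h q"
    "map_poly h (Polynomial.smult c p) = Polynomial.smult (h c) (map_poly h p)"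
    "map_poly h (pCons c p) = pCons (h c) (map_poly h p)"
    "map_poly h (monom c n) = monom (h c) n"
    "poly (map_poly h p) (h x) = h (poly p x)"
proof -
  have [simp]: "h 0 = 0" by (rule is_ring_homD[OF h])
  show c: "coeff (map_poly h p) i = h (coeff p i)" for p i by (simp add: coeff_map_poly)
  show "map_poly h (p + q) = map_poly h p + map_poly h q" "map_poly h (p - q) = map_poly h p - map_poly h q"
    "map_poly h (- p) = - map_poly h p" "map_poly h (p * q) = map_poly h p * map_poly h q"
    "map_poly h (Polynomial.smult c p) = Polynomial.smult (h c) (map_poly h p)"
    by (intro poly_eqI; simp add: c is_ring_homD[OF h] coeff_mult is_ring_hom_sum[OF h])+
  show pc: "map_poly h (pCons c p) = pCons (h c) (map_poly h p)" for c p by (simp add: map_poly_pCons)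
  show "map_poly h (monom c n) = monom (h c) n" by (simp add: map_poly_monom)
  show "poly (map_poly h p) (h x) = h (poly p x)"
    by (induction p) (simp_all add: pc is_ring_homD[OF h])
qed

lemma map_poly_hom_fderiv:
  fixes h :: "'a::comm_ring_1 \<Rightarrow> 'b::idom"
  shows "is_ring_hom h \<Longrightarrow> map_poly h (fderiv p) = pderiv (map_poly h p)"
  by (intro poly_eqI) (simp add: map_poly_hom coeff_fderiv coeff_pderiv is_ring_homD del: of_nat_Suc)

lemma table_match_reindex:
  assumes "table_match \<rho> I P P'" "\<And>j. j \<in> I2 \<Longrightarrow> \<exists>i\<in>I. Q j = P i \<and> Q' j = P' i"
  shows "table_match \<rho> I2 Q Q'"
  using assms(1) unfolding table_match_def
proof (elim conjE, intro conjI)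
  assume 1: "\<forall>i\<in>I. \<forall>y y'. \<rho> y y' \<longrightarrow> sg (poly (P i) y) = sg (poly (P' i) y')"
  then show "\<forall>i\<in>I2. \<forall>y y'. \<rho> y y' \<longrightarrow> sg (poly (Q i) y) = sg (poly (Q' i) y')"
    using assms(2) by metis
  assume 2: "\<forall>i\<in>I. \<forall>a a' y y'. P i \<noteq> 0 \<longrightarrow> poly (P i) a = 0 \<longrightarrow> \<rho> a a' \<longrightarrow> \<rho> y y' \<longrightarrow>
        (a < y \<longleftrightarrow> a' < y') \<and> (y < a \<longleftrightarrow> y' < a')"
  show "\<forall>i\<in>I2. \<forall>a a' y y'. Q i \<noteq> 0 \<longrightarrow> poly (Q i) a = 0 \<longrightarrow> \<rho> a a' \<longrightarrow> \<rho> y y' \<longrightarrow>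
        (a < y \<longleftrightarrow> a' < y') \<and> (y < a \<longleftrightarrow> y' < a')"
  proof
    fix j assume "j \<in> I2"
    then obtain i where "i \<in> I" "Q j = P i" using assms(2) by blast
    then show "\<forall>a a' y y'. Q j \<noteq> 0 \<longrightarrow> poly (Q j) a = 0 \<longrightarrow> \<rho> a a' \<longrightarrow> \<rho> y y' \<longrightarrow>
        (a < y \<longleftrightarrow> a' < y') \<and> (y < a \<longleftrightarrow> y' < a')" using 2 by auto
  qed
qed

text \<open>
  The termination measure of the elimination, compared in the multiset order.
\<close>

definition degrees :: "'c::comm_ring_1 poly set \<Rightarrow> nat multiset" where
  "degrees F = image_mset degree (mset_set F)"

lemma degrees_decrease:
  assumes "finite F" "p \<in> F" "finite E" "\<And>q. q \<in> E \<Longrightarrow> degree q < degree p"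
  shows "(degrees ((F - {p}) \<union> E), degrees F) \<in> Multiset.mult less_than"
proof -
  have 1: "(F - {p}) \<union> E = (F - {p}) \<union> (E - (F - {p}))" by auto
  have 2: "mset_set ((F - {p}) \<union> (E - (F - {p}))) = mset_set (F - {p}) + mset_set (E - (F - {p}))"
    using assms(1,3) by (intro mset_set_Union) auto
  have 3: "mset_set F = mset_set (F - {p}) + {#p#}"
    using assms(1,2) by (metis add_mset_add_single mset_set.remove)
  show ?thesis unfolding degrees_def 1 2 unfolding 3 image_mset_union
    by (rule one_step_implies_mult) (use assms in auto)
qed

text \<open>
  The polynomials in \<open>F\<close> have coefficients in a ring of parameters, and the homomorphisms \<open>h\<close> and \<open>h'\<close> are two choices
  of the parameters, in two real closed fields. The finite set \<open>Q\<close> of conditions is built by recursion. If some leading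
  coefficient vanishes at \<open>h\<close> then also at \<open>h'\<close>, and its term can be dropped. Otherwise, a member \<open>p\<close> of maximal degree is replaced by its
  derivative and its remainders modulo the other members and modulo the derivative: at a root of such a divisor the sign of
  \<open>p\<close> is that of the remainder, up to the sign of a leading coefficient, so \<open>table_match_step\<close> recovers the table of \<open>F\<close>.
  In both cases polynomials of smaller degree replace one member.
\<close>

lemma sign_table_elimination:
  fixes F :: "'c::comm_ring_1 poly set"
  assumes S: "is_subring S" and F: "finite F" "F \<subseteq> polys_over S"
  shows "\<exists>Q. finite Q \<and> Q \<subseteq> S \<and>
    (\<forall>(h :: 'c \<Rightarrow> 'a::real_closed) (h' :: 'c \<Rightarrow> 'b::real_closed). is_ring_hom h \<longrightarrow> is_ring_hom h' \<longrightarrow>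
       (\<forall>q\<in>Q. sg (h q) = sg (h' q)) \<longrightarrow> (\<exists>\<rho>. table_match \<rho> F (map_poly h) (map_poly h')))"
  using F
proof (induction "degrees F" arbitrary: F rule: wf_induct_rule[OF wf_mult[OF wf_less_than]])
  case (1 F)
  note F = 1(2,3)
  define good where "good F Q \<longleftrightarrow> finite Q \<and> Q \<subseteq> S \<and>
    (\<forall>(h :: 'c \<Rightarrow> 'a::real_closed) (h' :: 'c \<Rightarrow> 'b::real_closed). is_ring_hom h \<longrightarrow> is_ring_hom h' \<longrightarrow>
       (\<forall>q\<in>Q. sg (h q) = sg (h' q)) \<longrightarrow> (\<exists>\<rho>. table_match \<rho> F (map_poly h) (map_poly h')))" for F Q
  have goodD: "finite Q" "Q \<subseteq> S"
    "is_ring_hom h \<Longrightarrow> is_ring_hom h' \<Longrightarrow> (\<forall>q\<in>Q. sg (h q) = sg (h' q)) \<Longrightarrow> \<exists>\<rho>. table_match \<rho> F (map_poly h) (map_poly h')"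
    if "good F Q" for F Q and h :: "'c \<Rightarrow> 'a" and h' :: "'c \<Rightarrow> 'b"
    using that unfolding good_def by blast+
  have IH: "\<exists>Q. good ((F - {p}) \<union> E) Q"
    if "p \<in> F" "finite E" "E \<subseteq> polys_over S" "\<And>q. q \<in> E \<Longrightarrow> degree q < degree p" for p E
    unfolding good_def
    by (rule 1(1)[OF degrees_decrease[OF F(1) that(1,2,4)]]) (use that F in auto)
  note cl = polys_over_closed[OF S]
  show ?case
  proof (cases "\<forall>p\<in>F. degree p = 0")
    case True
    define Q where "Q = (\<lambda>p. coeff p 0) ` F"
    have "\<exists>\<rho>. table_match \<rho> F (map_poly h) (map_poly h')"
      if h: "is_ring_hom h" "is_ring_hom h'" "\<forall>q\<in>Q. sg (h q) = sg (h' q)"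
      for h :: "'c \<Rightarrow> 'a" and h' :: "'c \<Rightarrow> 'b"
    proof -
      have c: "map_poly h p = [:h (coeff p 0):]" "map_poly h' p = [:h' (coeff p 0):]" "sg (h (coeff p 0)) = sg (h' (coeff p 0))"
        if "p \<in> F" for p
      proof -
        obtain c where "p = [:c:]" using True \<open>p \<in> F\<close> by (meson degree_eq_zeroE)
        then show "map_poly h p = [:h (coeff p 0):]" "map_poly h' p = [:h' (coeff p 0):]"
          using map_poly_hom(7)[OF h(1), of c 0] map_poly_hom(7)[OF h(2), of c 0] by auto
        show "sg (h (coeff p 0)) = sg (h' (coeff p 0))" using h(3) that by (auto simp: Q_def)
      qed
      have "table_match (\<lambda>_ _. True) F (map_poly h) (map_poly h')"
        unfolding table_match_def using c by auto
      then show ?thesis by blast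
    qed
    moreover have "finite Q" "Q \<subseteq> S" using F by (auto simp: Q_def polys_over_def)
    ultimately show ?thesis by blast
  next
    case False
    define T where "T = {p\<in>F. degree p \<noteq> 0}"
    have T: "finite T" "T \<noteq> {}" "T \<subseteq> F" using False F by (auto simp: T_def)
    define m where "m = Max (degree ` T)"
    have "m \<in> degree ` T" unfolding m_def using T by (intro Max_in) auto
    then obtain p where p: "p \<in> F" "degree p = m" "m \<noteq> 0" by (auto simp: T_def)
    have mx: "degree q \<le> m" if "q \<in> F" for q
    proof (cases "q \<in> T")
      case True then show ?thesis unfolding m_def using T by auto
    next
      case False then show ?thesis using that by (auto simp: T_def)
    qed
    define N where "N = (F - {p}) \<union> {fderiv p}"
    have dlt: "degree (fderiv p) < m"
      using degree_fderiv_le[of p] p by linarith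
    have NS: "N \<subseteq> polys_over S" using F cl(8)[of p] p by (auto simp: N_def)
    define D where "D = {q\<in>N. degree q \<noteq> 0}"
    have Dm: "degree q \<le> m" if "q \<in> D" for q using that mx dlt by (auto simp: D_def N_def)
    define isrem where "isrem q k r \<longleftrightarrow> (\<exists>s. s \<in> polys_over S \<and> r \<in> polys_over S \<and>
        Polynomial.smult (lead_coeff q ^ k) p = q * s + r \<and> (r = 0 \<or> degree r < degree q))" for q k r
    have pS: "p \<in> polys_over S" using F p by auto
    have "\<forall>q\<in>D. \<exists>k r. isrem q k r"
    proof
      fix q assume "q \<in> D"
      then have "q \<in> polys_over S" using NS by (auto simp: D_def)
      from pseudo_division_over[OF S this pS] show "\<exists>k r. isrem q k r" unfolding isrem_def by blast
    qed
    from bchoice[OF this] obtain k where "\<forall>q\<in>D. \<exists>r. isrem q (k q) r" by blast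
    from bchoice[OF this] obtain r where "\<forall>q\<in>D. isrem q (k q) (r q)" by blast
    then have kr: "\<exists>s. s \<in> polys_over S \<and> r q \<in> polys_over S \<and>
        Polynomial.smult (lead_coeff q ^ k q) p = q * s + r q \<and> (r q = 0 \<or> degree (r q) < degree q)"
      if "q \<in> D" for q
      using that unfolding isrem_def by blast
    define J where "J = N \<union> r ` D"
    have finN: "finite N" using F by (auto simp: N_def)
    then have finD: "finite D" by (auto simp: D_def)
    have "\<exists>Q. good ((F - {p}) \<union> ({fderiv p} \<union> r ` D)) Q"
    proof (rule IH[OF p(1)])
      show "finite ({fderiv p} \<union> r ` D)" using finD by auto
      show "{fderiv p} \<union> r ` D \<subseteq> polys_over S" using kr cl(8)[OF pS] by blast
      fix q assume "q \<in> {fderiv p} \<union> r ` D"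
      then show "degree q < degree p"
      proof
        assume "q \<in> {fderiv p}" then show ?thesis using dlt p by simp
      next
        assume "q \<in> r ` D"
        then obtain d where d: "d \<in> D" "q = r d" by auto
        then show ?thesis using kr[OF d(1)] Dm[OF d(1)] p by auto
      qed
    qed
    moreover have "(F - {p}) \<union> ({fderiv p} \<union> r ` D) = J" by (auto simp: J_def N_def)
    ultimately obtain QJ where QJ: "good J QJ" by auto
    \<comment> \<open>the members without their leading terms, for parameters at which a leading coefficient vanishes\<close>
    define trunc where "trunc = (\<lambda>q :: 'c poly. q - monom (lead_coeff q) (degree q))"
    have "\<exists>Q. good ((F - {q}) \<union> {trunc q}) Q" if "q \<in> T" for q
    proof (rule IH)
      show "q \<in> F" "finite {trunc q}" using that T by auto
      show "{trunc q} \<subseteq> polys_over S"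
      proof -
        have "q \<in> polys_over S" using that T F by auto
        then have "trunc q \<in> polys_over S" unfolding trunc_def by (intro cl polys_overD)
        then show ?thesis by simp
      qed
      fix q' assume "q' \<in> {trunc q}"
      then have "q' = 0 \<or> degree q' < degree q"
        using degree_diff_cancel_less[of q "degree q" "monom (lead_coeff q) (degree q)"] degree_monom_le
        by (auto simp: trunc_def)
      then show "degree q' < degree q" using that by (auto simp: T_def)
    qed
    then have "\<forall>q\<in>T. \<exists>Q. good ((F - {q}) \<union> {trunc q}) Q" by blast
    from bchoice[OF this] obtain QT where QT: "\<And>q. q \<in> T \<Longrightarrow> good ((F - {q}) \<union> {trunc q}) (QT q)" by blast
    note QJ' = goodD[OF QJ] and QT' = goodD[OF QT]
    define Q where "Q = QJ \<union> (\<Union>q\<in>T. QT q) \<union> lead_coeff ` (insert (fderiv p) F)"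
    have finQ: "finite Q" using QJ'(1) QT'(1) T F by (auto simp: Q_def)
    have "lead_coeff q \<in> S" if "q \<in> insert (fderiv p) F" for q
      using that F cl(8)[OF pS] polys_overD by blast
    then have QS: "Q \<subseteq> S" using QJ'(2) QT'(2) by (auto simp: Q_def)
    have "\<exists>\<rho>. table_match \<rho> F (map_poly h) (map_poly h')"
      if h: "is_ring_hom h" "is_ring_hom h'" and hQ: "\<forall>q\<in>Q. sg (h q) = sg (h' q)"
      for h :: "'c \<Rightarrow> 'a" and h' :: "'c \<Rightarrow> 'b"
    proof (cases "\<exists>q\<in>T. h (lead_coeff q) = 0")
      case True
      then obtain q where q: "q \<in> T" "h (lead_coeff q) = 0" by blast
      have "lead_coeff q \<in> Q" using q T by (auto simp: Q_def)
      then have q': "h' (lead_coeff q) = 0" using hQ q sg_eqD(1) by metis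
      have "\<forall>x\<in>QT q. sg (h x) = sg (h' x)" using hQ q by (auto simp: Q_def)
      then obtain \<rho> where \<rho>: "table_match \<rho> ((F - {q}) \<union> {trunc q}) (map_poly h) (map_poly h')"
        using QT'(3)[OF q(1) h] by blast
      have "map_poly h q = map_poly h (trunc q)" "map_poly h' q = map_poly h' (trunc q)"
        unfolding trunc_def by (simp_all add: map_poly_hom[OF h(1)] map_poly_hom[OF h(2)] q q')
      then have "table_match \<rho> F (map_poly h) (map_poly h')"
        by (intro table_match_reindex[OF \<rho>]) blast
      then show ?thesis by blast
    next
      case nz: False
      obtain \<rho> where \<rho>: "table_match \<rho> J (map_poly h) (map_poly h')"
        using QJ'(3)[OF h] hQ by (auto simp: Q_def)
      have pT: "p \<in> T" using p by (auto simp: T_def)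
      \<comment> \<open>in characteristic \<open>0\<close> the leading coefficient of the derivative does not vanish at \<open>h\<close> either\<close>
      have hp: "coeff (pderiv (map_poly h p)) (m - 1) \<noteq> 0"
        using nz pT p by (auto simp: coeff_pderiv map_poly_hom[OF h(1)] simp del: of_nat_Suc)
      have hp2: "h (coeff (fderiv p) (m - 1)) \<noteq> 0"
        using hp by (simp add: map_poly_hom_fderiv[OF h(1), symmetric] map_poly_hom[OF h(1)])
      then have "coeff (fderiv p) (m - 1) \<noteq> 0" using is_ring_homD(4)[OF h(1)] by metis
      then have "degree (fderiv p) = m - 1" using dlt le_degree by fastforce
      then have hp3: "h (lead_coeff (fderiv p)) \<noteq> 0" using hp2 by simp
      have "table_match (refine_rel \<rho> N (map_poly h) (map_poly h') (map_poly h p) (map_poly h' p))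
          (insert p N) (map_poly h) (map_poly h')"
      proof (rule table_match_step[OF \<rho> _ finN, of "fderiv p"])
        show "N \<subseteq> J" "fderiv p \<in> N" by (auto simp: J_def N_def)
        show "map_poly h (fderiv p) = pderiv (map_poly h p)" "map_poly h' (fderiv p) = pderiv (map_poly h' p)"
          by (simp_all add: map_poly_hom_fderiv h)
        show "pderiv (map_poly h p) \<noteq> 0" using hp by auto
        fix a a' assume a: "a \<in> roots_of N (map_poly h)" "\<rho> a a'"
        then obtain q where q: "q \<in> N" "map_poly h q \<noteq> 0" "poly (map_poly h q) a = 0" by (auto simp: roots_of_def)
        have qD: "q \<in> D"
        proof (rule ccontr)
          assume "q \<notin> D"
          then obtain c where "q = [:c:]" using q(1) by (auto simp: D_def elim: degree_eq_zeroE)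
          then show False using q map_poly_hom(7)[OF h(1), of c 0] by auto
        qed
        have q': "poly (map_poly h' q) a' = 0"
          using table_match_root_iff[OF \<rho> _ a(2)] q by (auto simp: J_def)
        from kr[OF qD] obtain s where s: "Polynomial.smult (lead_coeff q ^ k q) p = q * s + r q" by blast
        have "h (lead_coeff q) ^ k q * poly (map_poly h p) a = poly (map_poly h (r q)) a"
          using arg_cong[OF s, of "\<lambda>x. poly (map_poly h x) a"] q(3)
          by (simp add: map_poly_hom[OF h(1)] is_ring_homD[OF h(1)])
        moreover have "h' (lead_coeff q) ^ k q * poly (map_poly h' p) a' = poly (map_poly h' (r q)) a'"
          using arg_cong[OF s, of "\<lambda>x. poly (map_poly h' x) a'"] q'
          by (simp add: map_poly_hom[OF h(2)] is_ring_homD[OF h(2)])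
        moreover have "sg (poly (map_poly h (r q)) a) = sg (poly (map_poly h' (r q)) a')"
          using table_matchD(3)[OF \<rho> _ a(2)] qD by (auto simp: J_def)
        ultimately have eq: "sg (h (lead_coeff q)) ^ k q * sg (poly (map_poly h p) a)
            = sg (h' (lead_coeff q)) ^ k q * sg (poly (map_poly h' p) a')"
          by (metis sg_mult sg_power)
        have "q = fderiv p \<or> q \<in> T" using qD by (auto simp: D_def N_def T_def)
        then have "h (lead_coeff q) \<noteq> 0" "lead_coeff q \<in> Q"
          using nz hp3 T by (auto simp: Q_def)
        then show "sg (poly (map_poly h p) a) = sg (poly (map_poly h' p) a')"
        proof -
          have e: "sg (h' (lead_coeff q)) = sg (h (lead_coeff q))" using hQ \<open>lead_coeff q \<in> Q\<close> by simp
          show ?thesis using eq \<open>h (lead_coeff q) \<noteq> 0\<close> unfolding e by simp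
        qed
      qed
      then have "table_match (refine_rel \<rho> N (map_poly h) (map_poly h') (map_poly h p) (map_poly h' p))
          F (map_poly h) (map_poly h')"
        by (rule table_match_reindex) (auto simp: N_def)
      then show ?thesis by blast
    qed
    then show ?thesis using finQ QS by blast
  qed
qed

section \<open>Specialisation of signs to real points\<close>

definition cst :: "real \<Rightarrow> 'n rpoly" where
  "cst = Poly_Mapping.single 0"

definition var :: "'n \<Rightarrow> 'n rpoly" where
  "var i = Poly_Mapping.single (Poly_Mapping.single i 1) 1"

lemma cst_hom: "is_ring_hom cst"
  by (simp add: is_ring_hom_def cst_def single_add mult_single)

lemma single_var: "Poly_Mapping.single (Poly_Mapping.single i k) 1 = (var i :: 'n rpoly) ^ k"
proof (induction k)
  case (Suc k)
  have "Poly_Mapping.single i (Suc k) = Poly_Mapping.single i 1 + Poly_Mapping.single i k"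
    by (simp add: single_add[symmetric])
  then have "Poly_Mapping.single (Poly_Mapping.single i (Suc k)) 1 = var i * Poly_Mapping.single (Poly_Mapping.single i k) (1::real)"
    by (simp only: var_def mult_single mult_1_left)
  then show ?case by (simp only: Suc power_Suc)
qed simp

lemma single_monomial:
  fixes m :: "'n::finite \<Rightarrow>\<^sub>0 nat"
  shows "Poly_Mapping.single m c = cst c * (\<Prod>i\<in>UNIV. var i ^ Poly_Mapping.lookup m i)"
proof -
  have "(\<Prod>i\<in>A. (var i :: 'n rpoly) ^ Poly_Mapping.lookup m i) = Poly_Mapping.single (\<Sum>i\<in>A. Poly_Mapping.single i (Poly_Mapping.lookup m i)) 1"
    if "finite A" for A
    using that by induction (simp_all add: single_var[symmetric] mult_single)
  moreover have "(\<Sum>i\<in>UNIV. Poly_Mapping.single i (Poly_Mapping.lookup m i)) = m"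
    by (rule poly_mapping_eqI) (simp add: lookup_sum lookup_single when_def sum.delta)
  ultimately show ?thesis by (simp add: cst_def mult_single)
qed

lemma sum_monomials: "(\<Sum>m\<in>Poly_Mapping.keys p. Poly_Mapping.single m (Poly_Mapping.lookup p m)) = p"
  by (rule poly_mapping_eqI) (simp add: lookup_sum lookup_single when_def sum.delta in_keys_iff)

lemma rpoly_induct [case_names cst var add mult]:
  fixes p :: "'n::finite rpoly"
  assumes "\<And>c. Pr (cst c)" "\<And>i. Pr (var i)" "\<And>p q. Pr p \<Longrightarrow> Pr q \<Longrightarrow> Pr (p + q)" "\<And>p q. Pr p \<Longrightarrow> Pr q \<Longrightarrow> Pr (p * q)"
  shows "Pr p"
proof -
  have 0: "Pr 0" "Pr 1" using assms(1)[of 0] assms(1)[of 1] by (simp_all add: is_ring_homD[OF cst_hom])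
  have pw: "Pr (q ^ k)" if "Pr q" for q k by (induction k) (auto intro: 0 assms that)
  have pr: "Pr (\<Prod>i\<in>A. var i ^ k i)" for A k
    by (induction A rule: infinite_finite_induct) (auto intro: 0 assms pw)
  have "Pr (\<Sum>m\<in>A. Poly_Mapping.single m (c m))" for A c
    by (induction A rule: infinite_finite_induct) (auto intro!: 0 assms(3) simp: single_monomial intro: assms pr)
  from this[of "Poly_Mapping.lookup p" "Poly_Mapping.keys p"] show ?thesis by (simp only: sum_monomials)
qed

lemma peval_superset:
  fixes x :: "real ^ 'n"
  assumes "finite A" "Poly_Mapping.keys p \<subseteq> A"
  shows "peval p x = (\<Sum>m\<in>A. Poly_Mapping.lookup p m * (\<Prod>i\<in>UNIV. (x $ i) ^ Poly_Mapping.lookup m i))"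
  unfolding peval_def using assms by (intro sum.mono_neutral_left) (auto simp: in_keys_iff)

lemma peval_single:
  fixes x :: "real ^ 'n"
  shows "peval (Poly_Mapping.single m c) x = c * (\<Prod>i\<in>UNIV. (x $ i) ^ Poly_Mapping.lookup m i)"
  by (cases "c = 0") (simp_all add: peval_def)

lemma peval_add: "peval (p + q) x = peval p x + peval q x"
proof -
  let ?A = "Poly_Mapping.keys p \<union> Poly_Mapping.keys q"
  have "Poly_Mapping.keys (p + q) \<subseteq> ?A" by (rule Poly_Mapping.keys_add)
  then show ?thesis
    by (simp add: peval_superset[of ?A] lookup_add sum.distrib[symmetric] algebra_simps)
qed

lemma peval_sum: "peval (sum f A) x = (\<Sum>a\<in>A. peval (f a) x)"
proof (induction A rule: infinite_finite_induct)
  case (insert a A) then show ?case by (simp add: peval_add)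
qed (simp_all add: peval_def)

lemma peval_mult:
  fixes x :: "real ^ 'n"
  shows "peval (p * q) x = peval p x * peval q x"
proof -
  let ?M = "\<lambda>m. \<Prod>i\<in>UNIV. (x $ i) ^ Poly_Mapping.lookup m i"
  have "p * q = (\<Sum>m\<in>Poly_Mapping.keys p. \<Sum>m'\<in>Poly_Mapping.keys q.
      Poly_Mapping.single (m + m') (Poly_Mapping.lookup p m * Poly_Mapping.lookup q m'))"
    by (subst (1 2) sum_monomials[symmetric]) (simp only: sum_product mult_single)
  then have "peval (p * q) x = (\<Sum>m\<in>Poly_Mapping.keys p. \<Sum>m'\<in>Poly_Mapping.keys q.
      (Poly_Mapping.lookup p m * Poly_Mapping.lookup q m') * ?M (m + m'))"
    by (simp only: peval_sum peval_single)
  also have "\<dots> = (\<Sum>m\<in>Poly_Mapping.keys p. \<Sum>m'\<in>Poly_Mapping.keys q.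
      (Poly_Mapping.lookup p m * ?M m) * (Poly_Mapping.lookup q m' * ?M m'))"
    by (intro sum.cong refl) (simp add: lookup_add power_add prod.distrib algebra_simps)
  also have "\<dots> = peval p x * peval q x" by (simp add: peval_def sum_product)
  finally show ?thesis .
qed

lemma peval_cst [simp]: "peval (cst c) x = c"
  by (simp add: cst_def peval_single)

lemma peval_var [simp]:
  fixes x :: "real ^ 'n"
  shows "peval (var i) x = x $ i"
proof -
  have "(\<Prod>j\<in>UNIV. (x $ j) ^ Poly_Mapping.lookup (Poly_Mapping.single i (1::nat)) j) = (\<Prod>j\<in>UNIV. if j = i then x $ i else 1)"
    by (intro prod.cong) (auto simp: lookup_single when_def)
  then show ?thesis by (simp add: var_def peval_single)
qed

lemma peval_hom: "is_ring_hom (\<lambda>p. peval p x)"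
  using peval_cst[of 1 x] by (simp add: is_ring_hom_def peval_add peval_mult is_ring_homD[OF cst_hom])

lemmas peval_simps [simp] = is_ring_homD[OF peval_hom]

inductive_set polys_in :: "'n set \<Rightarrow> 'n rpoly set" for V where
  cst: "cst c \<in> polys_in V"
| var: "i \<in> V \<Longrightarrow> var i \<in> polys_in V"
| add: "p \<in> polys_in V \<Longrightarrow> q \<in> polys_in V \<Longrightarrow> p + q \<in> polys_in V"
| mult: "p \<in> polys_in V \<Longrightarrow> q \<in> polys_in V \<Longrightarrow> p * q \<in> polys_in V"

lemma is_subring_polys_in: "is_subring (polys_in V)"
proof -
  have "1 \<in> polys_in V" using polys_in.cst[of 1 V] by (simp add: is_ring_homD[OF cst_hom])
  moreover have "p - q \<in> polys_in V" if "p \<in> polys_in V" "q \<in> polys_in V" for p q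
  proof -
    have "p - q = p + cst (- 1) * q" by (simp add: is_ring_homD[OF cst_hom])
    then show ?thesis using that by (metis polys_in.intros)
  qed
  ultimately show ?thesis by (auto simp: is_subring_def intro: polys_in.mult)
qed

lemma polys_in_UNIV: "(p :: 'n::finite rpoly) \<in> polys_in UNIV"
  by (induction p rule: rpoly_induct) (auto intro: polys_in.intros)

lemma peval_polys_in_cong:
  fixes x y :: "real ^ 'n"
  assumes "p \<in> polys_in V" "\<And>i. i \<in> V \<Longrightarrow> x $ i = y $ i"
  shows "peval p x = peval p y"
  using assms(1) by induction (auto simp: assms(2))

lemma polys_in_empty: "p \<in> polys_in {} \<Longrightarrow> \<exists>c. p = cst c"
proof (induction rule: polys_in.induct)
  case (add p q)
  then show ?case using is_ring_homD(2)[OF cst_hom] by metis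
next
  case (mult p q)
  then show ?case using is_ring_homD(3)[OF cst_hom] by metis
qed auto

lemma polys_in_insert:
  assumes "p \<in> polys_in (insert i V)"
  shows "\<exists>P\<in>polys_over (polys_in V). poly P (var i) = p"
  using assms
proof induction
  case (cst c)
  then show ?case using polys_over_closed(2)[OF is_subring_polys_in polys_in.cst] by (intro bexI[of _ "[:cst c:]"]) auto
next
  case (var j)
  note S = polys_over_closed[OF is_subring_polys_in] is_subringD[OF is_subring_polys_in]
  show ?case
  proof (cases "j = i")
    case True
    have "[:0, 1:] \<in> polys_over (polys_in V)" by (intro S)
    then show ?thesis using True by (intro bexI[of _ "[:0, 1:]"]) auto
  next
    case False
    then have "[:var j:] \<in> polys_over (polys_in V)" using var by (intro S polys_in.var) auto
    then show ?thesis by (intro bexI[of _ "[:var j:]"]) auto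
  qed
next
  case (add p q)
  then show ?case using polys_over_closed(4)[OF is_subring_polys_in] by (metis poly_add)
next
  case (mult p q)
  then show ?case using polys_over_closed(6)[OF is_subring_polys_in] by (metis poly_mult)
qed

text \<open>
  Positive reals are squares of invertible elements, so every ring homomorphism to an ordered field preserves signs.
\<close>

lemma hom_real_sg:
  fixes h :: "real \<Rightarrow> 'k::linordered_field"
  assumes h: "is_ring_hom h"
  shows "sg (h c) = sg c"
proof -
  have pos: "0 < h c" if "0 < c" for c
  proof -
    have "h (sqrt c) * h (sqrt c) = h c" using that by (simp add: is_ring_homD(3)[OF h, symmetric])
    moreover have "h c * h (inverse c) = 1" using that by (simp add: is_ring_homD[OF h] is_ring_homD(3)[OF h, symmetric])
    ultimately show ?thesis by (metis mult_zero_left not_square_less_zero linorder_neqE_linordered_idom zero_neq_one)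
  qed
  show ?thesis using pos[of c] pos[of "- c"] is_ring_homD(4,5)[OF h]
    by (cases c "0::real" rule: linorder_cases) (auto simp: sg_def)
qed

text \<open>
  The theorem of Artin and Lang for real closed \<open>K\<close>: induction on the set of variables that occur. Having found real values of
  the variables in \<open>V\<close> that satisfy the conditions of \<open>sign_table_elimination\<close>, the partner of \<open>h (var i)\<close>
  in the matching sign table is a suitable real value of the next variable.
\<close>

theorem sign_specialization:
  fixes h :: "'n::finite rpoly \<Rightarrow> 'k::real_closed"
  assumes h: "is_ring_hom h" and Q: "finite Q"
  shows "\<exists>x. \<forall>q\<in>Q. sg (h q) = sg (peval q x)"
proof -
  have "\<exists>x. \<forall>q\<in>Q. sg (h q) = sg (peval q x)" if "finite V" "finite Q" "Q \<subseteq> polys_in V" for V and Q :: "'n rpoly set"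
    using that
  proof (induction V arbitrary: Q)
    case empty
    have "sg (h q) = sg (peval q x)" if q: "q \<in> Q" for q x
    proof -
      obtain c where "q = cst c" using polys_in_empty empty q by blast
      then show ?thesis using hom_real_sg[OF is_ring_hom_comp[OF cst_hom h], of c] by simp
    qed
    then show ?case by blast
  next
    case (insert i V)
    have "\<forall>q\<in>Q. \<exists>P. P \<in> polys_over (polys_in V) \<and> poly P (var i) = q"
    proof
      fix q assume "q \<in> Q"
      then have "q \<in> polys_in (insert i V)" using insert.prems(2) by blast
      from polys_in_insert[OF this] show "\<exists>P. P \<in> polys_over (polys_in V) \<and> poly P (var i) = q" by blast
    qed
    from bchoice[OF this] obtain P where P: "\<And>q. q \<in> Q \<Longrightarrow> P q \<in> polys_over (polys_in V)"
      "\<And>q. q \<in> Q \<Longrightarrow> poly (P q) (var i) = q" by blast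
    have "finite (P ` Q)" "P ` Q \<subseteq> polys_over (polys_in V)" using insert.prems P by auto
    from sign_table_elimination[OF is_subring_polys_in this, where 'a = 'k and 'b = real]
    obtain Q' where Q': "finite Q'" "Q' \<subseteq> polys_in V" and
      elim: "\<forall>(h :: 'n rpoly \<Rightarrow> 'k) (h' :: 'n rpoly \<Rightarrow> real). is_ring_hom h \<longrightarrow> is_ring_hom h' \<longrightarrow>
        (\<forall>q\<in>Q'. sg (h q) = sg (h' q)) \<longrightarrow> (\<exists>\<rho>. table_match \<rho> (P ` Q) (map_poly h) (map_poly h'))"
      by (elim exE conjE)
    obtain x where x: "\<forall>q\<in>Q'. sg (h q) = sg (peval q x)" using insert.IH[OF Q'] by blast
    from elim[rule_format, OF h peval_hom, of x] this obtain \<rho> where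
      \<rho>: "table_match \<rho> (P ` Q) (map_poly h) (map_poly (\<lambda>p. peval p x))" by auto
    obtain y where y: "\<rho> (h (var i)) y" using table_matchD(1)[OF \<rho>] by blast
    define x' where "x' = (\<chi> j. if j = i then y else x $ j)"
    have "sg (h q) = sg (peval q x')" if q: "q \<in> Q" for q
    proof -
      have "map_poly (\<lambda>p. peval p x) (P q) = map_poly (\<lambda>p. peval p x') (P q)"
      proof (rule poly_eqI)
        fix k
        have "peval (coeff (P q) k) x = peval (coeff (P q) k) x'"
          using polys_overD[OF P(1)[OF q]] insert.hyps
          by (intro peval_polys_in_cong[where V = V]) (auto simp: x'_def)
        then show "coeff (map_poly (\<lambda>p. peval p x) (P q)) k = coeff (map_poly (\<lambda>p. peval p x') (P q)) k"
          by (simp add: map_poly_hom[OF peval_hom])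
      qed
      moreover have "y = peval (var i) x'" by (simp add: x'_def)
      ultimately have "poly (map_poly (\<lambda>p. peval p x) (P q)) y = peval q x'"
        using map_poly_hom(9)[OF peval_hom, of x' "P q" "var i"] P(2)[OF q] by simp
      moreover have "poly (map_poly h (P q)) (h (var i)) = h q"
        using map_poly_hom(9)[OF h, of "P q" "var i"] P(2)[OF q] by simp
      ultimately show ?thesis using table_matchD(3)[OF \<rho> _ y, of "P q"] q by simp
    qed
    then show ?case by blast
  qed
  from this[OF finite[of UNIV] Q] show ?thesis using polys_in_UNIV by blast
qed

section \<open>The real closure of an ordered field\<close>

text \<open>
  A cone of nonnegative elements of an unspecified subfield of the algebraic closure, namely of its set of differences.
  Working with the cone alone, Zorn's lemma enlarges subfield and ordering at the same time.
\<close>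

definition ordering_cone :: "'a::linordered_field alg_closure set \<Rightarrow> bool" where
  "ordering_cone T \<longleftrightarrow> (\<forall>x\<ge>0. to_ac x \<in> T) \<and>
     (\<forall>x\<in>T. \<forall>y\<in>T. x + y \<in> T \<and> x * y \<in> T \<and> (x - y)^2 \<in> T) \<and> (\<forall>x\<in>T. inverse x \<in> T) \<and> - 1 \<notin> T"

lemma ordering_coneD:
  assumes "ordering_cone T"
  shows "0 \<le> c \<Longrightarrow> to_ac c \<in> T" "x \<in> T \<Longrightarrow> y \<in> T \<Longrightarrow> x + y \<in> T" "x \<in> T \<Longrightarrow> y \<in> T \<Longrightarrow> x * y \<in> T"
    "x \<in> T \<Longrightarrow> y \<in> T \<Longrightarrow> (x - y)^2 \<in> T" "x \<in> T \<Longrightarrow> inverse x \<in> T" "- 1 \<notin> T" "0 \<in> T" "1 \<in> T"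
proof -
  have *: "to_ac x \<in> T" if "0 \<le> x" for x using assms that by (auto simp: ordering_cone_def)
  show "0 \<in> T" "1 \<in> T" using *[of 0] *[of 1] by simp_all
qed (use assms in \<open>auto simp: ordering_cone_def\<close>)

definition diff_set :: "'a::ab_group_add set \<Rightarrow> 'a set" where
  "diff_set T = {x - y | x y. x \<in> T \<and> y \<in> T}"

lemma diff_setE:
  assumes "z \<in> diff_set T"
  obtains x y where "x \<in> T" "y \<in> T" "z = x - y"
  using assms by (auto simp: diff_set_def)

lemma diff_setI: "x \<in> T \<Longrightarrow> y \<in> T \<Longrightarrow> x - y \<in> diff_set T"
  by (auto simp: diff_set_def)

lemma diff_set_closed:
  assumes T: "ordering_cone T"
  shows "x \<in> T \<Longrightarrow> x \<in> diff_set T" "x \<in> diff_set T \<Longrightarrow> y \<in> diff_set T \<Longrightarrow> x - y \<in> diff_set T"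
    "x \<in> diff_set T \<Longrightarrow> y \<in> diff_set T \<Longrightarrow> x + y \<in> diff_set T"
    "x \<in> diff_set T \<Longrightarrow> - x \<in> diff_set T"
    "x \<in> diff_set T \<Longrightarrow> y \<in> diff_set T \<Longrightarrow> x * y \<in> diff_set T" "x \<in> diff_set T \<Longrightarrow> x^2 \<in> T"
proof -
  note D = ordering_coneD[OF T]
  show "x \<in> T \<Longrightarrow> x \<in> diff_set T" using diff_setI[of x T 0] D by simp
  show "x \<in> diff_set T \<Longrightarrow> x^2 \<in> T" by (elim diff_setE) (simp add: D)
  show "x - y \<in> diff_set T" if xy: "x \<in> diff_set T" "y \<in> diff_set T"
  proof -
    obtain a b c d where ab: "a \<in> T" "b \<in> T" "x = a - b" "c \<in> T" "d \<in> T" "y = c - d"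
      using xy by (auto elim!: diff_setE)
    have "x - y = (a + d) - (b + c)" by (simp add: ab algebra_simps)
    moreover have "a + d \<in> T" "b + c \<in> T" using ab D(2,3) by blast+
    ultimately show ?thesis by (simp only: diff_setI)
  qed
  show "x + y \<in> diff_set T" if xy: "x \<in> diff_set T" "y \<in> diff_set T"
  proof -
    obtain a b c d where ab: "a \<in> T" "b \<in> T" "x = a - b" "c \<in> T" "d \<in> T" "y = c - d"
      using xy by (auto elim!: diff_setE)
    have "x + y = (a + c) - (b + d)" by (simp add: ab algebra_simps)
    moreover have "a + c \<in> T" "b + d \<in> T" using ab D(2,3) by blast+
    ultimately show ?thesis by (simp only: diff_setI)
  qed
  show "- x \<in> diff_set T" if xy: "x \<in> diff_set T"
  proof -
    obtain a b where "a \<in> T" "b \<in> T" "x = a - b" using xy by (auto elim!: diff_setE)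
    then show ?thesis using diff_setI[of b T a] by simp
  qed
  show "x * y \<in> diff_set T" if xy: "x \<in> diff_set T" "y \<in> diff_set T"
  proof -
    obtain a b c d where ab: "a \<in> T" "b \<in> T" "x = a - b" "c \<in> T" "d \<in> T" "y = c - d"
      using xy by (auto elim!: diff_setE)
    have "x * y = (a * c + b * d) - (a * d + b * c)" by (simp add: ab algebra_simps)
    moreover have "a * c + b * d \<in> T" "a * d + b * c \<in> T" using ab D(2,3) by blast+
    ultimately show ?thesis by (simp only: diff_setI)
  qed
qed

definition max_cone :: "'a::linordered_field alg_closure set" where
  "max_cone = (SOME M. ordering_cone M \<and> (\<forall>M2. ordering_cone M2 \<longrightarrow> M \<subseteq> M2 \<longrightarrow> M2 = M))"

lemma max_cone:
  fixes M2 :: "'a::linordered_field alg_closure set"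
  shows "ordering_cone (max_cone :: 'a alg_closure set)"
    "ordering_cone M2 \<Longrightarrow> max_cone \<subseteq> M2 \<Longrightarrow> M2 = max_cone"
proof -
  have "\<exists>M\<in>Collect ordering_cone. \<forall>M2\<in>Collect ordering_cone. M \<subseteq> M2 \<longrightarrow> M2 = (M :: 'a alg_closure set)"
  proof (rule subset_Zorn_nonempty)
    have "ordering_cone (to_ac ` {x::'a. 0 \<le> x})"
      unfolding ordering_cone_def
    proof (intro conjI ballI allI impI)
      fix x y assume "x \<in> to_ac ` {x::'a. 0 \<le> x}" "y \<in> to_ac ` {x::'a. 0 \<le> x}"
      then obtain a b where ab: "0 \<le> a" "0 \<le> b" "x = to_ac a" "y = to_ac b" by auto
      have "x + y = to_ac (a + b)" "x * y = to_ac (a * b)" "(x - y)^2 = to_ac ((a - b)^2)" by (simp_all add: ab)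
      then show "x + y \<in> to_ac ` {x::'a. 0 \<le> x}" "x * y \<in> to_ac ` {x::'a. 0 \<le> x}" "(x - y)^2 \<in> to_ac ` {x::'a. 0 \<le> x}"
        using ab by (metis (no_types, lifting) imageI mem_Collect_eq add_nonneg_nonneg mult_nonneg_nonneg zero_le_power2)+
    next
      fix x assume "x \<in> to_ac ` {x::'a. 0 \<le> x}"
      then obtain a where "0 \<le> a" "x = to_ac a" by auto
      then show "inverse x \<in> to_ac ` {x::'a. 0 \<le> x}" by (intro image_eqI[of _ _ "inverse a"]) auto
    next
      show "- 1 \<notin> to_ac ` {x::'a. 0 \<le> x}"
      proof
        assume "- 1 \<in> to_ac ` {x::'a. 0 \<le> x}"
        then obtain a :: 'a where "0 \<le> a" "to_ac (- 1) = to_ac a" by auto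
        then have "- 1 = a" by (simp only: to_ac_eq_iff)
        then show False using \<open>0 \<le> a\<close> by auto
      qed
    qed auto
    then show "Collect ordering_cone \<noteq> ({} :: 'a alg_closure set set)" by blast
  next
    fix C :: "'a alg_closure set set" assume "C \<noteq> {}" and ch: "subset.chain (Collect ordering_cone) C"
    then obtain M0 where M0: "M0 \<in> C" by auto
    have oc: "ordering_cone M2" if "M2 \<in> C" for M2 using ch that by (auto simp: subset.chain_def)
    have two: "\<exists>M2\<in>C. x \<in> M2 \<and> y \<in> M2" if xy: "x \<in> \<Union>C" "y \<in> \<Union>C" for x y
    proof -
      obtain M2 Y where "M2 \<in> C" "x \<in> M2" "Y \<in> C" "y \<in> Y" using xy by blast
      moreover then have "M2 \<subseteq> Y \<or> Y \<subseteq> M2" using ch by (auto simp: subset_chain_def)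
      ultimately show ?thesis by blast
    qed
    have "ordering_cone (\<Union>C)"
      unfolding ordering_cone_def
    proof (intro conjI ballI allI impI)
      fix x :: 'a assume "0 \<le> x" then show "to_ac x \<in> \<Union>C" using ordering_coneD(1)[OF oc[OF M0]] M0 by blast
    next
      fix x y assume "x \<in> \<Union>C" "y \<in> \<Union>C"
      from two[OF this] obtain M2 where M2: "M2 \<in> C" "x \<in> M2" "y \<in> M2" by blast
      note D = ordering_coneD[OF oc[OF M2(1)]]
      show "x + y \<in> \<Union>C" "x * y \<in> \<Union>C" "(x - y)^2 \<in> \<Union>C"
        using M2 D(2)[OF M2(2,3)] D(3)[OF M2(2,3)] D(4)[OF M2(2,3)] by blast+
    next
      fix x assume "x \<in> \<Union>C" then show "inverse x \<in> \<Union>C" using ordering_coneD(5)[OF oc] by blast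
    next
      show "- 1 \<notin> \<Union>C" using ordering_coneD(6)[OF oc] by blast
    qed
    then show "\<Union>C \<in> Collect ordering_cone" by simp
  qed
  then have "\<exists>M::'a alg_closure set. ordering_cone M \<and> (\<forall>M2. ordering_cone M2 \<longrightarrow> M \<subseteq> M2 \<longrightarrow> M2 = M)" by auto
  from someI_ex[OF this] show "ordering_cone (max_cone :: 'a alg_closure set)"
    "ordering_cone M2 \<Longrightarrow> max_cone \<subseteq> M2 \<Longrightarrow> M2 = max_cone"
    unfolding max_cone_def by blast+
qed

lemmas max_coneD = ordering_coneD[OF max_cone(1)]
lemmas max_cone_diffs = diff_set_closed[OF max_cone(1)]

text \<open>
  If \<open>x\<close> is not nonnegative, then \<open>- x\<close> can be adjoined to the cone without changing the subfield: an equation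
  \<open>- 1 = a - b * x\<close> would exhibit \<open>x\<close> as a quotient of nonnegative elements.
\<close>

lemma max_cone_total:
  assumes x: "x \<in> diff_set (max_cone :: 'a::linordered_field alg_closure set)"
  shows "x \<in> max_cone \<or> - x \<in> max_cone"
proof (cases "x \<in> max_cone")
  case nx: False
  define T where "T = {a - b * x | a b. a \<in> max_cone \<and> b \<in> max_cone}"
  note D = max_coneD and E = max_cone_diffs
  have TI: "a - b * x \<in> T" if "a \<in> max_cone" "b \<in> max_cone" for a b using that by (auto simp: T_def)
  have sub: "max_cone \<subseteq> T" using TI[OF _ D(7)] by auto
  have TE: "t \<in> diff_set max_cone" if "t \<in> T" for t
  proof -
    obtain a b where "a \<in> max_cone" "b \<in> max_cone" "t = a - b * x" using \<open>t \<in> T\<close> by (auto simp: T_def)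
    then show ?thesis using E(2)[OF E(1) E(5)[OF E(1) x]] by blast
  qed
  have Tm: "s * t \<in> T" if st: "s \<in> T" "t \<in> T" for s t
  proof -
    obtain a b c d where ab: "s = a - b * x" "t = c - d * x" "a \<in> max_cone" "b \<in> max_cone" "c \<in> max_cone" "d \<in> max_cone"
      using st unfolding T_def by blast
    have "s * t = (a * c + b * d * x^2) - (a * d + b * c) * x"
      by (simp add: ab algebra_simps power2_eq_square)
    moreover have "a * c + b * d * x^2 \<in> max_cone" "a * d + b * c \<in> max_cone"
      using ab E(6)[OF x] by (auto intro!: D(2,3))
    ultimately show ?thesis using TI by metis
  qed
  have "ordering_cone T"
    unfolding ordering_cone_def
  proof (intro conjI ballI allI impI)
    fix c :: 'a assume "0 \<le> c" then show "to_ac c \<in> T" using D(1) sub by blast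
  next
    fix s t assume st: "s \<in> T" "t \<in> T"
    then show "s * t \<in> T" by (rule Tm)
    obtain a b c d where ab: "s = a - b * x" "t = c - d * x" "a \<in> max_cone" "b \<in> max_cone" "c \<in> max_cone" "d \<in> max_cone"
      using st unfolding T_def by blast
    have "s + t = (a + c) - (b + d) * x" by (simp add: ab algebra_simps)
    then show "s + t \<in> T" using TI D(2) ab by metis
    show "(s - t)^2 \<in> T" using E(6)[OF E(2)[OF TE TE]] st sub by blast
  next
    fix t assume t: "t \<in> T"
    have "inverse t = t * inverse (t^2)" by (cases "t = 0") (auto simp: power2_eq_square)
    moreover have "inverse (t^2) \<in> T" using D(5)[OF E(6)[OF TE[OF t]]] sub by blast
    ultimately show "inverse t \<in> T" using Tm t by metis
  next
    show "- 1 \<notin> T"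
    proof
      assume "- 1 \<in> T"
      then obtain a b where ab: "a \<in> max_cone" "b \<in> max_cone" "- 1 = a - b * x" by (auto simp: T_def)
      then have bx: "b * x = 1 + a" by (metis add.commute diff_add_cancel diff_eq_eq minus_diff_eq uminus_add_conv_diff)
      have "b \<noteq> 0" using ab D(6) by auto
      then have "x = (1 + a) * inverse b" using bx by (simp add: field_simps)
      then have "x \<in> max_cone" using ab D(2,3,5,8) by metis
      then show False using nx by simp
    qed
  qed
  then have "T = max_cone" using max_cone(2) sub by blast
  then show ?thesis using TI[OF D(7,8)] by simp
qed simp

lemma max_cone_antisym: "x \<in> max_cone \<Longrightarrow> - x \<in> max_cone \<Longrightarrow> x = 0"
proof (rule ccontr)
  assume x: "x \<in> max_cone" "- x \<in> max_cone" "x \<noteq> 0"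
  have "- x * inverse x \<in> max_cone" using x max_coneD(3,5) by blast
  then show False using x(3) by (simp add: max_coneD(6))
qed

lemma diffs_max_cone_inverse: "x \<in> diff_set max_cone \<Longrightarrow> inverse x \<in> diff_set max_cone"
  using max_cone_total[of x] max_coneD(5)[of x] max_coneD(5)[of "- x"] max_cone_diffs(1,4)
  by (metis inverse_minus_eq minus_minus)

typedef (overloaded) 'a real_closure = "diff_set (max_cone :: 'a::linordered_field alg_closure set)"
  using max_coneD(7) diff_setI by blast

setup_lifting type_definition_real_closure

instantiation real_closure :: (linordered_field) linordered_field
begin

lift_definition zero_real_closure :: "'a real_closure" is 0 by (rule max_cone_diffs(1)[OF max_coneD(7)])
lift_definition one_real_closure :: "'a real_closure" is 1 by (rule max_cone_diffs(1)[OF max_coneD(8)])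
lift_definition plus_real_closure :: "'a real_closure \<Rightarrow> 'a real_closure \<Rightarrow> 'a real_closure" is "(+)" by (rule max_cone_diffs)
lift_definition minus_real_closure :: "'a real_closure \<Rightarrow> 'a real_closure \<Rightarrow> 'a real_closure" is "(-)" by (rule max_cone_diffs)
lift_definition uminus_real_closure :: "'a real_closure \<Rightarrow> 'a real_closure" is "uminus" by (rule max_cone_diffs)
lift_definition times_real_closure :: "'a real_closure \<Rightarrow> 'a real_closure \<Rightarrow> 'a real_closure" is "(*)" by (rule max_cone_diffs)
lift_definition inverse_real_closure :: "'a real_closure \<Rightarrow> 'a real_closure" is "inverse" by (rule diffs_max_cone_inverse)
lift_definition less_eq_real_closure :: "'a real_closure \<Rightarrow> 'a real_closure \<Rightarrow> bool" is "\<lambda>x y. y - x \<in> max_cone" .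
definition "less_real_closure (x :: 'a real_closure) y \<longleftrightarrow> x \<le> y \<and> x \<noteq> y"
definition "divide_real_closure (x :: 'a real_closure) y = x * inverse y"
definition "abs_real_closure (x :: 'a real_closure) = (if x < 0 then - x else x)"
definition "sgn_real_closure (x :: 'a real_closure) = (if x = 0 then 0 else if 0 < x then 1 else - 1 :: 'a real_closure)"

instance
proof
  fix a b c :: "'a real_closure"
  show "a * b * c = a * (b * c)" by transfer (simp add: algebra_simps)
  show "a * b = b * a" by transfer (simp add: algebra_simps)
  show "1 * a = a" by transfer simp
  show "a + b + c = a + (b + c)" by transfer (simp add: algebra_simps)
  show "a + b = b + a" by transfer (simp add: algebra_simps)
  show "0 + a = a" by transfer simp
  show "- a + a = 0" by transfer simp
  show "a + b - a = b" by transfer simp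
  show "a - b - c = a - (b + c)" by transfer (simp add: algebra_simps)
  show "0 * a = 0" "a * 0 = 0" by (transfer, simp)+
  show "a - b = a + - b" by transfer simp
  show "(a + b) * c = a * c + b * c" by transfer (simp add: algebra_simps)
  show "(0 :: 'a real_closure) \<noteq> 1" by transfer simp
  show "a \<noteq> 0 \<Longrightarrow> inverse a * a = 1" by transfer (rule left_inverse)
  show "a div b = a * inverse b" by (rule divide_real_closure_def)
  show "inverse (0 :: 'a real_closure) = 0" by transfer simp
  show "a \<le> a" by transfer (simp add: max_coneD)
  show "a \<le> b \<Longrightarrow> b \<le> c \<Longrightarrow> a \<le> c"
  proof transfer
    fix a b c :: "'a alg_closure" assume "b - a \<in> max_cone" "c - b \<in> max_cone"
    then have "(c - b) + (b - a) \<in> max_cone" by (intro max_coneD)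
    then show "c - a \<in> max_cone" by simp
  qed
  show anti: "a \<le> b \<Longrightarrow> b \<le> a \<Longrightarrow> a = b"
    by transfer (metis eq_iff_diff_eq_0 max_cone_antisym minus_diff_eq)
  show "a < b \<longleftrightarrow> a \<le> b \<and> \<not> b \<le> a"
    unfolding less_real_closure_def using anti \<open>a \<le> a\<close> by blast
  show "a \<le> b \<or> b \<le> a"
    by transfer (metis max_cone_diffs(2) max_cone_total minus_diff_eq)
  show "a \<le> b \<Longrightarrow> c + a \<le> c + b" by transfer simp
  have m: "x \<le> y \<Longrightarrow> 0 \<le> z \<Longrightarrow> z * x \<le> z * y" for x y z :: "'a real_closure"
    by transfer (metis diff_zero max_coneD(3) right_diff_distrib)
  show "a < b \<Longrightarrow> 0 < c \<Longrightarrow> c * a < c * b"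
  proof -
    assume ab: "a < b" "0 < c"
    have "c * a \<noteq> c * b"
    proof
      assume "c * a = c * b"
      then have "inverse c * (c * a) = inverse c * (c * b)" by simp
      moreover have "inverse c * (c * z) = z" for z using ab(2) unfolding less_real_closure_def
        by transfer (metis left_inverse mult.assoc mult_1)
      ultimately show False using ab by (simp add: less_real_closure_def)
    qed
    then show ?thesis using m[of a b c] ab by (simp add: less_real_closure_def)
  qed
  show "\<bar>a\<bar> = (if a < 0 then - a else a)" by (rule abs_real_closure_def)
  show "sgn a = (if a = 0 then 0 else if 0 < a then 1 else - 1)" by (rule sgn_real_closure_def)
qed

end

lemma Rep_hom: "is_ring_hom Rep_real_closure"
  by (simp add: is_ring_hom_def one_real_closure.rep_eq plus_real_closure.rep_eq times_real_closure.rep_eq)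

lemma Rep_nonneg: "0 \<le> a \<longleftrightarrow> Rep_real_closure a \<in> max_cone"
  by (simp add: less_eq_real_closure.rep_eq zero_real_closure.rep_eq)

lemma max_cone_Rep: "t \<in> max_cone \<Longrightarrow> \<exists>a\<ge>0. Rep_real_closure a = t"
  using Abs_real_closure_inverse[OF max_cone_diffs(1)] Rep_nonneg by metis

text \<open>
  Its values at an algebraic element \<open>z\<close> are the sums of squares with nonnegative weights in the field
  generated by \<open>z\<close>; this is the least candidate for an ordering of that field.
\<close>

inductive_set weighted_sos :: "'a::linordered_field poly set" where
  zero: "0 \<in> weighted_sos"
| add: "w \<in> weighted_sos \<Longrightarrow> 0 \<le> a \<Longrightarrow> w + Polynomial.smult a (s^2) \<in> weighted_sos"

lemma weighted_sos_square: "0 \<le> a \<Longrightarrow> Polynomial.smult a (s^2) \<in> weighted_sos"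
  using weighted_sos.add[OF weighted_sos.zero, of a s] by simp

lemma weighted_sos_plus:
  assumes "v \<in> weighted_sos" "w \<in> weighted_sos"
  shows "v + w \<in> weighted_sos"
  using assms(2,1) by (induction w rule: weighted_sos.induct) (auto simp: add.assoc[symmetric] intro: weighted_sos.intros)

lemma weighted_sos_mult:
  assumes v: "v \<in> weighted_sos" and "w \<in> weighted_sos"
  shows "v * w \<in> weighted_sos"
  using assms(2)
proof (induction w rule: weighted_sos.induct)
  case (add w a s)
  have "v * Polynomial.smult a (s^2) \<in> weighted_sos"
    using v
  proof (induction v rule: weighted_sos.induct)
    case (add v b t)
    have "(v + Polynomial.smult b (t^2)) * Polynomial.smult a (s^2) = v * Polynomial.smult a (s^2) + Polynomial.smult (b * a) ((t * s)^2)"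
      by (simp add: algebra_simps power_mult_distrib)
    then show ?case using weighted_sos.add[OF add.IH, of "b * a" "t * s"] add \<open>0 \<le> a\<close> by simp
  qed (simp add: weighted_sos.zero)
  then show ?case using weighted_sos_plus[OF add.IH] by (simp add: distrib_left)
qed (simp add: weighted_sos.zero)

lemma weighted_sos_nonneg: "w \<in> weighted_sos \<Longrightarrow> 0 \<le> poly w x"
  by (induction rule: weighted_sos.induct) (auto simp: poly_power)

text \<open>
  Induction on the degree, following Artin and Schreier. Let \<open>p\<close> change sign between \<open>a\<close> and \<open>b\<close>. If \<open>p\<close> has a root outside of
  this interval, or factors, then a factor of smaller degree changes sign. Otherwise let \<open>z\<close> be a root in the algebraic closure. The ordering extends to the field generated by \<open>z\<close>:
  a representation of \<open>- 1\<close> as a weighted sum of squares lifts to \<open>1 + w = p * g\<close> with \<open>deg g < deg p\<close>, where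
  the left side is positive everywhere, so \<open>g\<close> changes sign and has a root, a contradiction. By maximality of the cone \<open>z\<close> already
  belongs to the real closure.
\<close>

lemma real_closure_ivt:
  fixes p :: "'a::linordered_field real_closure poly"
  assumes "a < b" "poly p a * poly p b < 0"
  shows "\<exists>c. a < c \<and> c < b \<and> poly p c = 0"
  using assms(2)
proof (induction "degree p" arbitrary: p rule: less_induct)
  case less
  have p0: "p \<noteq> 0" using less.prems by auto
  have IHf: "\<exists>c. a < c \<and> c < b \<and> poly (q * r) c = 0"
    if qr: "degree q < degree p" "degree r < degree p" "poly (q * r) a * poly (q * r) b < 0" for q r
  proof -
    have "(poly q a * poly q b) * (poly r a * poly r b) < 0" using qr(3) by (simp add: algebra_simps)
    then have "poly q a * poly q b < 0 \<or> poly r a * poly r b < 0" unfolding mult_less_0_iff[of "poly q a * poly q b"] by blast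
    then obtain c where "a < c" "c < b" "poly q c = 0 \<or> poly r c = 0"
      using less.hyps[OF qr(1)] less.hyps[OF qr(2)] by blast
    then show ?thesis by (intro exI[of _ c]) auto
  qed
  show ?case
  proof (cases "\<exists>z. poly p z = 0")
    case True
    then obtain z where z: "poly p z = 0" by blast
    then obtain q where q: "p = [:- z, 1:] * q" by (metis dvdE poly_eq_0_iff_dvd)
    then have dq: "degree p = Suc (degree q)" using p0 by (subst q, subst degree_mult_eq) auto
    show ?thesis
    proof (cases "a < z \<and> z < b")
      case False
      have "z \<noteq> a" "z \<noteq> b" using z less.prems by auto
      then have "0 < (a - z) * (b - z)" using False assms(1) by (auto simp: zero_less_mult_iff)
      moreover have "((a - z) * (b - z)) * (poly q a * poly q b) < 0" using less.prems by (simp add: q algebra_simps)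
      ultimately have "poly q a * poly q b < 0" by (simp add: mult_less_0_iff[of "(a - z) * (b - z)"])
      then have "\<exists>c. a < c \<and> c < b \<and> poly q c = 0" using less.hyps dq by simp
      then show ?thesis by (auto simp: q)
    qed (use z in blast)
  next
    case noroot: False
    define ev where "ev s z = poly (map_poly Rep_real_closure s) z" for s :: "'a real_closure poly" and z
    have ev_hom: "is_ring_hom (\<lambda>s. ev s z)" for z
      by (simp add: is_ring_hom_def ev_def map_poly_hom[OF Rep_hom] is_ring_homD[OF Rep_hom])
    note evs = is_ring_homD[OF ev_hom]
    have ev_smult: "ev (Polynomial.smult c s) z = Rep_real_closure c * ev s z" for c s z
      by (simp add: ev_def map_poly_hom[OF Rep_hom])
    have ev_const: "ev [:c:] z = Rep_real_closure c" for c z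
      by (simp add: ev_def map_poly_hom[OF Rep_hom])
    have dp: "degree p > 0"
    proof (rule ccontr)
      assume "\<not> degree p > 0"
      then obtain c where "p = [:c:]" by (auto elim: degree_eq_zeroE)
      then show False using less.prems by (simp add: mult_less_0_iff)
    qed
    have "degree (map_poly Rep_real_closure p) = degree p"
      by (rule map_poly_degree_eq) (use p0 is_ring_homD(4)[OF Rep_hom] Rep_real_closure_inject in \<open>metis leading_coeff_0_iff\<close>)
    then have "degree (map_poly Rep_real_closure p) > 0" using dp by simp
    then obtain z where z: "ev p z = 0" unfolding ev_def using alg_closed_imp_poly_has_root by blast
    \<comment> \<open>\<open>p\<close> is the minimal polynomial of \<open>z\<close>, up to a constant\<close>
    have min: "degree p \<le> degree s" if "s \<noteq> 0" "ev s z = 0" for s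
    proof -
      define m where "m = arg_min degree (\<lambda>s. s \<noteq> 0 \<and> ev s z = 0)"
      have m: "m \<noteq> 0" "ev m z = 0" unfolding m_def using arg_min_natI[of "\<lambda>s. s \<noteq> 0 \<and> ev s z = 0" p degree] p0 z by auto
      have mle: "degree m \<le> degree s" if "s \<noteq> 0" "ev s z = 0" for s
        unfolding m_def using arg_min_nat_le[of "\<lambda>s. s \<noteq> 0 \<and> ev s z = 0" s degree] that by auto
      have "ev (p mod m) z = ev p z - ev m z * ev (p div m) z"
        by (metis evs(3) evs(6) minus_mult_div_eq_mod)
      then have "ev (p mod m) z = 0" using z m by simp
      then have "p mod m = 0" using mle[of "p mod m"] degree_mod_less[of m p] m(1) by linarith
      then have pm: "p = m * (p div m)" by (metis add.right_neutral mult_div_mod_eq)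
      have "p div m \<noteq> 0" using pm p0 by auto
      then have deg: "degree p = degree m + degree (p div m)" using pm m(1) by (metis degree_mult_eq)
      have "degree m > 0"
      proof (rule ccontr)
        assume "\<not> degree m > 0"
        then obtain c where c: "m = [:c:]" by (auto elim: degree_eq_zeroE)
        then have "Rep_real_closure c = Rep_real_closure 0" using m(2) ev_const is_ring_homD(4)[OF Rep_hom] by metis
        then show False using c m(1) by (simp add: Rep_real_closure_inject)
      qed
      moreover have "\<not> degree m < degree p"
      proof
        assume "degree m < degree p"
        then have "\<exists>c. a < c \<and> c < b \<and> poly (m * (p div m)) c = 0"
          using IHf[of m "p div m"] deg \<open>degree m > 0\<close> less.prems pm by auto
        then show False using noroot pm by metis
      qed
      ultimately show ?thesis using mle[OF that] by linarith
    qed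
    \<comment> \<open>by division with remainder, nonzero polynomial expressions in \<open>z\<close> have inverses of this form\<close>
    have inv: "\<exists>v. ev s z * ev v z = 1" if "ev s z \<noteq> 0" for s
      using that
    proof (induction "degree s" arbitrary: s rule: less_induct)
      case (less s)
      have s0: "s \<noteq> 0" using less.prems evs(4) by auto
      show ?case
      proof (cases "degree s = 0")
        case True
        then obtain c where c: "s = [:c:]" by (meson degree_eq_zeroE)
        then have "c \<noteq> 0" using s0 by auto
        then have "s * [:inverse c:] = 1" by (simp add: c one_pCons)
        then show ?thesis using evs(1,3) by metis
      next
        case False
        have eq: "ev (p mod s) z = - (ev s z * ev (p div s) z)"
          using z evs(2)[of "s * (p div s)" "p mod s"] evs(3) by (simp add: eq_neg_iff_add_eq_0 add.commute)
        show ?thesis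
        proof (cases "ev (p mod s) z = 0")
          case True
          then have e0: "ev (p div s) z = 0" using eq less.prems by simp
          have "p div s = 0"
          proof (rule ccontr)
            assume n0: "p div s \<noteq> 0"
            have "degree p \<le> degree (p div s)" by (rule min[OF n0 e0])
            moreover have "degree (p div s) < degree p" using degree_div_less dp False by blast
            ultimately show False by simp
          qed
          then have "degree p < degree s" using s0 p0 by (metis div_poly_eq_0_iff)
          then have "degree (s mod p) < degree s" using p0 degree_mod_less[of p s] dp by auto
          moreover have "ev (s mod p) z = ev s z" using z evs(6)[of s "p * (s div p)"] evs(3)
            by (simp add: minus_mult_div_eq_mod)
          ultimately show ?thesis using less.hyps[of "s mod p"] less.prems by metis
        next
          case r: False
          then have "p mod s \<noteq> 0" using evs(4) by auto
          then have "degree (p mod s) < degree s" using degree_mod_less[of s p] s0 by auto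
          from less.hyps[OF this r] obtain v where "ev (p mod s) z * ev v z = 1" by blast
          then have "ev s z * ev (- ((p div s) * v)) z = 1" using eq by (simp add: evs mult.assoc)
          then show ?thesis by blast
        qed
      qed
    qed
    define T where "T = (\<lambda>w. ev w z) ` weighted_sos"
    have TI: "w \<in> weighted_sos \<Longrightarrow> ev w z \<in> T" for w by (auto simp: T_def)
    have sq: "(ev s z)^2 \<in> T" for s using TI[OF weighted_sos_square[of 1 s]] by (simp add: evs)
    have sub: "max_cone \<subseteq> T"
    proof
      fix t :: "'a alg_closure" assume "t \<in> max_cone"
      then obtain a where a: "0 \<le> a" "Rep_real_closure a = t" using max_cone_Rep by blast
      moreover have "Polynomial.smult a (1^2) = [:a:]" by simp
      ultimately show "t \<in> T" using TI[OF weighted_sos_square[of a 1]] by (simp only: ev_const)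
    qed
    \<comment> \<open>reducing the squared polynomials modulo \<open>p\<close> bounds the degree of a weighted sum of squares\<close>
    have red: "\<exists>w'\<in>weighted_sos. ev w' z = ev w z \<and> degree w' + 2 \<le> 2 * degree p" if "w \<in> weighted_sos" for w
      using that
    proof induction
      case zero
      show ?case by (rule bexI[of _ 0]) (use dp in \<open>auto simp: weighted_sos.zero\<close>)
    next
      case (add w a s)
      then obtain w' where w': "w' \<in> weighted_sos" "ev w' z = ev w z" "degree w' + 2 \<le> 2 * degree p" by blast
      have e: "ev (s mod p) z = ev s z" using z evs(6)[of s "p * (s div p)"] evs(3)
        by (simp add: minus_mult_div_eq_mod)
      have "degree (s mod p) < degree p" using p0 degree_mod_less[of p s] dp by auto
      then have d: "degree ((s mod p)^2) + 2 \<le> 2 * degree p"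
        using degree_power_le[of "s mod p" 2] by linarith
      have "degree (w' + Polynomial.smult a ((s mod p)^2)) \<le> max (degree w') (degree ((s mod p)^2))"
        using degree_add_le_max degree_smult_le by (meson le_max_iff_disj max.mono order.trans order_refl)
      then have "degree (w' + Polynomial.smult a ((s mod p)^2)) + 2 \<le> 2 * degree p" using d w'(3) by linarith
      then show ?case
        by (intro bexI[OF _ weighted_sos.add[OF w'(1) add(2), of "s mod p"]]) (simp add: evs ev_smult w' e)
    qed
    have "ordering_cone T"
      unfolding ordering_cone_def
    proof (intro conjI ballI allI impI)
      fix c :: 'a assume "0 \<le> c" then show "to_ac c \<in> T" using max_coneD(1) sub by blast
    next
      fix x y assume "x \<in> T" "y \<in> T"
      then obtain v w where vw: "v \<in> weighted_sos" "w \<in> weighted_sos" "x = ev v z" "y = ev w z" by (auto simp: T_def)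
      show "x + y \<in> T" using TI[OF weighted_sos_plus[OF vw(1,2)]] vw by (simp add: evs)
      show "x * y \<in> T" using TI[OF weighted_sos_mult[OF vw(1,2)]] vw by (simp add: evs)
      show "(x - y)^2 \<in> T" using sq[of "v - w"] vw by (simp add: evs)
    next
      fix x assume "x \<in> T"
      then obtain w where w: "w \<in> weighted_sos" "x = ev w z" by (auto simp: T_def)
      show "inverse x \<in> T"
      proof (cases "x = 0")
        case False
        then obtain v where v: "x * ev v z = 1" using inv w by blast
        then have "inverse x = ev v z" by (rule inverse_unique)
        moreover have "x * (ev v z)^2 = ev v z" using v by (simp add: power2_eq_square mult.assoc[symmetric])
        ultimately have "inverse x = x * (ev v z)^2" by simp
        moreover obtain v' where "v' \<in> weighted_sos" "(ev v z)^2 = ev v' z" using sq[of v] by (auto simp: T_def)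
        ultimately show ?thesis using TI[OF weighted_sos_mult[OF w(1)]] w by (simp add: evs)
      qed (use sub max_coneD(7) in auto)
    next
      show "- 1 \<notin> T"
      proof
        assume "- 1 \<in> T"
        then obtain w where w: "w \<in> weighted_sos" "ev w z = - 1" "degree w + 2 \<le> 2 * degree p"
          using red unfolding T_def by (metis imageE)
        have pos: "0 < poly (1 + w) x" for x using weighted_sos_nonneg[OF w(1), of x] by (simp add: add_pos_nonneg)
        have n0: "1 + w \<noteq> 0" using pos[of 0] by (metis poly_0 less_irrefl)
        have "ev ((1 + w) mod p) z = ev (1 + w) z - ev p z * ev ((1 + w) div p) z"
          by (metis evs(3) evs(6) minus_mult_div_eq_mod)
        then have e0: "ev ((1 + w) mod p) z = 0" using z w by (simp add: evs)
        have "(1 + w) mod p = 0"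
          using min[OF _ e0] degree_mod_less[OF p0, of "1 + w"] by (meson not_le)
        then obtain g where g: "1 + w = p * g" by (metis dvdE mod_0_imp_dvd)
        then have g0: "g \<noteq> 0" using n0 by auto
        have "degree (1 + w) \<le> degree w" using degree_add_le_max[of 1 w] by simp
        moreover have "degree (1 + w) = degree p + degree g" using g g0 p0 by (simp add: degree_mult_eq)
        ultimately have dg: "degree g < degree p" using w(3) by linarith
        have "0 < poly (1 + w) a * poly (1 + w) b" using pos by simp
        then have "0 < (poly p a * poly p b) * (poly g a * poly g b)" by (simp add: g algebra_simps)
        then have "poly g a * poly g b < 0" using less.prems by (simp add: zero_less_mult_iff[of "poly p a * poly p b"])
        from less.hyps[OF dg this] obtain c where "poly g c = 0" by blast
        then show False using pos[of c] by (simp add: g)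
      qed
    qed
    then have TT: "T = max_cone" using max_cone(2) sub by blast
    \<comment> \<open>every \<open>z\<close> is a difference of squares, namely of \<open>(z + 1)/2\<close> and \<open>(z - 1)/2\<close>\<close>
    define half where "half = inverse (2 :: 'a real_closure)"
    have "[:0, 1:] = [:half, half:]^2 - [:- half, half:]^2"
      by (simp add: power2_eq_square half_def field_simps)
    then have "ev [:0, 1:] z = (ev [:half, half:] z)^2 - (ev [:- half, half:] z)^2" by (simp only: evs)
    moreover have "ev [:0, 1:] z = z" by (simp add: ev_def map_poly_hom[OF Rep_hom] is_ring_homD[OF Rep_hom])
    ultimately have "z \<in> diff_set max_cone" using diff_setI sq TT by metis
    then obtain c where c: "Rep_real_closure c = z" using Abs_real_closure_inverse by blast
    then have "Rep_real_closure (poly p c) = Rep_real_closure 0"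
      using z map_poly_hom(9)[OF Rep_hom, of p c] is_ring_homD(4)[OF Rep_hom] by (simp add: ev_def)
    then show ?thesis using noroot by (simp add: Rep_real_closure_inject)
  qed
qed

instance real_closure :: (linordered_field) real_closed
proof
  fix a b :: "'a real_closure" and f n
  assume ab: "a < b" and s: "(\<Sum>k\<le>n. f k * a ^ k) < 0" "0 < (\<Sum>k\<le>n. f k * b ^ k)"
  have e: "poly (\<Sum>k\<le>n. monom (f k) k) x = (\<Sum>k\<le>n. f k * x ^ k)" for x
    by (simp add: poly_sum poly_monom)
  show "\<exists>c>a. c < b \<and> (\<Sum>k\<le>n. f k * c ^ k) = 0"
    using real_closure_ivt[OF ab, of "\<Sum>k\<le>n. monom (f k) k"] s unfolding e
    by (auto simp: mult_neg_pos)
qed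

definition to_rc :: "'a::linordered_field \<Rightarrow> 'a real_closure" where
  "to_rc x = Abs_real_closure (to_ac x)"

lemma Rep_to_rc: "Rep_real_closure (to_rc x) = to_ac x"
proof -
  have "to_ac x \<in> diff_set max_cone"
    using max_coneD(1)[of x] max_coneD(1)[of "- x"] max_cone_diffs(1,4) by (metis le_cases minus_minus neg_0_le_iff_le to_ac_minus)
  then show ?thesis by (simp add: to_rc_def Abs_real_closure_inverse)
qed

lemma to_rc_hom: "is_ring_hom to_rc"
  by (simp add: is_ring_hom_def Rep_real_closure_inject[symmetric] Rep_to_rc is_ring_homD[OF Rep_hom])

lemma to_rc_nonneg: "0 \<le> x \<Longrightarrow> 0 \<le> to_rc x"
  by (simp add: Rep_nonneg Rep_to_rc max_coneD(1))

section \<open>Prime cones and their residue rings\<close>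

definition supp :: "'c::comm_ring_1 set \<Rightarrow> 'c set" where
  "supp \<alpha> = {x. x \<in> \<alpha> \<and> - x \<in> \<alpha>}"

text \<open>
  Equivalently, an ordering of the residue field at the prime ideal \<open>supp \<alpha>\<close>.
\<close>

definition prime_cone :: "'c::comm_ring_1 set \<Rightarrow> bool" where
  "prime_cone \<alpha> \<longleftrightarrow> (\<forall>x\<in>\<alpha>. \<forall>y\<in>\<alpha>. x + y \<in> \<alpha> \<and> x * y \<in> \<alpha>) \<and> (\<forall>x. x \<in> \<alpha> \<or> - x \<in> \<alpha>) \<and> - 1 \<notin> \<alpha> \<and>
     (\<forall>x y. x * y \<in> supp \<alpha> \<longrightarrow> x \<in> supp \<alpha> \<or> y \<in> supp \<alpha>)"

lemma prime_coneD:
  assumes "prime_cone \<alpha>"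
  shows "x \<in> \<alpha> \<Longrightarrow> y \<in> \<alpha> \<Longrightarrow> x + y \<in> \<alpha>" "x \<in> \<alpha> \<Longrightarrow> y \<in> \<alpha> \<Longrightarrow> x * y \<in> \<alpha>"
    "x \<in> \<alpha> \<or> - x \<in> \<alpha>" "- 1 \<notin> \<alpha>" "x * y \<in> supp \<alpha> \<Longrightarrow> x \<in> supp \<alpha> \<or> y \<in> supp \<alpha>"
    "x * x \<in> \<alpha>" "0 \<in> \<alpha>" "1 \<in> \<alpha>"
proof -
  show m: "x \<in> \<alpha> \<Longrightarrow> y \<in> \<alpha> \<Longrightarrow> x * y \<in> \<alpha>" and t: "x \<in> \<alpha> \<or> - x \<in> \<alpha>" for x y
    using assms by (auto simp: prime_cone_def)
  show s: "x * x \<in> \<alpha>" for x using t[of x] m[of x x] m[of "- x" "- x"] by auto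
  show "0 \<in> \<alpha>" "1 \<in> \<alpha>" using s[of 0] s[of 1] by auto
qed (use assms in \<open>auto simp: prime_cone_def\<close>)

lemma suppD:
  assumes \<alpha>: "prime_cone \<alpha>"
  shows "0 \<in> supp \<alpha>" "x \<in> supp \<alpha> \<Longrightarrow> y \<in> supp \<alpha> \<Longrightarrow> x + y \<in> supp \<alpha>" "x \<in> supp \<alpha> \<Longrightarrow> - x \<in> supp \<alpha>"
    "x \<in> supp \<alpha> \<Longrightarrow> y * x \<in> supp \<alpha>" "1 \<notin> supp \<alpha>" "x \<in> supp \<alpha> \<Longrightarrow> y \<in> supp \<alpha> \<Longrightarrow> x - y \<in> supp \<alpha>"
proof -
  note D = prime_coneD[OF \<alpha>]
  show "0 \<in> supp \<alpha>" using D(7) by (simp add: supp_def)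
  show a: "x \<in> supp \<alpha> \<Longrightarrow> y \<in> supp \<alpha> \<Longrightarrow> x + y \<in> supp \<alpha>" for x y
    using D(1)[of x y] D(1)[of "- x" "- y"] by (simp add: supp_def)
  show n: "x \<in> supp \<alpha> \<Longrightarrow> - x \<in> supp \<alpha>" for x by (simp add: supp_def)
  show "x \<in> supp \<alpha> \<Longrightarrow> y \<in> supp \<alpha> \<Longrightarrow> x - y \<in> supp \<alpha>" using a[of x "- y"] n[of y] by simp
  show "1 \<notin> supp \<alpha>" using D(4) by (simp add: supp_def)
  show "y * x \<in> supp \<alpha>" if x: "x \<in> supp \<alpha>"
    using D(3)[of y]
  proof
    assume "y \<in> \<alpha>"
    then show ?thesis using x D(2)[of y x] D(2)[of y "- x"] by (simp add: supp_def)
  next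
    assume "- y \<in> \<alpha>"
    then show ?thesis using x D(2)[of "- y" x] D(2)[of "- y" "- x"] by (simp add: supp_def)
  qed
qed

lemma prime_cone_supp_shift:
  assumes \<alpha>: "prime_cone \<alpha>" and "x - y \<in> supp \<alpha>"
  shows "x \<in> \<alpha> \<longleftrightarrow> y \<in> \<alpha>"
proof -
  have "x - y \<in> \<alpha>" "y - x \<in> \<alpha>" using assms(2) by (simp_all add: supp_def)
  then show ?thesis using prime_coneD(1)[OF \<alpha>, of "x - y" y] prime_coneD(1)[OF \<alpha>, of "y - x" x] by auto
qed

text \<open>
  A cone that is maximal among those avoiding the negatives of a multiplicative set \<open>S\<close> of squares is a prime cone.
  For \<open>S = {1}\<close> this is the usual extension of a preordering; a larger \<open>S\<close> prescribes elements outside the support.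
\<close>

lemma prime_cone_extension:
  fixes T S :: "'c::comm_ring_1 set"
  assumes T: "\<And>x y. x \<in> T \<Longrightarrow> y \<in> T \<Longrightarrow> x + y \<in> T" "\<And>x y. x \<in> T \<Longrightarrow> y \<in> T \<Longrightarrow> x * y \<in> T" "\<And>x. x * x \<in> T"
    and S: "1 \<in> S" "\<And>s t. s \<in> S \<Longrightarrow> t \<in> S \<Longrightarrow> s * t \<in> S" "\<And>s. s \<in> S \<Longrightarrow> \<exists>a. s = a * a"
    and TS: "\<And>s. s \<in> S \<Longrightarrow> - s \<notin> T"
  shows "\<exists>\<alpha>. prime_cone \<alpha> \<and> T \<subseteq> \<alpha> \<and> (\<forall>s\<in>S. - s \<notin> \<alpha>)"
proof -
  define pre where "pre P \<longleftrightarrow> T \<subseteq> P \<and> (\<forall>x\<in>P. \<forall>y\<in>P. x + y \<in> P \<and> x * y \<in> P) \<and> (\<forall>s\<in>S. - s \<notin> P)" for P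
  have preD: "T \<subseteq> P" "x \<in> P \<Longrightarrow> y \<in> P \<Longrightarrow> x + y \<in> P" "x \<in> P \<Longrightarrow> y \<in> P \<Longrightarrow> x * y \<in> P" "s \<in> S \<Longrightarrow> - s \<notin> P"
    if "pre P" for P x y s
    using that by (auto simp: pre_def)
  have "\<exists>M\<in>Collect pre. \<forall>Y\<in>Collect pre. M \<subseteq> Y \<longrightarrow> Y = M"
  proof (rule subset_Zorn_nonempty)
    have "pre T" using T TS by (auto simp: pre_def)
    then show "Collect pre \<noteq> {}" by blast
  next
    fix C assume "C \<noteq> {}" and ch: "subset.chain (Collect pre) C"
    then obtain M0 where M0: "M0 \<in> C" by auto
    have oc: "pre M" if "M \<in> C" for M using ch that by (auto simp: subset.chain_def)
    have two: "\<exists>M\<in>C. x \<in> M \<and> y \<in> M" if xy: "x \<in> \<Union>C" "y \<in> \<Union>C" for x y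
    proof -
      obtain M Y where MY: "M \<in> C" "x \<in> M" "Y \<in> C" "y \<in> Y" using xy by blast
      then have "M \<subseteq> Y \<or> Y \<subseteq> M" using ch by (auto simp: subset_chain_def)
      then show ?thesis using MY by blast
    qed
    have "x + y \<in> \<Union>C \<and> x * y \<in> \<Union>C" if xy: "x \<in> \<Union>C" "y \<in> \<Union>C" for x y
      using two[OF xy] preD(2,3)[OF oc] by blast
    moreover have "T \<subseteq> \<Union>C" using preD(1)[OF oc[OF M0]] M0 by blast
    ultimately have "pre (\<Union>C)" using preD(4)[OF oc] by (auto simp: pre_def)
    then show "\<Union>C \<in> Collect pre" by simp
  qed
  then obtain M where M: "pre M" and Mmax: "\<And>Y. pre Y \<Longrightarrow> M \<subseteq> Y \<Longrightarrow> Y = M" by blast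
  note D = preD[OF M]
  have sq: "x * x \<in> M" for x using T(3) D(1) by blast
  have S_M: "s \<in> M" if "s \<in> S" for s using S(3)[OF that] sq by auto
  have 0: "0 \<in> M" and 1: "1 \<in> M" using sq[of 0] sq[of 1] by auto
  \<comment> \<open>an element outside the maximal cone produces an obstruction\<close>
  have obstr: "\<exists>s\<in>S. \<exists>a\<in>M. \<exists>b\<in>M. - s = a + b * x" if x: "x \<notin> M" for x
  proof (rule ccontr)
    assume no: "\<not> ?thesis"
    define Y where "Y = {a + b * x | a b. a \<in> M \<and> b \<in> M}"
    have YI: "a + b * x \<in> Y" if "a \<in> M" "b \<in> M" for a b using that by (auto simp: Y_def)
    have "u + v \<in> Y \<and> u * v \<in> Y" if uv: "u \<in> Y" "v \<in> Y" for u v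
    proof -
      obtain a b c d where ab: "u = a + b * x" "v = c + d * x" "a \<in> M" "b \<in> M" "c \<in> M" "d \<in> M"
        using uv unfolding Y_def by blast
      have "u + v = (a + c) + (b + d) * x" by (simp add: ab algebra_simps)
      moreover have "u * v = (a * c + b * d * (x * x)) + (a * d + b * c) * x" by (simp add: ab algebra_simps)
      moreover have "a + c \<in> M" "b + d \<in> M" "a * c + b * d * (x * x) \<in> M" "a * d + b * c \<in> M"
        by (intro D(2,3) sq ab(3-6))+
      ultimately show ?thesis using YI by simp
    qed
    moreover have sub: "M \<subseteq> Y"
    proof
      fix u assume "u \<in> M" then show "u \<in> Y" using YI[of u 0] 0 by simp
    qed
    moreover have "- s \<notin> Y" if "s \<in> S" for s using no that by (auto simp: Y_def)
    ultimately have "pre Y" using D(1) unfolding pre_def by blast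
    then have "Y = M" using Mmax sub by blast
    then show False using YI[OF 0 1] x by simp
  qed
  have total: "x \<in> M \<or> - x \<in> M" for x
  proof (rule ccontr)
    assume n: "\<not> ?thesis"
    then obtain s a b where s: "s \<in> S" "a \<in> M" "b \<in> M" "- s = a + b * x" using obstr[of x] by blast
    obtain t c d where t: "t \<in> S" "c \<in> M" "d \<in> M" "- t = c + d * (- x)" using obstr[of "- x"] n by blast
    have 1: "b * x = - s - a" "d * x = t + c" using s(4) t(4) by (simp_all add: algebra_simps)
    have "b * d * (x * x) = (b * x) * (d * x)" by (simp add: algebra_simps)
    also have "\<dots> = - (s * t) - (s * c + a * t + a * c)" unfolding 1 by (simp add: algebra_simps)
    finally have "- (s * t) = b * d * (x * x) + (s * c + a * t + a * c)" by (simp add: algebra_simps)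
    moreover have "b * d * (x * x) + (s * c + a * t + a * c) \<in> M"
      by (rule D(2)[OF D(3)[OF D(3)[OF s(3) t(3)] sq] D(2)[OF D(2)[OF D(3)[OF S_M[OF s(1)] t(2)] D(3)[OF s(2) S_M[OF t(1)]]] D(3)[OF s(2) t(2)]]])
    ultimately show False using D(4)[OF S(2)[OF s(1) t(1)]] by simp
  qed
  have prime: "x \<in> supp M \<or> y \<in> supp M" if xy: "x * y \<in> supp M" for x y
  proof (rule ccontr)
    assume n: "\<not> ?thesis"
    \<comment> \<open>up to sign, neither \<open>u\<close> nor \<open>v\<close> belongs to the cone\<close>
    obtain u where u: "u \<notin> M" "u = x \<or> u = - x" using n by (auto simp: supp_def)
    obtain v where v: "v \<notin> M" "v = y \<or> v = - y" using n by (auto simp: supp_def)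
    have uv: "u * v \<in> M" "- (u * v) \<in> M" using xy u(2) v(2) by (auto simp: supp_def)
    obtain s a b where s: "s \<in> S" "a \<in> M" "b \<in> M" "- s = a + b * u" using obstr[OF u(1)] by blast
    obtain t c d where t: "t \<in> S" "c \<in> M" "d \<in> M" "- t = c + d * v" using obstr[OF v(1)] by blast
    have 1: "b * u = - (s + a)" "d * v = - (t + c)" using s(4) t(4) by (simp_all add: algebra_simps)
    have "(b * d) * (u * v) = (b * u) * (d * v)" by (simp add: algebra_simps)
    also have "\<dots> = s * t + (s * c + a * t + a * c)" unfolding 1 by (simp add: algebra_simps)
    finally have "- (s * t) = (b * d) * (- (u * v)) + (s * c + a * t + a * c)" by (simp add: algebra_simps)
    moreover have "(b * d) * (- (u * v)) + (s * c + a * t + a * c) \<in> M"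
      by (rule D(2)[OF D(3)[OF D(3)[OF s(3) t(3)] uv(2)] D(2)[OF D(2)[OF D(3)[OF S_M[OF s(1)] t(2)] D(3)[OF s(2) S_M[OF t(1)]]] D(3)[OF s(2) t(2)]]])
    ultimately show False using D(4)[OF S(2)[OF s(1) t(1)]] by simp
  qed
  have "prime_cone M" unfolding prime_cone_def using D(2,3) total D(4)[OF S(1)] prime by blast
  then show ?thesis using D(1,4) by blast
qed

text \<open>
  Since \<open>Q\<close> may contain negatives, this prescribes all signs, including zeros.
\<close>

definition realizable :: "'n::finite rpoly set \<Rightarrow> bool" where
  "realizable \<alpha> \<longleftrightarrow> (\<forall>Q. finite Q \<longrightarrow> (\<exists>x. \<forall>q\<in>Q. q \<in> \<alpha> \<longleftrightarrow> 0 \<le> peval q x))"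

definition critical_values_real :: "'n::finite rpoly set \<Rightarrow> bool" where
  "critical_values_real \<alpha> \<longleftrightarrow> (\<forall>f. (\<forall>i. pdiff i f \<in> supp \<alpha>) \<longrightarrow> (\<exists>c. f - cst c \<in> supp \<alpha>))"

definition bad_cone :: "'n::finite rpoly set \<Rightarrow> bool" where
  "bad_cone \<alpha> \<longleftrightarrow> prime_cone \<alpha> \<and> \<not> (realizable \<alpha> \<and> critical_values_real \<alpha>)"

text \<open>
  The residue ring of a prime cone is to become a type, and a type cannot depend on a variable. Therefore a single
  cone is fixed once and for all, chosen as a counterexample to the claim about prime cones if there is one. Proving the claim for
  this cone then proves it for all. If there is no counterexample, the cone belonging to the origin serves as a default.
\<close>

definition test_cone :: "'n::finite rpoly set" where
  "test_cone = (if \<exists>\<alpha>::'n rpoly set. bad_cone \<alpha> then SOME \<alpha>. bad_cone \<alpha> else {p. 0 \<le> peval p 0})"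

lemma prime_cone_test_cone: "prime_cone (test_cone :: 'n::finite rpoly set)"
proof (cases "\<exists>\<alpha>::'n rpoly set. bad_cone \<alpha>")
  case True
  then have "test_cone = (SOME \<alpha> :: 'n rpoly set. bad_cone \<alpha>)" by (simp add: test_cone_def)
  moreover have "prime_cone (SOME \<alpha> :: 'n rpoly set. bad_cone \<alpha>)"
    using someI_ex[OF True] unfolding bad_cone_def[of "Eps bad_cone"] by (rule conjunct1)
  ultimately show ?thesis by simp
next
  case False
  then show ?thesis by (auto simp: test_cone_def prime_cone_def supp_def)
qed

lemmas test_coneD = prime_coneD[OF prime_cone_test_cone] suppD[OF prime_cone_test_cone]

quotient_type (overloaded) 'n residue = "'n::finite rpoly" / "\<lambda>p q. p - q \<in> supp test_cone"
  morphisms rep_residue residue_class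
proof (rule equivpI)
  show "reflp (\<lambda>p q :: 'n rpoly. p - q \<in> supp test_cone)" by (auto simp: reflp_def test_coneD)
  show "symp (\<lambda>p q :: 'n rpoly. p - q \<in> supp test_cone)"
    unfolding symp_def using suppD(3)[OF prime_cone_test_cone] by (metis minus_diff_eq)
  show "transp (\<lambda>p q :: 'n rpoly. p - q \<in> supp test_cone)"
  proof (rule transpI)
    fix p q r :: "'n rpoly" assume "p - q \<in> supp test_cone" "q - r \<in> supp test_cone"
    from suppD(2)[OF prime_cone_test_cone this] show "p - r \<in> supp test_cone" by simp
  qed
qed

instantiation residue :: (finite) linordered_idom
begin

lift_definition zero_residue :: "'a residue" is 0 .
lift_definition one_residue :: "'a residue" is 1 .
lift_definition plus_residue :: "'a residue \<Rightarrow> 'a residue \<Rightarrow> 'a residue" is "(+)"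
proof -
  fix a b c d :: "'a rpoly" assume "a - b \<in> supp test_cone" "c - d \<in> supp test_cone"
  from suppD(2)[OF prime_cone_test_cone this] show "a + c - (b + d) \<in> supp test_cone" by (simp add: algebra_simps)
qed
lift_definition uminus_residue :: "'a residue \<Rightarrow> 'a residue" is "uminus"
proof -
  fix a b :: "'a rpoly" assume "a - b \<in> supp test_cone"
  from suppD(3)[OF prime_cone_test_cone this] show "- a - - b \<in> supp test_cone" by (simp add: algebra_simps)
qed
lift_definition minus_residue :: "'a residue \<Rightarrow> 'a residue \<Rightarrow> 'a residue" is "(-)"
proof -
  fix a b c d :: "'a rpoly" assume "a - b \<in> supp test_cone" "c - d \<in> supp test_cone"
  from suppD(6)[OF prime_cone_test_cone this] show "a - c - (b - d) \<in> supp test_cone" by (simp add: algebra_simps)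
qed
lift_definition times_residue :: "'a residue \<Rightarrow> 'a residue \<Rightarrow> 'a residue" is "(*)"
proof -
  note D = suppD[OF prime_cone_test_cone]
  fix a b c d :: "'a rpoly" assume h: "a - b \<in> supp test_cone" "c - d \<in> supp test_cone"
  have "c * (a - b) + b * (c - d) \<in> supp test_cone" by (rule D(2)[OF D(4)[OF h(1)] D(4)[OF h(2)]])
  then show "a * c - b * d \<in> supp test_cone" by (simp add: algebra_simps)
qed
lift_definition less_eq_residue :: "'a residue \<Rightarrow> 'a residue \<Rightarrow> bool" is "\<lambda>p q. q - p \<in> test_cone"
proof -
  fix a b c d :: "'a rpoly" assume "a - b \<in> supp test_cone" "c - d \<in> supp test_cone"
  from suppD(6)[OF prime_cone_test_cone this(2,1)] have "(c - a) - (d - b) \<in> supp test_cone" by (simp add: algebra_simps)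
  from prime_cone_supp_shift[OF prime_cone_test_cone this]
  show "(c - a \<in> test_cone) = (d - b \<in> test_cone)" .
qed
definition "less_residue (x :: 'a residue) y \<longleftrightarrow> x \<le> y \<and> x \<noteq> y"
definition "abs_residue (x :: 'a residue) = (if x < 0 then - x else x)"
definition "sgn_residue (x :: 'a residue) = (if x = 0 then 0 else if 0 < x then 1 else - 1 :: 'a residue)"

instance
proof
  fix a b c :: "'a residue"
  note z = suppD(1)[OF prime_cone_test_cone]
  show "a * b * c = a * (b * c)" by transfer (simp add: algebra_simps z)
  show "a * b = b * a" by transfer (simp add: algebra_simps z)
  show "1 * a = a" by transfer (simp add: z)
  show "a + b + c = a + (b + c)" by transfer (simp add: algebra_simps z)
  show "a + b = b + a" by transfer (simp add: algebra_simps z)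
  show "0 + a = a" by transfer (simp add: z)
  show "- a + a = 0" by transfer (simp add: z)
  show "a + b - a = b" by transfer (simp add: z)
  show "a - b - c = a - (b + c)" by transfer (simp add: algebra_simps z)
  show "0 * a = 0" "a * 0 = 0" by (transfer, simp add: z)+
  show "a - b = a + - b" by transfer (simp add: z)
  show "(a + b) * c = a * c + b * c" by transfer (simp add: algebra_simps z)
  show "(0 :: 'a residue) \<noteq> 1" by transfer (use suppD(3,5)[OF prime_cone_test_cone] in force)
  have zd: "a \<noteq> 0 \<Longrightarrow> b \<noteq> 0 \<Longrightarrow> a * b \<noteq> 0" for a b :: "'a residue"
    by transfer (use prime_coneD(5)[OF prime_cone_test_cone] in auto)
  show refl: "a \<le> a" for a :: "'a residue" by transfer (simp add: prime_coneD(7)[OF prime_cone_test_cone])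
  show "a \<le> b \<Longrightarrow> b \<le> c \<Longrightarrow> a \<le> c"
  proof transfer
    fix a b c :: "'a rpoly" assume "b - a \<in> test_cone" "c - b \<in> test_cone"
    from prime_coneD(1)[OF prime_cone_test_cone this] show "c - a \<in> test_cone" by simp
  qed
  show anti: "a \<le> b \<Longrightarrow> b \<le> a \<Longrightarrow> a = b" for a b :: "'a residue"
    by transfer (simp add: supp_def)
  show "a < b \<longleftrightarrow> a \<le> b \<and> \<not> b \<le> a"
    unfolding less_residue_def using anti refl by blast
  show "a \<le> b \<or> b \<le> a"
    by transfer (metis prime_coneD(3)[OF prime_cone_test_cone] minus_diff_eq)
  show "a \<le> b \<Longrightarrow> c + a \<le> c + b" by transfer simp
  have m: "x \<le> y \<Longrightarrow> 0 \<le> z \<Longrightarrow> z * x \<le> z * y" for x y z :: "'a residue"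
    by transfer (metis diff_zero prime_coneD(2)[OF prime_cone_test_cone] right_diff_distrib)
  have dist: "z * x = z * y \<Longrightarrow> z * (x - y) = 0" for x y z :: "'a residue"
    by transfer (simp add: algebra_simps)
  have dz: "x - y = 0 \<Longrightarrow> x = y" for x y :: "'a residue" by transfer simp
  show "a < b \<Longrightarrow> 0 < c \<Longrightarrow> c * a < c * b"
    unfolding less_residue_def using m[of a b c] dist[of c a b] dz[of a b] zd[of c "a - b"] by metis
  show "\<bar>a\<bar> = (if a < 0 then - a else a)" by (rule abs_residue_def)
  show "sgn a = (if a = 0 then 0 else if 0 < a then 1 else - 1)" by (rule sgn_residue_def)
qed

end

section \<open>Two properties of prime cones\<close>

type_synonym 'n residue_field = "'n residue fract real_closure"

definition to_residue_field :: "'n::finite rpoly \<Rightarrow> 'n residue_field" where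
  "to_residue_field p = to_rc (Fract (residue_class p) 1)"

lemma to_residue_field_hom: "is_ring_hom to_residue_field"
proof -
  have "is_ring_hom (\<lambda>p :: 'a rpoly. residue_class p)"
    by (simp add: is_ring_hom_def one_residue_def plus_residue.abs_eq times_residue.abs_eq)
  moreover have "is_ring_hom (\<lambda>x :: 'a residue. Fract x 1)"
    by (simp add: is_ring_hom_def One_fract_def)
  ultimately have "is_ring_hom (\<lambda>p :: 'a rpoly. to_rc (Fract (residue_class p) 1))"
    by (rule is_ring_hom_comp[OF is_ring_hom_comp to_rc_hom])
  then show ?thesis unfolding to_residue_field_def[abs_def] .
qed

lemma to_rc_eq_0: "to_rc x = 0 \<longleftrightarrow> x = 0"
  using Rep_to_rc[of x] is_ring_homD(4)[OF Rep_hom] is_ring_homD(4)[OF to_rc_hom]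
  by (metis to_ac_eq_0_iff)

lemma to_rc_nonneg_iff: "0 \<le> to_rc x \<longleftrightarrow> 0 \<le> x"
proof
  assume 1: "0 \<le> to_rc x"
  show "0 \<le> x"
  proof (rule ccontr)
    assume "\<not> 0 \<le> x"
    then have x: "0 \<le> - x" "x \<noteq> 0" by auto
    have "0 \<le> - to_rc x" using to_rc_nonneg[OF x(1)] by (simp add: is_ring_homD[OF to_rc_hom])
    then have "to_rc x = 0" using 1 by simp
    then show False using x to_rc_eq_0 by blast
  qed
qed (rule to_rc_nonneg)

lemma to_residue_field_nonneg: "0 \<le> to_residue_field p \<longleftrightarrow> p \<in> test_cone"
proof -
  have "(0 \<le> residue_class p) \<longleftrightarrow> p \<in> test_cone"
    by (simp add: zero_residue_def less_eq_residue.abs_eq)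
  then show ?thesis by (simp add: to_residue_field_def to_rc_nonneg_iff zero_le_Fract_iff)
qed

lemma to_residue_field_eq_0: "to_residue_field p = 0 \<longleftrightarrow> p \<in> supp test_cone"
proof -
  have "to_residue_field p = 0 \<longleftrightarrow> 0 \<le> to_residue_field p \<and> 0 \<le> to_residue_field (- p)"
    by (auto simp: is_ring_homD[OF to_residue_field_hom])
  then show ?thesis by (simp only: to_residue_field_nonneg supp_def mem_Collect_eq)
qed

lemma realizable_test_cone: "realizable test_cone"
  unfolding realizable_def
proof (intro allI impI)
  fix Q :: "'a rpoly set" assume "finite Q"
  from sign_specialization[OF to_residue_field_hom this] obtain x where
    "\<forall>q\<in>Q. sg (to_residue_field q) = sg (peval q x)" by blast
  then show "\<exists>x. \<forall>q\<in>Q. (q \<in> test_cone) = (0 \<le> peval q x)"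
    using sg_eqD(4) to_residue_field_nonneg by metis
qed

text \<open>
  Only \<open>F\<close> is required to be a ring; the values of the derivation may lie outside of \<open>F\<close>.
\<close>

definition derivation_on :: "'k::field_char_0 set \<Rightarrow> ('k \<Rightarrow> 'k) \<Rightarrow> bool" where
  "derivation_on F D \<longleftrightarrow> is_subring F \<and>
     (\<forall>x\<in>F. \<forall>y\<in>F. D (x + y) = D x + D y \<and> D (x * y) = D x * y + x * D y)"

lemma derivation_onD:
  assumes "derivation_on F D"
  shows "is_subring F" "x \<in> F \<Longrightarrow> y \<in> F \<Longrightarrow> D (x + y) = D x + D y"
    "x \<in> F \<Longrightarrow> y \<in> F \<Longrightarrow> D (x * y) = D x * y + x * D y" "D 0 = 0" "D 1 = 0"
proof -
  show S: "is_subring F" and a: "x \<in> F \<Longrightarrow> y \<in> F \<Longrightarrow> D (x + y) = D x + D y"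
    and m: "x \<in> F \<Longrightarrow> y \<in> F \<Longrightarrow> D (x * y) = D x * y + x * D y" for x y
    using assms by (auto simp: derivation_on_def)
  show "D 0 = 0" using a[of 0 0] is_subringD(1)[OF S] by simp
  show "D 1 = 0" using m[of 1 1] is_subringD(2)[OF S] by simp
qed

lemma derivation_on_sum:
  assumes D: "derivation_on F D" and "\<And>i. i \<in> I \<Longrightarrow> f i \<in> F"
  shows "D (sum f I) = (\<Sum>i\<in>I. D (f i))"
  using assms(2)
proof (induction I rule: infinite_finite_induct)
  case (insert i I)
  have "f i \<in> F" "sum f I \<in> F"
    by (auto intro!: is_subring_sum[OF derivation_onD(1)[OF D]] simp: insert.prems)
  then show ?case using insert derivation_onD(2)[OF D] by simp
qed (simp_all add: derivation_onD(4)[OF D])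

text \<open>
  The value at \<open>p(z)\<close> that is forced on a derivation which extends \<open>D\<close> and maps \<open>z\<close> to \<open>w\<close>.
\<close>

definition ext_deriv :: "('k::field_char_0 \<Rightarrow> 'k) \<Rightarrow> 'k \<Rightarrow> 'k \<Rightarrow> 'k poly \<Rightarrow> 'k" where
  "ext_deriv D z w p = poly (map_poly D p) z + poly (pderiv p) z * w"

lemma ext_deriv_rules:
  assumes D: "derivation_on F D" and p: "p \<in> polys_over F"
  shows "q \<in> polys_over F \<Longrightarrow> ext_deriv D z w (p + q) = ext_deriv D z w p + ext_deriv D z w q"
    and "q \<in> polys_over F \<Longrightarrow> ext_deriv D z w (p * q) = ext_deriv D z w p * poly q z + poly p z * ext_deriv D z w q"
    and "ext_deriv D z w [:c:] = D c"
proof -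
  have c: "coeff (map_poly D r) i = D (coeff r i)" for r i
    by (simp add: coeff_map_poly derivation_onD(4)[OF D])
  note S = is_subringD[OF derivation_onD(1)[OF D]]
  show "ext_deriv D z w (p + q) = ext_deriv D z w p + ext_deriv D z w q" if q: "q \<in> polys_over F"
  proof -
    have "map_poly D (p + q) = map_poly D p + map_poly D q"
      using p q derivation_onD(2)[OF D] by (intro poly_eqI) (simp add: c polys_overD)
    then show ?thesis by (simp add: ext_deriv_def pderiv_add algebra_simps)
  qed
  show "ext_deriv D z w (p * q) = ext_deriv D z w p * poly q z + poly p z * ext_deriv D z w q" if q: "q \<in> polys_over F"
  proof -
    have "map_poly D (p * q) = map_poly D p * q + p * map_poly D q"
    proof (rule poly_eqI)
      fix n
      have "coeff (map_poly D (p * q)) n = D (\<Sum>i\<le>n. coeff p i * coeff q (n - i))" by (simp add: c coeff_mult)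
      also have "\<dots> = (\<Sum>i\<le>n. D (coeff p i * coeff q (n - i)))"
        by (rule derivation_on_sum[OF D]) (simp add: S polys_overD[OF p] polys_overD[OF q])
      also have "\<dots> = (\<Sum>i\<le>n. D (coeff p i) * coeff q (n - i) + coeff p i * D (coeff q (n - i)))"
        by (intro sum.cong refl derivation_onD(3)[OF D] polys_overD[OF p] polys_overD[OF q])
      finally show "coeff (map_poly D (p * q)) n = coeff (map_poly D p * q + p * map_poly D q) n"
        by (simp add: c coeff_mult sum.distrib)
    qed
    then show ?thesis by (simp add: ext_deriv_def pderiv_mult algebra_simps)
  qed
  show "ext_deriv D z w [:c:] = D c"
    using derivation_onD(4)[OF D] by (simp add: ext_deriv_def map_poly_pCons pderiv_pCons)
qed

text \<open>
  The hypothesis says that the forced value does not depend on the representation of an element as \<open>p(z)\<close>.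
\<close>

lemma derivation_adjoin:
  assumes D: "derivation_on F D"
    and w: "\<And>p. p \<in> polys_over F \<Longrightarrow> poly p z = 0 \<Longrightarrow> ext_deriv D z w p = 0"
  shows "\<exists>F' D'. derivation_on F' D' \<and> F \<subseteq> F' \<and> z \<in> F' \<and> (\<forall>x\<in>F. D' x = D x) \<and> D' z = w"
proof -
  note S = derivation_onD(1)[OF D] and P = polys_over_closed[OF derivation_onD(1)[OF D]]
  note E = ext_deriv_rules[OF D]
  define F' where "F' = (\<lambda>p. poly p z) ` polys_over F"
  define D' where "D' v = ext_deriv D z w (SOME p. p \<in> polys_over F \<and> poly p z = v)" for v
  have D': "D' (poly p z) = ext_deriv D z w p" if p: "p \<in> polys_over F" for p
  proof -
    define q where "q = (SOME q. q \<in> polys_over F \<and> poly q z = poly p z)"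
    have q: "q \<in> polys_over F \<and> poly q z = poly p z" unfolding q_def
      by (rule someI[of _ p]) (use p in simp)
    have n: "[:- 1:] \<in> polys_over F" by (rule P(2)[OF is_subringD(3)[OF S is_subringD(2)[OF S]]])
    have m1: "D (- 1) = 0"
      using derivation_onD(2)[OF D is_subringD(2)[OF S] is_subringD(3)[OF S is_subringD(2)[OF S]]]
        derivation_onD(4,5)[OF D] by simp
    have nq: "[:- 1:] * q \<in> polys_over F" using n q P(6) by blast
    have "poly (p + [:- 1:] * q) z = 0" using q by simp
    then have "ext_deriv D z w (p + [:- 1:] * q) = 0" by (rule w[OF P(4)[OF p nq]])
    then have "ext_deriv D z w p + ext_deriv D z w ([:- 1:] * q) = 0" by (simp only: E(1)[OF p nq])
    moreover have "ext_deriv D z w ([:- 1:] * q) = - ext_deriv D z w q"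
      using E(2)[OF n, of q] q E(3)[OF n] m1 by simp
    ultimately show ?thesis unfolding D'_def q_def[symmetric] by simp
  qed
  have F'I: "poly p z \<in> F'" if "p \<in> polys_over F" for p using that by (auto simp: F'_def)
  have "derivation_on F' D'"
    unfolding derivation_on_def is_subring_def
  proof (intro conjI ballI)
    show "1 \<in> F'" using F'I[OF P(2)[OF is_subringD(2)[OF S]]] by simp
    fix u v assume "u \<in> F'" "v \<in> F'"
    then obtain p q where pq: "p \<in> polys_over F" "q \<in> polys_over F" "u = poly p z" "v = poly q z"
      by (auto simp: F'_def)
    show "u - v \<in> F'" using F'I[OF P(5)[OF pq(1,2)]] pq by simp
    show "u * v \<in> F'" using F'I[OF P(6)[OF pq(1,2)]] pq by simp
    show "D' (u + v) = D' u + D' v" using D'[OF P(4)[OF pq(1,2)]] D'[OF pq(1)] D'[OF pq(2)] E(1)[OF pq(1,2)] pq by simp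
    show "D' (u * v) = D' u * v + u * D' v"
      using D'[OF P(6)[OF pq(1,2)]] D'[OF pq(1)] D'[OF pq(2)] E(2)[OF pq(1,2)] pq by simp
  qed
  moreover have Fx: "x \<in> F' \<and> D' x = D x" if "x \<in> F" for x
    using F'I[OF P(2)[OF that]] D'[OF P(2)[OF that]] E(3)[OF P(2)[OF that]] by simp
  moreover have X: "[:0, 1:] \<in> polys_over F"
    by (rule P(9)[OF is_subringD(1)[OF S] P(2)[OF is_subringD(2)[OF S]]])
  moreover have "ext_deriv D z w [:0, 1:] = w"
    using derivation_onD(4,5)[OF D] by (simp add: ext_deriv_def map_poly_pCons pderiv_pCons)
  ultimately show ?thesis using F'I[OF X] D'[OF X] by (intro exI[of _ F'] exI[of _ D']) auto
qed

text \<open>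
  If \<open>z\<close> is transcendental over \<open>F\<close>, any value at \<open>z\<close> will do. If \<open>z\<close> is algebraic with minimal polynomial \<open>m\<close>, the condition for
  \<open>m\<close> determines the value, because \<open>m'(z) \<noteq> 0\<close> in characteristic \<open>0\<close>, and pseudo-division by \<open>m\<close> transfers the condition to
  all polynomials with root \<open>z\<close>.
\<close>

lemma derivation_extend:
  assumes D: "derivation_on F D"
  shows "\<exists>F' D'. derivation_on F' D' \<and> F \<subseteq> F' \<and> z \<in> F' \<and> (\<forall>x\<in>F. D' x = D x)"
proof (cases "\<exists>p\<in>polys_over F. p \<noteq> 0 \<and> poly p z = 0")
  case False
  have "\<exists>F' D'. derivation_on F' D' \<and> F \<subseteq> F' \<and> z \<in> F' \<and> (\<forall>x\<in>F. D' x = D x) \<and> D' z = 0"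
  proof (rule derivation_adjoin[OF D])
    fix p assume "p \<in> polys_over F" "poly p z = 0"
    then have "p = 0" using False by blast
    then show "ext_deriv D z 0 p = 0" by (simp add: ext_deriv_def)
  qed
  then show ?thesis by blast
next
  case True
  note S = derivation_onD(1)[OF D] and P = polys_over_closed[OF derivation_onD(1)[OF D]]
  note E = ext_deriv_rules[OF D]
  let ?alg = "\<lambda>p. p \<in> polys_over F \<and> p \<noteq> 0 \<and> poly p z = 0"
  define m where "m = arg_min degree ?alg"
  obtain p0 where p0: "?alg p0" using True by blast
  have m: "m \<in> polys_over F" "m \<noteq> 0" "poly m z = 0"
    using arg_min_natI[of ?alg p0 degree, OF p0] by (auto simp: m_def)
  have mle: "degree m \<le> degree p" if "p \<in> polys_over F" "p \<noteq> 0" "poly p z = 0" for p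
    unfolding m_def by (rule arg_min_nat_le) (use that in blast)
  have dm: "degree m > 0"
  proof (rule ccontr)
    assume "\<not> degree m > 0"
    then obtain c where "m = [:c:]" by (auto elim: degree_eq_zeroE)
    then show False using m by auto
  qed
  have nz: "poly (pderiv m) z \<noteq> 0"
  proof
    assume z0: "poly (pderiv m) z = 0"
    have "pderiv m \<noteq> 0" using dm by (simp add: pderiv_eq_0_iff)
    moreover have "pderiv m \<in> polys_over F"
      using m(1) is_subringD(6,8)[OF S] by (auto simp: polys_over_def coeff_pderiv simp del: of_nat_Suc)
    ultimately have "degree m \<le> degree (pderiv m)" using mle z0 by blast
    then show False using dm by (simp add: degree_pderiv)
  qed
  define w where "w = - poly (map_poly D m) z / poly (pderiv m) z"
  have Em: "ext_deriv D z w m = 0" using nz by (simp add: ext_deriv_def w_def)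
  have "\<exists>F' D'. derivation_on F' D' \<and> F \<subseteq> F' \<and> z \<in> F' \<and> (\<forall>x\<in>F. D' x = D x) \<and> D' z = w"
  proof (rule derivation_adjoin[OF D])
    fix p assume p: "p \<in> polys_over F" "poly p z = 0"
    obtain k q r where kqr: "q \<in> polys_over F" "r \<in> polys_over F"
      "Polynomial.smult (lead_coeff m ^ k) p = m * q + r" "r = 0 \<or> degree r < degree m"
      using pseudo_division_over[OF S m(1) p(1)] by blast
    have "poly r z = poly (Polynomial.smult (lead_coeff m ^ k) p) z - poly (m * q) z" unfolding kqr(3) by simp
    then have "poly r z = 0" using p(2) m(3) by simp
    then have "r = 0" using mle[OF kqr(2)] kqr(4) by (meson not_le)
    then have eq: "[:lead_coeff m ^ k:] * p = m * q" using kqr(3) by simp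
    have c: "[:lead_coeff m ^ k:] \<in> polys_over F"
      by (intro P(2) is_subringD(7)[OF S] polys_overD[OF m(1)])
    have "ext_deriv D z w ([:lead_coeff m ^ k:] * p) = lead_coeff m ^ k * ext_deriv D z w p"
      using E(2)[OF c p(1)] p(2) by simp
    moreover have "ext_deriv D z w (m * q) = 0" using E(2)[OF m(1) kqr(1)] Em m(3) by simp
    ultimately show "ext_deriv D z w p = 0" using eq m(2) by simp
  qed
  then show ?thesis by blast
qed

lemma pdiff_superset:
  assumes "finite A" "Poly_Mapping.keys p \<subseteq> A"
  shows "pdiff i p = (\<Sum>m\<in>A. Poly_Mapping.single (m - Poly_Mapping.single i 1)
    (real (Poly_Mapping.lookup m i) * Poly_Mapping.lookup p m))"
  unfolding pdiff_def using assms by (intro sum.mono_neutral_left) (auto simp: in_keys_iff)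

lemma pdiff_single: "pdiff i (Poly_Mapping.single m c) =
    Poly_Mapping.single (m - Poly_Mapping.single i 1) (real (Poly_Mapping.lookup m i) * c)"
  by (cases "c = 0") (simp_all add: pdiff_def)

lemma pdiff_add: "pdiff i (p + q) = pdiff i p + pdiff i q"
proof -
  let ?A = "Poly_Mapping.keys p \<union> Poly_Mapping.keys q"
  have "Poly_Mapping.keys (p + q) \<subseteq> ?A" by (rule Poly_Mapping.keys_add)
  then show ?thesis
    by (simp add: pdiff_superset[of ?A] lookup_add sum.distrib[symmetric] algebra_simps single_add)
qed

lemma pdiff_sum: "pdiff i (sum f A) = (\<Sum>a\<in>A. pdiff i (f a))"
proof (induction A rule: infinite_finite_induct)
  case (insert a A) then show ?case by (simp add: pdiff_add)
qed (simp_all add: pdiff_def)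

lemma pdiff_single_mult:
  fixes m m' :: "'n \<Rightarrow>\<^sub>0 nat"
  shows "pdiff i (Poly_Mapping.single m c * Poly_Mapping.single m' c') =
    pdiff i (Poly_Mapping.single m c) * Poly_Mapping.single m' c' + Poly_Mapping.single m c * pdiff i (Poly_Mapping.single m' c')"
proof -
  let ?e = "Poly_Mapping.single i (1::nat)"
  have shift: "m1 - ?e + m2 = m1 + m2 - ?e" if "Poly_Mapping.lookup m1 i \<noteq> 0" for m1 m2 :: "'n \<Rightarrow>\<^sub>0 nat"
    by (rule poly_mapping_eqI) (use that in \<open>auto simp: lookup_add lookup_minus lookup_single when_def\<close>)
  have 1: "Poly_Mapping.single (m - ?e + m') (real (Poly_Mapping.lookup m i) * c * c') =
      Poly_Mapping.single (m + m' - ?e) (real (Poly_Mapping.lookup m i) * c * c')"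
    using shift[of m m'] by (cases "Poly_Mapping.lookup m i = 0") auto
  have 2: "Poly_Mapping.single (m + (m' - ?e)) (c * (real (Poly_Mapping.lookup m' i) * c')) =
      Poly_Mapping.single (m + m' - ?e) (c * (real (Poly_Mapping.lookup m' i) * c'))"
    using shift[of m' m] by (cases "Poly_Mapping.lookup m' i = 0") (auto simp: add.commute)
  show ?thesis
    unfolding mult_single pdiff_single 1 2 single_add[symmetric]
    by (simp add: lookup_add algebra_simps)
qed

lemma pdiff_mult: "pdiff i (p * q) = pdiff i p * q + p * pdiff i q"
proof -
  let ?s = "\<lambda>p m. Poly_Mapping.single m (Poly_Mapping.lookup p m)"
  have s: "p = (\<Sum>m\<in>Poly_Mapping.keys p. ?s p m)" for p :: "'a rpoly" by (rule sum_monomials[symmetric])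
  have d: "pdiff i p = (\<Sum>m\<in>Poly_Mapping.keys p. pdiff i (?s p m))" for p :: "'a rpoly"
    by (subst s) (rule pdiff_sum)
  have "p * q = (\<Sum>m\<in>Poly_Mapping.keys p. \<Sum>m'\<in>Poly_Mapping.keys q. ?s p m * ?s q m')"
    by (subst (1) s, subst (2) s) (rule sum_product)
  then have "pdiff i (p * q) = (\<Sum>m\<in>Poly_Mapping.keys p. \<Sum>m'\<in>Poly_Mapping.keys q.
      pdiff i (?s p m) * ?s q m' + ?s p m * pdiff i (?s q m'))"
    by (simp only: pdiff_sum pdiff_single_mult)
  also have "\<dots> = (\<Sum>m\<in>Poly_Mapping.keys p. pdiff i (?s p m)) * (\<Sum>m'\<in>Poly_Mapping.keys q. ?s q m')
      + (\<Sum>m\<in>Poly_Mapping.keys p. ?s p m) * (\<Sum>m'\<in>Poly_Mapping.keys q. pdiff i (?s q m'))"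
    by (simp only: sum_product sum.distrib)
  finally show ?thesis by (simp only: d[symmetric] s[symmetric])
qed

lemma pdiff_cst: "pdiff i (cst c) = 0"
  by (simp add: cst_def pdiff_single)

lemma pdiff_var: "pdiff i (var j) = (if i = j then 1 else 0)"
  by (auto simp: var_def pdiff_single lookup_single when_def)

text \<open>
  Both sides are derivations of the polynomial ring along \<open>h\<close> that agree on constants and variables.
\<close>

lemma derivation_chain_rule:
  fixes h :: "'n::finite rpoly \<Rightarrow> 'k::field_char_0"
  assumes h: "is_ring_hom h" and D: "derivation_on F D"
    and F: "\<And>c. h (cst c) \<in> F" "\<And>i. h (var i) \<in> F" and D0: "\<And>c. D (h (cst c)) = 0"
  shows "h p \<in> F \<and> D (h p) = (\<Sum>i\<in>UNIV. h (pdiff i p) * D (h (var i)))"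
proof (induction p rule: rpoly_induct)
  case (cst c)
  then show ?case using F D0 by (simp add: pdiff_cst is_ring_homD[OF h])
next
  case (var j)
  have "h (pdiff i (var j)) * D (h (var i)) = (if i = j then D (h (var j)) else 0)" for i
    by (simp add: pdiff_var is_ring_homD[OF h])
  then show ?case using F by simp
next
  case (add p q)
  then show ?case
    using is_subringD(5)[OF derivation_onD(1)[OF D], of "h p" "h q"] derivation_onD(2)[OF D, of "h p" "h q"]
    by (simp add: is_ring_homD[OF h] pdiff_add distrib_right sum.distrib)
next
  case (mult p q)
  then show ?case
    using is_subringD(6)[OF derivation_onD(1)[OF D], of "h p" "h q"] derivation_onD(3)[OF D, of "h p" "h q"]
    by (simp add: is_ring_homD[OF h] pdiff_mult sum.distrib sum_distrib_left sum_distrib_right algebra_simps)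
qed

text \<open>
  If \<open>h f\<close> were transcendental over the reals, differentiation with respect to it, a derivation with value \<open>1\<close> at \<open>h f\<close> that kills the reals,
  would extend to all \<open>h (var i)\<close>. By the chain rule its value at \<open>h f\<close> is \<open>0\<close>.
\<close>

lemma critical_value_algebraic:
  fixes h :: "'n::finite rpoly \<Rightarrow> 'k::field_char_0"
  assumes h: "is_ring_hom h" and crit: "\<And>i. h (pdiff i f) = 0"
  shows "\<exists>q. q \<noteq> 0 \<and> poly (map_poly (\<lambda>c. h (cst c)) q) (h f) = 0"
proof (rule ccontr)
  assume tr: "\<not> ?thesis"
  define r where "r = (\<lambda>c. h (cst c))"
  have r: "is_ring_hom r" unfolding r_def by (rule is_ring_hom_comp[OF cst_hom h])
  define F where "F = range r"
  have S: "is_subring F"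
    unfolding is_subring_def F_def by (auto simp: is_ring_homD[OF r, symmetric])
  have D: "derivation_on F (\<lambda>_. 0)" using S by (simp add: derivation_on_def)
  have "\<exists>F' D'. derivation_on F' D' \<and> F \<subseteq> F' \<and> h f \<in> F' \<and> (\<forall>x\<in>F. D' x = 0) \<and> D' (h f) = 1"
  proof (rule derivation_adjoin[OF D])
    fix p assume p: "p \<in> polys_over F" "poly p (h f) = 0"
    have "\<forall>i. \<exists>c. coeff p i = r c" using p(1) by (auto simp: polys_over_def F_def)
    then obtain c where c: "\<And>i. coeff p i = r (c i)" by metis
    define q where "q = (\<Sum>i\<le>degree p. monom (c i) i)"
    have "map_poly r q = p"
    proof (rule poly_eqI)
      fix n
      have "coeff q n = (if n \<le> degree p then c n else 0)" by (simp add: q_def coeff_sum)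
      then show "coeff (map_poly r q) n = coeff p n"
        by (auto simp: map_poly_hom[OF r] is_ring_homD[OF r] c[symmetric] coeff_eq_0)
    qed
    then have "q = 0" using tr p(2) unfolding r_def by blast
    then have "p = 0" using \<open>map_poly r q = p\<close> by simp
    then show "ext_deriv (\<lambda>_. 0) (h f) 1 p = 0" by (simp add: ext_deriv_def)
  qed
  then obtain F1 D1 where 1: "derivation_on F1 D1" "F \<subseteq> F1" "h f \<in> F1" "\<forall>x\<in>F. D1 x = 0" "D1 (h f) = 1" by blast
  have "\<exists>F' D'. derivation_on F' D' \<and> F1 \<subseteq> F' \<and> (\<forall>i\<in>V. h (var i) \<in> F') \<and> (\<forall>x\<in>F1. D' x = D1 x)"
    if "finite V" for V :: "'n set"
    using that
  proof induction
    case empty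
    then show ?case using 1 by blast
  next
    case (insert i V)
    then obtain F2 D2 where 2: "derivation_on F2 D2" "F1 \<subseteq> F2" "\<forall>i\<in>V. h (var i) \<in> F2" "\<forall>x\<in>F1. D2 x = D1 x" by blast
    obtain F3 D3 where 3: "derivation_on F3 D3" "F2 \<subseteq> F3" "h (var i) \<in> F3" "\<forall>x\<in>F2. D3 x = D2 x"
      using derivation_extend[OF 2(1), of "h (var i)"] by blast
    show ?case using 2 3 by (intro exI[of _ F3] exI[of _ D3]) auto
  qed
  from this[OF finite[of UNIV]] obtain F2 D2 where
    2: "derivation_on F2 D2" "F1 \<subseteq> F2" "\<And>i. h (var i) \<in> F2" "\<And>x. x \<in> F1 \<Longrightarrow> D2 x = D1 x" by blast
  have "h (cst c) \<in> F2" "D2 (h (cst c)) = 0" for c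
  proof -
    have "h (cst c) \<in> F" by (auto simp: F_def r_def)
    moreover then have "h (cst c) \<in> F1" using 1(2) by blast
    ultimately show "h (cst c) \<in> F2" "D2 (h (cst c)) = 0" using 1(4) 2(2) 2(4)[of "h (cst c)"] by auto
  qed
  then have "D2 (h f) = (\<Sum>i\<in>UNIV. h (pdiff i f) * D2 (h (var i)))"
    using derivation_chain_rule[OF h 2(1)] 2(3) by blast
  then show False using crit 1(3,5) 2(4) by simp
qed

text \<open>
  A polynomial relation \<open>q(h f) = 0\<close> is also satisfied by \<open>f\<close> at some real point, which yields a real root of \<open>q\<close>. Either
  \<open>h f\<close> equals this root, or it is a root of the remaining factor of smaller degree.
\<close>

lemma algebraic_value_real:
  fixes h :: "'n::finite rpoly \<Rightarrow> 'k::real_closed"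
  assumes h: "is_ring_hom h" and "q \<noteq> 0" "poly (map_poly (\<lambda>c. h (cst c)) q) (h f) = 0"
  shows "\<exists>c. h f = h (cst c)"
  using assms(2,3)
proof (induction "degree q" arbitrary: q rule: less_induct)
  case less
  have r: "is_ring_hom (\<lambda>c. h (cst c))" by (rule is_ring_hom_comp[OF cst_hom h])
  define g where "g = poly (map_poly cst q) f"
  have "h g = poly (map_poly h (map_poly cst q)) (h f)" by (simp add: g_def map_poly_hom(9)[OF h])
  also have "map_poly h (map_poly cst q) = map_poly (\<lambda>c. h (cst c)) q"
    by (simp add: map_poly_map_poly is_ring_homD[OF h] is_ring_homD[OF cst_hom] o_def)
  finally have "h g = 0" using less.prems by simp
  moreover obtain x where "sg (h g) = sg (peval g x)" using sign_specialization[OF h, of "{g}"] by auto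
  ultimately have "peval g x = 0" by simp
  moreover have "map_poly (\<lambda>p. peval p x) (map_poly cst q) = q"
    by (subst map_poly_map_poly) (simp_all add: is_ring_homD[OF cst_hom] o_def)
  then have "peval g x = poly q (peval f x)"
    using map_poly_hom(9)[OF peval_hom, of x "map_poly cst q" f] by (simp add: g_def)
  ultimately have "poly q (peval f x) = 0" by simp
  then obtain q' where q': "q = [:- peval f x, 1:] * q'" by (metis dvdE poly_eq_0_iff_dvd)
  then have "q' \<noteq> 0" using less.prems by auto
  then have "degree q' < degree q" by (subst q', subst degree_mult_eq) auto
  have "(h f - h (cst (peval f x))) * poly (map_poly (\<lambda>c. h (cst c)) q') (h f) = 0"
    using less.prems(2) unfolding q' map_poly_hom(5)[OF r]
    by (simp add: map_poly_hom[OF r] is_ring_homD[OF r] algebra_simps)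
  then have "h f = h (cst (peval f x)) \<or> poly (map_poly (\<lambda>c. h (cst c)) q') (h f) = 0" by simp
  then show ?case using less.hyps[OF \<open>degree q' < degree q\<close> \<open>q' \<noteq> 0\<close>] by blast
qed

lemma critical_values_real_test_cone: "critical_values_real test_cone"
  unfolding critical_values_real_def
proof (intro allI impI)
  fix f :: "'a rpoly" assume "\<forall>i. pdiff i f \<in> supp test_cone"
  then have "\<And>i. to_residue_field (pdiff i f) = 0" using to_residue_field_eq_0 by blast
  from critical_value_algebraic[OF to_residue_field_hom this] obtain c where
    "to_residue_field f = to_residue_field (cst c)"
    using algebraic_value_real[OF to_residue_field_hom] by metis
  then have "to_residue_field (f - cst c) = 0" by (simp add: is_ring_homD[OF to_residue_field_hom])
  then show "\<exists>c. f - cst c \<in> supp test_cone" using to_residue_field_eq_0 by blast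
qed

text \<open>
  The fixed cone was chosen to violate the claim if any cone does, and it does not.
\<close>

theorem prime_cone_real:
  assumes "prime_cone \<alpha>"
  shows "realizable \<alpha>" "critical_values_real \<alpha>"
proof -
  have "\<not> (\<exists>\<alpha> :: 'n::finite rpoly set. bad_cone \<alpha>)"
  proof
    assume ex: "\<exists>\<alpha> :: 'n rpoly set. bad_cone \<alpha>"
    then have "bad_cone (test_cone :: 'n rpoly set)" using someI_ex[OF ex] by (simp add: test_cone_def)
    then show False using realizable_test_cone critical_values_real_test_cone by (auto simp: bad_cone_def)
  qed
  then show "realizable \<alpha>" "critical_values_real \<alpha>" using assms unfolding bad_cone_def by blast+
qed

section \<open>Certificates by sums of squares\<close>

inductive_set sos :: "'c::comm_ring_1 set" where
  zero: "0 \<in> sos"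
| add: "\<sigma> \<in> sos \<Longrightarrow> \<sigma> + a * a \<in> sos"

lemma sos_square: "a * a \<in> sos"
  using sos.add[OF sos.zero, of a] by simp

lemma sos_plus:
  assumes "\<sigma> \<in> sos" "\<tau> \<in> sos"
  shows "\<sigma> + \<tau> \<in> sos"
  using assms(2,1) by (induction \<tau> rule: sos.induct) (auto simp: add.assoc[symmetric] intro: sos.intros)

lemma sos_mult_square: "\<sigma> \<in> sos \<Longrightarrow> b * b * \<sigma> \<in> sos"
proof (induction rule: sos.induct)
  case (add \<sigma> a)
  have "b * b * (\<sigma> + a * a) = b * b * \<sigma> + (b * a) * (b * a)" by (simp add: algebra_simps)
  then show ?case using sos.add[OF add.IH, of "b * a"] by simp
qed (simp add: sos.zero)

lemma sos_mult:
  assumes "\<sigma> \<in> sos" "\<tau> \<in> sos"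
  shows "\<sigma> * \<tau> \<in> sos"
  using assms(2)
proof (induction \<tau> rule: sos.induct)
  case (add \<tau> a)
  have "\<sigma> * (\<tau> + a * a) = \<sigma> * \<tau> + a * a * \<sigma>" by (simp add: algebra_simps)
  then show ?case using sos_plus[OF add.IH sos_mult_square[OF assms(1), of a]] by simp
qed (simp add: sos.zero)

definition is_ideal :: "'c::comm_ring_1 set \<Rightarrow> bool" where
  "is_ideal I \<longleftrightarrow> 0 \<in> I \<and> (\<forall>x\<in>I. \<forall>y\<in>I. x + y \<in> I) \<and> (\<forall>x\<in>I. \<forall>y. y * x \<in> I)"

lemma is_idealD:
  assumes "is_ideal I"
  shows "0 \<in> I" "x \<in> I \<Longrightarrow> y \<in> I \<Longrightarrow> x + y \<in> I" "x \<in> I \<Longrightarrow> y * x \<in> I" "x \<in> I \<Longrightarrow> - x \<in> I"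
proof -
  show "0 \<in> I" and m: "x \<in> I \<Longrightarrow> y * x \<in> I" and "x \<in> I \<Longrightarrow> y \<in> I \<Longrightarrow> x + y \<in> I" for x y
    using assms by (auto simp: is_ideal_def)
  show "x \<in> I \<Longrightarrow> - x \<in> I" using m[of x "- 1"] by simp
qed

lemma is_ideal_gen_ideal: "is_ideal (gen_ideal S)"
proof -
  interpret Modules.module "(*) :: 'a \<Rightarrow> 'a \<Rightarrow> 'a" by (rule module_times)
  show ?thesis unfolding is_ideal_def gen_ideal_def by (auto intro: span_zero span_add span_scale)
qed

lemma gen_ideal_superset: "S \<subseteq> gen_ideal S"
proof -
  interpret Modules.module "(*) :: 'a \<Rightarrow> 'a \<Rightarrow> 'a" by (rule module_times)
  show ?thesis unfolding gen_ideal_def by (rule span_superset)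
qed

lemma gen_ideal_minimal: "S \<subseteq> I \<Longrightarrow> is_ideal I \<Longrightarrow> gen_ideal S \<subseteq> I"
proof -
  assume *: "S \<subseteq> I" "is_ideal I"
  interpret Modules.module "(*) :: 'a \<Rightarrow> 'a \<Rightarrow> 'a" by (rule module_times)
  show ?thesis unfolding gen_ideal_def
    by (rule span_minimal[OF *(1)]) (use *(2) in \<open>auto simp: subspace_def is_ideal_def\<close>)
qed

lemma gen_ideal_insert: "gen_ideal (insert a S) = {x. \<exists>k. x - k * a \<in> gen_ideal S}"
proof -
  interpret Modules.module "(*) :: 'a \<Rightarrow> 'a \<Rightarrow> 'a" by (rule module_times)
  show ?thesis unfolding gen_ideal_def by (rule span_insert)
qed

text \<open>
  If no element of \<open>- S\<close> lies in the cone of sums of squares modulo \<open>I\<close>, that cone extends to a prime cone that avoids \<open>- S\<close>.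
\<close>

lemma prime_cone_certificate:
  fixes S :: "'c::comm_ring_1 set"
  assumes I: "is_ideal I"
    and S: "1 \<in> S" "\<And>s t. s \<in> S \<Longrightarrow> t \<in> S \<Longrightarrow> s * t \<in> S" "\<And>s. s \<in> S \<Longrightarrow> \<exists>a. s = a * a"
    and cones: "\<And>\<alpha>. prime_cone \<alpha> \<Longrightarrow> I \<subseteq> supp \<alpha> \<Longrightarrow> \<exists>s\<in>S. - s \<in> \<alpha>"
  shows "\<exists>s\<in>S. \<exists>\<sigma>\<in>sos. s + \<sigma> \<in> I"
proof (rule ccontr)
  assume no: "\<not> ?thesis"
  note i = is_idealD[OF I]
  define T where "T = {\<sigma> + g | \<sigma> g. \<sigma> \<in> sos \<and> g \<in> I}"
  have TI: "\<sigma> + g \<in> T" if "\<sigma> \<in> sos" "g \<in> I" for \<sigma> g using that by (auto simp: T_def)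
  have "\<exists>\<alpha>. prime_cone \<alpha> \<and> T \<subseteq> \<alpha> \<and> (\<forall>s\<in>S. - s \<notin> \<alpha>)"
  proof (rule prime_cone_extension[OF _ _ _ S])
    fix x y assume "x \<in> T" "y \<in> T"
    then obtain \<sigma> g \<tau> k where *: "x = \<sigma> + g" "y = \<tau> + k" "\<sigma> \<in> sos" "g \<in> I" "\<tau> \<in> sos" "k \<in> I"
      unfolding T_def by blast
    have "x + y = (\<sigma> + \<tau>) + (g + k)" by (simp add: * algebra_simps)
    then show "x + y \<in> T" using TI[OF sos_plus[OF *(3,5)] i(2)[OF *(4,6)]] by simp
    have "x * y = \<sigma> * \<tau> + (\<tau> * g + (\<sigma> + g) * k)" by (simp add: * algebra_simps)
    then show "x * y \<in> T" using TI[OF sos_mult[OF *(3,5)] i(2)[OF i(3)[OF *(4)] i(3)[OF *(6)]]] by simp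
  next
    fix x show "x * x \<in> T" using TI[OF sos_square i(1), of x] by simp
  next
    fix s assume s: "s \<in> S"
    show "- s \<notin> T"
    proof
      assume "- s \<in> T"
      then obtain \<sigma> g where *: "\<sigma> \<in> sos" "g \<in> I" "- s = \<sigma> + g" unfolding T_def by blast
      have "s + \<sigma> = - g" using *(3) by (simp add: algebra_simps eq_neg_iff_add_eq_0 neg_eq_iff_add_eq_0)
      then have "s + \<sigma> \<in> I" using i(4)[OF *(2)] by simp
      then show False using no s *(1) by blast
    qed
  qed
  then obtain \<alpha> where \<alpha>: "prime_cone \<alpha>" "T \<subseteq> \<alpha>" "\<forall>s\<in>S. - s \<notin> \<alpha>" by blast
  have "I \<subseteq> supp \<alpha>"
  proof
    fix g assume "g \<in> I"
    then have "g \<in> T" "- g \<in> T" using TI[OF sos.zero, of g] TI[OF sos.zero, of "- g"] i(4) by auto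
    then show "g \<in> supp \<alpha>" using \<alpha>(2) by (auto simp: supp_def)
  qed
  then show False using cones[OF \<alpha>(1)] \<alpha>(3) by blast
qed

text \<open>
  Multiplying an identity by an even power of \<open>p\<close> keeps its shape. Exponents that are powers of two allow the repeated extraction of square roots
  inside a kernel.
\<close>

lemma certificate_power_two:
  assumes I: "is_ideal I" and \<sigma>: "\<sigma> \<in> sos" "p ^ (2 * k) + \<sigma> \<in> I"
  shows "\<exists>j>0. \<exists>\<tau>\<in>sos. p ^ (2 ^ j) + \<tau> \<in> I"
proof -
  define e where "e = 2 ^ k - k"
  have "k < 2 ^ k" by (rule less_exp)
  then have "k + e = 2 ^ k" by (simp add: e_def)
  then have e: "2 ^ Suc k = 2 * k + 2 * e" by simp
  have "p ^ (2 * e) = p ^ e * p ^ e" by (simp add: mult_2 power_add)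
  moreover have "p ^ (2 * e) * (p ^ (2 * k) + \<sigma>) = p ^ (2 ^ Suc k) + p ^ (2 * e) * \<sigma>"
    unfolding e by (simp add: power_add algebra_simps)
  ultimately have "p ^ (2 ^ Suc k) + p ^ e * p ^ e * \<sigma> \<in> I"
    using is_idealD(3)[OF I \<sigma>(2), of "p ^ (2 * e)"] by simp
  then show ?thesis using sos_mult_square[OF \<sigma>(1), of "p ^ e"] by blast
qed

lemma realizable_zero:
  assumes "realizable \<alpha>" "finite Q"
  shows "\<exists>x. \<forall>q\<in>Q. q \<in> supp \<alpha> \<longleftrightarrow> peval q x = 0"
proof -
  have "finite (Q \<union> uminus ` Q)" using assms(2) by simp
  from assms(1)[unfolded realizable_def, rule_format, OF this]
  obtain x where x: "\<And>q. q \<in> Q \<union> uminus ` Q \<Longrightarrow> q \<in> \<alpha> \<longleftrightarrow> 0 \<le> peval q x" by meson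
  have "q \<in> supp \<alpha> \<longleftrightarrow> peval q x = 0" if "q \<in> Q" for q
    using x[of q] x[of "- q"] that by (auto simp: supp_def)
  then show ?thesis by blast
qed

text \<open>
  A prime cone whose support contains \<open>G\<close> but not \<open>p\<close> would specialise to a common real zero of \<open>G\<close> at which \<open>p\<close> does not vanish.
\<close>

theorem real_nullstellensatz:
  fixes p :: "'n::finite rpoly"
  assumes "finite G" and zero: "\<And>x. (\<forall>g\<in>G. peval g x = 0) \<Longrightarrow> peval p x = 0"
  shows "\<exists>j>0. \<exists>\<sigma>\<in>sos. p ^ (2 ^ j) + \<sigma> \<in> gen_ideal G"
proof -
  have "\<exists>s\<in>range (\<lambda>k. p ^ (2 * k)). \<exists>\<sigma>\<in>sos. s + \<sigma> \<in> gen_ideal G"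
  proof (rule prime_cone_certificate[OF is_ideal_gen_ideal])
    show "1 \<in> range (\<lambda>k. p ^ (2 * k))" by (rule range_eqI[of _ _ 0]) simp
    show "s * t \<in> range (\<lambda>k. p ^ (2 * k))" if st: "s \<in> range (\<lambda>k. p ^ (2 * k))" "t \<in> range (\<lambda>k. p ^ (2 * k))" for s t
    proof -
      obtain k l where "s = p ^ (2 * k)" "t = p ^ (2 * l)" using st by blast
      then have "s * t = p ^ (2 * (k + l))" by (simp add: power_add distrib_left)
      then show ?thesis by blast
    qed
    show "\<exists>a. s = a * a" if "s \<in> range (\<lambda>k. p ^ (2 * k))" for s
      using that by (auto simp: mult_2 power_add)
    fix \<alpha> assume \<alpha>: "prime_cone \<alpha>" "gen_ideal G \<subseteq> supp \<alpha>"
    obtain x where x: "\<And>q. q \<in> insert p G \<Longrightarrow> q \<in> supp \<alpha> \<longleftrightarrow> peval q x = 0"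
      using realizable_zero[OF prime_cone_real(1)[OF \<alpha>(1)], of "insert p G"] assms(1) by auto
    have "\<forall>g\<in>G. peval g x = 0" using x \<alpha>(2) gen_ideal_superset[of G] by blast
    then have "p \<in> supp \<alpha>" using zero x by blast
    then have "- (p ^ (2 * 1)) \<in> \<alpha>"
      using suppD(4)[OF \<alpha>(1), of p p] by (simp add: supp_def power2_eq_square)
    then show "\<exists>s\<in>range (\<lambda>k. p ^ (2 * k)). - s \<in> \<alpha>" by blast
  qed
  then show ?thesis using certificate_power_two[OF is_ideal_gen_ideal] by blast
qed

lemma min_value_attained:
  assumes "\<exists>x0. \<forall>x. peval f x0 \<le> peval f x"
  shows "min_value f \<le> peval f x" "\<exists>x0. peval f x0 = min_value f"
proof -
  obtain x0 where x0: "\<And>x. peval f x0 \<le> peval f x" using assms by blast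
  have "min_value f = peval f x0"
    unfolding min_value_def by (rule cInf_eq_minimum) (use x0 in auto)
  then show "min_value f \<le> peval f x" "\<exists>x0. peval f x0 = min_value f" using x0 by auto
qed

text \<open>
  On a prime cone whose support contains the gradient ideal, \<open>f\<close> is a real constant, which is a value of \<open>f\<close> by specialisation and hence at
  least the minimum. So the products of factors \<open>u - c\<close> with \<open>c \<ge> 0\<close> meet the support of every such cone. The resulting
  product may have repeated factors; raising the reduced product to a power absorbs them.
\<close>

lemma critical_value_certificate:
  fixes f :: "'n::finite rpoly"
  assumes att: "\<exists>x0. \<forall>x. peval f x0 \<le> peval f x"
  shows "\<exists>C j. finite C \<and> (\<forall>c\<in>C. 0 \<le> c) \<and> j > 0 \<and>
    (\<exists>\<sigma>\<in>sos. (\<Prod>c\<in>C. f - cst (min_value f) - cst c) ^ (2 ^ j) + \<sigma> \<in> I_grad f)"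
proof -
  define u where "u = f - cst (min_value f)"
  define a where "a cs = prod_list (map (\<lambda>c. u - cst c) cs)" for cs
  define S where "S = {a cs * a cs | cs. \<forall>c\<in>set cs. 0 \<le> c}"
  have I: "is_ideal (I_grad f)" unfolding I_grad_def by (rule is_ideal_gen_ideal)
  have "\<exists>s\<in>S. \<exists>\<sigma>\<in>sos. s + \<sigma> \<in> I_grad f"
  proof (rule prime_cone_certificate[OF I])
    have "a [] * a [] \<in> S" unfolding S_def by (rule CollectI, rule exI[of _ "[]"]) simp
    then show "1 \<in> S" by (simp add: a_def)
    show "s * t \<in> S" if st: "s \<in> S" "t \<in> S" for s t
    proof -
      obtain cs ds where "s = a cs * a cs" "t = a ds * a ds" "\<forall>c\<in>set cs. 0 \<le> c" "\<forall>c\<in>set ds. 0 \<le> c"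
        using st unfolding S_def by blast
      then have "s * t = a (cs @ ds) * a (cs @ ds)" "\<forall>c\<in>set (cs @ ds). 0 \<le> c"
        by (auto simp: a_def mult_ac)
      then show ?thesis unfolding S_def by blast
    qed
    show "\<exists>a. s = a * a" if "s \<in> S" for s using that by (auto simp: S_def)
    fix \<alpha> assume \<alpha>: "prime_cone \<alpha>" "I_grad f \<subseteq> supp \<alpha>"
    have "\<forall>i. pdiff i f \<in> supp \<alpha>" using \<alpha>(2) gen_ideal_superset[of "range (\<lambda>i. pdiff i f)"] by (auto simp: I_grad_def)
    then obtain c where c: "f - cst c \<in> supp \<alpha>" using prime_cone_real(2)[OF \<alpha>(1)] unfolding critical_values_real_def by blast
    obtain x where "peval (f - cst c) x = 0" using realizable_zero[OF prime_cone_real(1)[OF \<alpha>(1)], of "{f - cst c}"] c by auto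
    then have "min_value f \<le> c" using min_value_attained(1)[OF att, of x] by simp
    define d where "d = c - min_value f"
    have d: "0 \<le> d" "u - cst d = f - cst c" using \<open>min_value f \<le> c\<close> by (simp_all add: d_def u_def is_ring_homD[OF cst_hom])
    have "a [d] * a [d] \<in> S" unfolding S_def using d(1) by (intro CollectI exI[of _ "[d]"]) simp
    moreover have "- (a [d] * a [d]) \<in> \<alpha>"
      using suppD(4)[OF \<alpha>(1) c, of "f - cst c"] by (simp add: a_def d(2) supp_def)
    ultimately show "\<exists>s\<in>S. - s \<in> \<alpha>" by blast
  qed
  then obtain cs \<sigma> where cs: "\<forall>c\<in>set cs. 0 \<le> c" and \<sigma>: "\<sigma> \<in> sos" "a cs * a cs + \<sigma> \<in> I_grad f"
    unfolding S_def by blast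
  define b where "b = (\<Prod>c\<in>set cs. u - cst c)"
  have "a ds dvd b ^ length ds" if "set ds \<subseteq> set cs" for ds
    using that
  proof (induction ds)
    case (Cons d ds)
    have "u - cst d dvd b" unfolding b_def by (rule dvd_prodI) (use Cons.prems in auto)
    then show ?case using Cons by (simp add: a_def mult_dvd_mono)
  qed (simp add: a_def)
  then obtain r where r: "b ^ length cs = a cs * r" by (auto elim: dvdE)
  have "b ^ (2 * length cs) + r * r * \<sigma> = r * r * (a cs * a cs + \<sigma>)"
  proof -
    have "b ^ (2 * length cs) = b ^ length cs * b ^ length cs" by (simp only: mult_2 power_add)
    then show ?thesis unfolding r by (simp add: algebra_simps)
  qed
  then have "b ^ (2 * length cs) + r * r * \<sigma> \<in> I_grad f" using is_idealD(3)[OF I \<sigma>(2)] by simp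
  from certificate_power_two[OF I sos_mult_square[OF \<sigma>(1)] this]
  obtain j \<tau> where "j > 0" "\<tau> \<in> sos" "b ^ (2 ^ j) + \<tau> \<in> I_grad f" by blast
  then show ?thesis using cs unfolding b_def u_def by (intro exI[of _ "set cs"] exI[of _ j]) auto
qed

lemma prod_linear_dvd:
  fixes p :: "'k::field poly"
  assumes "finite C" "\<And>c. c \<in> C \<Longrightarrow> poly p c = 0"
  shows "(\<Prod>c\<in>C. [:- c, 1:]) dvd p"
  using assms
proof (induction C arbitrary: p)
  case (insert c C)
  then obtain q where q: "p = [:- c, 1:] * q" by (metis dvdE insertI1 poly_eq_0_iff_dvd)
  have "poly q d = 0" if "d \<in> C" for d
    using insert.prems[of d] insert.hyps that by (auto simp: q)
  from insert.IH[OF this] have "(\<Prod>c\<in>C. [:- c, 1:]) dvd q" by blast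
  then show ?case unfolding q prod.insert[OF insert.hyps] by (intro mult_dvd_mono) auto
qed simp

lemma interpolation:
  fixes g :: "'k::field \<Rightarrow> 'k"
  assumes "finite C"
  shows "\<exists>w. \<forall>c\<in>C. poly w c = g c"
  using assms
proof induction
  case (insert c C)
  then obtain w where w: "\<forall>d\<in>C. poly w d = g d" by blast
  define P where "P = (\<Prod>d\<in>C. [:- d, 1:])"
  have "poly P c \<noteq> 0" using insert.hyps by (auto simp: P_def poly_prod)
  moreover have "poly P d = 0" if "d \<in> C" for d using insert.hyps that by (auto simp: P_def poly_prod)
  ultimately show ?case using w
    by (intro exI[of _ "w + Polynomial.smult ((g c - poly w c) / poly P c) P"]) auto
qed simp

text \<open>
  For small \<open>\<delta>\<close> the number \<open>c - \<delta> * c^2\<close> is nonnegative at all \<open>c \<in> C\<close>, hence a square, and \<open>w\<close> interpolates the square roots.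
\<close>

lemma nonneg_modulo_roots:
  assumes C: "finite C" "\<And>c::real. c \<in> C \<Longrightarrow> 0 \<le> c"
  shows "\<exists>\<delta>>0. \<exists>w q. [:0, 1:] = Polynomial.smult \<delta> ([:0, 1:] * [:0, 1:]) + w * w + (\<Prod>c\<in>C. [:- c, 1:]) * q"
proof -
  define \<delta> where "\<delta> = 1 / (1 + \<Sum>C)"
  have s: "0 \<le> \<Sum>C" using C by (intro sum_nonneg) auto
  then have \<delta>: "0 < \<delta>" by (simp add: \<delta>_def)
  have le: "0 \<le> c - \<delta> * c^2" if "c \<in> C" for c
  proof -
    have "c \<le> \<Sum>C" using C that by (intro member_le_sum) auto
    then have "\<delta> * c \<le> 1" using s by (simp add: \<delta>_def field_simps)
    then have "0 \<le> c * (1 - \<delta> * c)" using C(2)[OF that] by simp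
    then show ?thesis by (simp add: algebra_simps power2_eq_square)
  qed
  obtain w where w: "\<forall>c\<in>C. poly w c = sqrt (c - \<delta> * c^2)" 
    using interpolation[OF C(1), of "\<lambda>c. sqrt (c - \<delta> * c^2)"] by auto
  define p where "p = [:0, 1:] - Polynomial.smult \<delta> ([:0, 1:] * [:0, 1:]) - w * w"
  have "poly p c = 0" if "c \<in> C" for c
  proof -
    have "poly w c * poly w c = c - \<delta> * c^2" using le[OF that] w that by simp
    then show ?thesis by (simp add: p_def power2_eq_square algebra_simps)
  qed
  from prod_linear_dvd[OF C(1) this] obtain q where q: "p = (\<Prod>c\<in>C. [:- c, 1:]) * q" by (auto elim: dvdE)
  have "x = y + z + r" if "x - y - z = r" for x y z r :: "real poly" using that by (auto simp: algebra_simps)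
  from this[OF q[unfolded p_def]] have "[:0, 1:] = Polynomial.smult \<delta> ([:0, 1:] * [:0, 1:]) + w * w + (\<Prod>c\<in>C. [:- c, 1:]) * q" .
  then show ?thesis using \<delta> by blast
qed

lemma nonneg_modulo_roots_rpoly:
  fixes u :: "'n rpoly"
  assumes C: "finite C" "\<And>c::real. c \<in> C \<Longrightarrow> 0 \<le> c"
  shows "\<exists>\<delta>>0. \<exists>w q. u = cst \<delta> * (u * u) + w * w + (\<Prod>c\<in>C. u - cst c) * q"
proof -
  obtain \<delta> w q where \<delta>: "\<delta> > 0" and
    eq: "[:0, 1:] = Polynomial.smult \<delta> ([:0, 1:] * [:0, 1:]) + w * w + (\<Prod>c\<in>C. [:- c, 1:]) * q"
    using nonneg_modulo_roots[OF C] by blast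
  define ev where "ev p = poly (map_poly cst p) u" for p
  have hom: "is_ring_hom ev" by (simp add: is_ring_hom_def ev_def map_poly_hom[OF cst_hom] is_ring_homD[OF cst_hom])
  note e = is_ring_homD[OF hom]
  have X: "ev [:0, 1:] = u" "ev (Polynomial.smult c p) = cst c * ev p" "ev [:- c, 1:] = u - cst c" for c p
    by (simp_all add: ev_def map_poly_hom[OF cst_hom] is_ring_homD[OF cst_hom])
  have "ev [:0, 1:] = ev (Polynomial.smult \<delta> ([:0, 1:] * [:0, 1:]) + w * w + (\<Prod>c\<in>C. [:- c, 1:]) * q)"
    using arg_cong[OF eq] .
  then have "u = cst \<delta> * (u * u) + ev w * ev w + (\<Prod>c\<in>C. u - cst c) * ev q"
    by (simp only: e(2,3) X is_ring_hom_prod[OF hom])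
  then show ?thesis using \<delta> by blast
qed

text \<open>
  The real zeros of \<open>f - min_value f\<close> are the minimisers.
\<close>

lemma I_min_certificate:
  fixes p :: "'n::finite rpoly"
  assumes "p \<in> I_min f"
  shows "\<exists>j>0. \<exists>\<sigma>\<in>sos. \<exists>g\<in>I_grad f. \<exists>q. p ^ (2 ^ j) + \<sigma> = g + q * (f - cst (min_value f))"
proof -
  let ?u = "f - cst (min_value f)"
  have "\<exists>j>0. \<exists>\<sigma>\<in>sos. p ^ (2 ^ j) + \<sigma> \<in> gen_ideal (insert ?u (range (\<lambda>i. pdiff i f)))"
    by (rule real_nullstellensatz) (use assms in \<open>auto simp: I_min_def\<close>)
  then obtain j \<sigma> q where j: "j > 0" "\<sigma> \<in> sos" and q: "p ^ (2 ^ j) + \<sigma> - q * ?u \<in> I_grad f"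
    unfolding gen_ideal_insert I_grad_def by blast
  have "p ^ (2 ^ j) + \<sigma> = (p ^ (2 ^ j) + \<sigma> - q * ?u) + q * ?u" by simp
  then show ?thesis using j q by blast
qed

section \<open>Finite generation of ideals\<close>

text \<open>
  The span of \<open>B\<close> over a subring \<open>S\<close>, which need not be the whole ring.
\<close>

inductive_set comb :: "'c::comm_ring_1 set \<Rightarrow> 'c set \<Rightarrow> 'c set" for S B where
  zero: "0 \<in> comb S B"
| add: "v \<in> comb S B \<Longrightarrow> s \<in> S \<Longrightarrow> b \<in> B \<Longrightarrow> v + s * b \<in> comb S B"

lemma comb_plus:
  assumes "v \<in> comb S B" "w \<in> comb S B"
  shows "v + w \<in> comb S B"
  using assms(2,1) by (induction w rule: comb.induct) (auto simp: add.assoc[symmetric] intro: comb.intros)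

lemma comb_mult:
  assumes "is_subring S" "v \<in> comb S B" "s \<in> S"
  shows "s * v \<in> comb S B"
  using assms(2)
proof induction
  case (add v t b)
  have "s * (v + t * b) = s * v + (s * t) * b" by (simp add: algebra_simps)
  then show ?case using comb.add[OF add.IH is_subringD(6)[OF assms(1,3) add(2)] add(3)] by simp
qed (simp add: comb.zero)

definition ideal_in :: "'c::comm_ring_1 set \<Rightarrow> 'c set \<Rightarrow> bool" where
  "ideal_in S I \<longleftrightarrow> I \<subseteq> S \<and> 0 \<in> I \<and> (\<forall>x\<in>I. \<forall>y\<in>I. x + y \<in> I) \<and> (\<forall>x\<in>I. \<forall>s\<in>S. s * x \<in> I)"

lemma comb_subset_ideal:
  assumes "ideal_in S I" "B \<subseteq> I"
  shows "comb S B \<subseteq> I"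
proof
  fix v assume "v \<in> comb S B"
  then show "v \<in> I" by induction (use assms in \<open>auto simp: ideal_in_def\<close>)
qed

definition noetherian_on :: "'c::comm_ring_1 set \<Rightarrow> bool" where
  "noetherian_on S \<longleftrightarrow> (\<forall>I. ideal_in S I \<longrightarrow> (\<exists>B. finite B \<and> B \<subseteq> I \<and> I \<subseteq> comb S B))"

text \<open>
  Elements of an ideal of \<open>S[x]\<close> are represented by polynomials over \<open>S\<close>, not necessarily in a unique way. The
  ideals of leading coefficients of representatives of degree at most \<open>n\<close> increase with \<open>n\<close>, so they are constant from some \<open>N\<close> on, and
  representatives of generators of the first of these ideals, up to the index \<open>N\<close>, suffice.
\<close>

theorem hilbert_basis:
  fixes S :: "'c::comm_ring_1 set" and x :: 'c
  assumes S: "is_subring S" and noeth: "noetherian_on S"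
  shows "noetherian_on ((\<lambda>P. poly P x) ` polys_over S)"
  unfolding noetherian_on_def
proof (intro allI impI)
  define Sx where "Sx = (\<lambda>P. poly P x) ` polys_over S"
  fix I assume "ideal_in ((\<lambda>P. poly P x) ` polys_over S) I"
  then have I: "I \<subseteq> Sx" "0 \<in> I" "\<And>a b. a \<in> I \<Longrightarrow> b \<in> I \<Longrightarrow> a + b \<in> I" "\<And>a s. a \<in> I \<Longrightarrow> s \<in> Sx \<Longrightarrow> s * a \<in> I"
    by (auto simp: ideal_in_def Sx_def)
  note P = polys_over_closed[OF S]
  have SxI: "poly p x \<in> Sx" if "p \<in> polys_over S" for p using that by (auto simp: Sx_def)
  have S_Sx: "s \<in> Sx" if "s \<in> S" for s using SxI[OF P(2)[OF that]] by simp
  have Sx: "is_subring Sx"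
    unfolding is_subring_def
  proof (intro conjI ballI)
    show "1 \<in> Sx" by (rule S_Sx[OF is_subringD(2)[OF S]])
    fix a b assume "a \<in> Sx" "b \<in> Sx"
    then obtain p q where "p \<in> polys_over S" "q \<in> polys_over S" "a = poly p x" "b = poly q x" by (auto simp: Sx_def)
    then show "a - b \<in> Sx" "a * b \<in> Sx" using SxI[of "p - q"] SxI[of "p * q"] P(5,6)[of p q] by auto
  qed
  define rep where "rep n a R \<longleftrightarrow> R \<in> polys_over S \<and> degree R \<le> n \<and> coeff R n = a" for n a R
  \<comment> \<open>leading coefficients of the representatives of degree at most \<open>n\<close>\<close>
  define L where "L n = {a. \<exists>R. rep n a R \<and> poly R x \<in> I}" for n
  have L_mono: "L n \<subseteq> L m" if "n \<le> m" for n m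
  proof
    fix a assume "a \<in> L n"
    then obtain R where R: "rep n a R" "poly R x \<in> I" unfolding L_def by blast
    have m1: "monom 1 (m - n) \<in> polys_over S" by (rule P(3)[OF is_subringD(2)[OF S]])
    have "rep m a (monom 1 (m - n) * R)"
      unfolding rep_def
    proof (intro conjI)
      show "monom 1 (m - n) * R \<in> polys_over S" using m1 R(1) P(6) by (auto simp: rep_def)
      show "degree (monom 1 (m - n) * R) \<le> m"
        using degree_mult_le[of "monom 1 (m - n)" R] degree_monom_le[of "1::'c" "m - n"] R(1) that
        unfolding rep_def by linarith
      show "coeff (monom 1 (m - n) * R) m = a" using R(1) that by (simp add: rep_def coeff_monom_mult)
    qed
    moreover have "poly (monom 1 (m - n) * R) x \<in> I" using I(4)[OF R(2) SxI[OF m1]] by simp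
    ultimately show "a \<in> L m" unfolding L_def by blast
  qed
  have L_ideal: "ideal_in S (L n)" for n
    unfolding ideal_in_def
  proof (intro conjI ballI)
    show "L n \<subseteq> S" by (auto simp: L_def rep_def polys_over_def)
    have "rep n 0 0" using P(1) by (simp add: rep_def)
    then show "0 \<in> L n" using I(2) unfolding L_def by (metis (mono_tags, lifting) mem_Collect_eq poly_0)
    fix a assume "a \<in> L n"
    then obtain R where R: "rep n a R" "poly R x \<in> I" unfolding L_def by blast
    {
      fix b assume "b \<in> L n"
      then obtain R' where R': "rep n b R'" "poly R' x \<in> I" unfolding L_def by blast
      have "rep n (a + b) (R + R')" using R R' P(4) unfolding rep_def by (auto intro: degree_add_le)
      then show "a + b \<in> L n" using I(3)[OF R(2) R'(2)] unfolding L_def by (metis (mono_tags, lifting) mem_Collect_eq poly_add)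
    }
    fix s assume s: "s \<in> S"
    have "rep n (s * a) (Polynomial.smult s R)"
      using R P(7)[OF s] degree_smult_le[of s R] unfolding rep_def by auto
    then show "s * a \<in> L n" using I(4)[OF R(2) S_Sx[OF s]] unfolding L_def by (metis (mono_tags, lifting) mem_Collect_eq poly_smult)
  qed
  have "ideal_in S (\<Union>n. L n)"
    unfolding ideal_in_def
  proof (intro conjI ballI)
    have "L n \<subseteq> S" "0 \<in> L n" for n using L_ideal[of n] unfolding ideal_in_def by blast+
    then show "(\<Union>n. L n) \<subseteq> S" "0 \<in> (\<Union>n. L n)" by blast+
    fix a assume "a \<in> (\<Union>n. L n)"
    then obtain n where n: "a \<in> L n" by blast
    {
      fix b assume "b \<in> (\<Union>n. L n)"
      then obtain m where "b \<in> L m" by blast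
      then have "a \<in> L (max n m)" "b \<in> L (max n m)" using n L_mono[of n "max n m"] L_mono[of m "max n m"] by auto
      then have "a + b \<in> L (max n m)" using L_ideal unfolding ideal_in_def by blast
      then show "a + b \<in> (\<Union>n. L n)" by blast
    }
    fix s assume "s \<in> S"
    then show "s * a \<in> (\<Union>n. L n)" using n L_ideal[of n] unfolding ideal_in_def by blast
  qed
  then obtain A where A: "finite A" "A \<subseteq> (\<Union>n. L n)" "(\<Union>n. L n) \<subseteq> comb S A"
    using noeth unfolding noetherian_on_def by blast
  have "\<exists>N. A \<subseteq> L N"
    using A(1,2)
  proof induction
    case (insert a A)
    then obtain N n where "A \<subseteq> L N" "a \<in> L n" by auto
    then have "insert a A \<subseteq> L (max N n)" using L_mono[of N "max N n"] L_mono[of n "max N n"] by auto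
    then show ?case by blast
  qed simp
  then obtain N where N: "A \<subseteq> L N" by blast
  have stable: "L n \<subseteq> L N" for n using A(3) comb_subset_ideal[OF L_ideal N] by blast
  have "\<forall>n. \<exists>B. finite B \<and> B \<subseteq> L n \<and> L n \<subseteq> comb S B"
    using noeth L_ideal unfolding noetherian_on_def by blast
  then obtain B where B: "\<And>n. finite (B n)" "\<And>n. B n \<subseteq> L n" "\<And>n. L n \<subseteq> comb S (B n)" by metis
  define pick where "pick n a = (SOME R. rep n a R \<and> poly R x \<in> I)" for n a
  have pick: "rep n a (pick n a)" "poly (pick n a) x \<in> I" if "a \<in> L n" for n a
  proof -
    have "\<exists>R. rep n a R \<and> poly R x \<in> I" using that by (simp add: L_def)
    from someI_ex[OF this] show "rep n a (pick n a)" "poly (pick n a) x \<in> I" unfolding pick_def by blast+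
  qed
  define K where "K = (\<Union>n\<le>N. (\<lambda>a. poly (pick n a) x) ` B n)"
  have K: "finite K" using B(1) by (auto simp: K_def)
  have K_I: "K \<subseteq> I" using pick(2)[OF subsetD[OF B(2)]] by (auto simp: K_def)
  have KI: "comb Sx K \<subseteq> I"
    by (rule comb_subset_ideal[OF _ K_I]) (use I in \<open>auto simp: ideal_in_def\<close>)
  have lift: "\<exists>R. rep n a R \<and> poly R x \<in> comb Sx K" if n: "n \<le> N" and a: "a \<in> comb S (B n)" for n a
    using a
  proof induction
    case zero
    show ?case by (rule exI[of _ 0]) (use P(1) in \<open>simp add: rep_def comb.zero\<close>)
  next
    case (add a s b)
    then obtain R where R: "rep n a R" "poly R x \<in> comb Sx K" by blast
    let ?R = "R + Polynomial.smult s (pick n b)"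
    have pb: "rep n b (pick n b)" using pick(1) B(2) add by blast
    have "degree (Polynomial.smult s (pick n b)) \<le> n"
      using degree_smult_le[of s "pick n b"] pb unfolding rep_def by linarith
    then have "rep n (a + s * b) ?R"
      using R(1) pb P(4)[OF _ P(7)[OF add(2)]] unfolding rep_def by (auto intro: degree_add_le)
    moreover have "poly (pick n b) x \<in> K" using n add(3) by (auto simp: K_def)
    then have "poly ?R x \<in> comb Sx K" using comb.add[OF R(2) S_Sx[OF add(2)]] by simp
    ultimately show ?case by blast
  qed
  \<comment> \<open>the leading term of a representative is cancelled by a combination of the chosen elements\<close>
  have main: "poly p x \<in> comb Sx K" if "p \<in> polys_over S" "poly p x \<in> I" for p
    using that
  proof (induction "if p = 0 then 0 else Suc (degree p)" arbitrary: p rule: less_induct)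
    case less
    show ?case
    proof (cases "p = 0")
      case False
      define d where "d = degree p"
      have "rep d (lead_coeff p) p" using less.prems by (simp add: rep_def d_def)
      then have "lead_coeff p \<in> L d" using less.prems unfolding L_def by blast
      then have "lead_coeff p \<in> L (min d N)" using stable by (auto simp: min_def)
      then obtain R where R: "rep (min d N) (lead_coeff p) R" "poly R x \<in> comb Sx K"
        using lift[OF min.cobounded2 subsetD[OF B(3)], of "lead_coeff p" d] by blast
      define M where "M = monom 1 (d - min d N) * R"
      have m1: "monom 1 (d - min d N) \<in> polys_over S" by (rule P(3)[OF is_subringD(2)[OF S]])
      have M: "M \<in> polys_over S" using m1 R(1) P(6) by (auto simp: M_def rep_def)
      have "degree M \<le> d"
        using degree_mult_le[of "monom 1 (d - min d N)" R] degree_monom_le[of "1::'c" "d - min d N"] R(1)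
        unfolding M_def rep_def by linarith
      moreover have "coeff M d = lead_coeff p"
        using R(1) by (simp add: M_def rep_def coeff_monom_mult)
      ultimately have "p - M = 0 \<or> degree (p - M) < degree p"
        using degree_diff_cancel_less[of p d M] by (simp add: d_def)
      then have sm: "(if p - M = 0 then 0 else Suc (degree (p - M))) < (if p = 0 then 0 else Suc (degree p))"
        using False by auto
      have Mx: "poly M x \<in> comb Sx K" unfolding M_def poly_mult by (rule comb_mult[OF Sx R(2) SxI[OF m1]])
      then have "poly p x + (- 1) * poly M x \<in> I"
        using I(3)[OF less.prems(2) I(4)] KI S_Sx[OF is_subringD(3)[OF S is_subringD(2)[OF S]]] by blast
      then have "poly (p - M) x \<in> I" by simp
      from less.hyps[OF sm P(5)[OF less.prems(1) M] this] have "poly (p - M) x \<in> comb Sx K" .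
      from comb_plus[OF this Mx] show ?thesis by simp
    qed (simp add: comb.zero)
  qed
  have "I \<subseteq> comb Sx K" using main I(1) by (auto simp: Sx_def)
  then show "\<exists>B. finite B \<and> B \<subseteq> I \<and> I \<subseteq> comb ((\<lambda>P. poly P x) ` polys_over S) B"
    using K K_I unfolding Sx_def by blast
qed

lemma noetherian_polys_in:
  fixes V :: "'n set"
  assumes "finite V"
  shows "noetherian_on (polys_in V)"
  using assms
proof induction
  case empty
  show ?case
    unfolding noetherian_on_def
  proof (intro allI impI)
    fix I :: "'n rpoly set" assume I: "ideal_in (polys_in {}) I"
    show "\<exists>B. finite B \<and> B \<subseteq> I \<and> I \<subseteq> comb (polys_in {}) B"
    proof (cases "I \<subseteq> {0}")
      case True
      then show ?thesis by (intro exI[of _ "{}"]) (auto intro: comb.zero)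
    next
      case False
      then obtain b where b: "b \<in> I" "b \<noteq> 0" by blast
      then obtain c where c: "b = cst c" using I polys_in_empty unfolding ideal_in_def by blast
      then have c0: "c \<noteq> 0" using b is_ring_homD(4)[OF cst_hom] by auto
      have "I \<subseteq> comb (polys_in {}) {b}"
      proof
        fix a assume "a \<in> I"
        then obtain d where d: "a = cst d" using I polys_in_empty unfolding ideal_in_def by blast
        have "a = 0 + cst (d / c) * b" using c0 by (simp add: d c is_ring_homD(3)[OF cst_hom, symmetric])
        also have "\<dots> \<in> comb (polys_in {}) {b}" by (intro comb.intros polys_in.cst) simp
        finally show "a \<in> comb (polys_in {}) {b}" .
      qed
      then show ?thesis using b by (intro exI[of _ "{b}"]) auto
    qed
  qed
next
  case (insert i V)
  have "polys_in (insert i V) = (\<lambda>P. poly P (var i)) ` polys_over (polys_in V)"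
  proof
    show "polys_in (insert i V) \<subseteq> (\<lambda>P. poly P (var i)) ` polys_over (polys_in V)"
    proof
      fix p assume "p \<in> polys_in (insert i V)"
      from polys_in_insert[OF this] obtain P where "P \<in> polys_over (polys_in V)" "poly P (var i) = p" by blast
      then show "p \<in> (\<lambda>P. poly P (var i)) ` polys_over (polys_in V)" by blast
    qed
    have "polys_in V \<subseteq> polys_in (insert i V)"
    proof
      fix p assume "p \<in> polys_in V" then show "p \<in> polys_in (insert i V)" by induction (auto intro: polys_in.intros)
    qed
    then show "(\<lambda>P. poly P (var i)) ` polys_over (polys_in V) \<subseteq> polys_in (insert i V)"
      using poly_in_subring[OF is_subring_polys_in, of _ "insert i V" "var i"] polys_in.var[of i "insert i V"]
      by (auto simp: polys_over_def)
  qed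
  then show ?case using hilbert_basis[OF is_subring_polys_in insert.IH, of "var i"] by simp
qed

corollary ideal_finitely_generated:
  fixes I :: "'n::finite rpoly set"
  assumes I: "is_ideal I"
  shows "\<exists>B. finite B \<and> B \<subseteq> I \<and> gen_ideal B = I"
proof -
  have U: "polys_in UNIV = (UNIV :: 'n rpoly set)" using polys_in_UNIV by blast
  have "ideal_in (UNIV :: 'n rpoly set) I" using I by (auto simp: ideal_in_def is_ideal_def)
  then obtain B where B: "finite B" "B \<subseteq> I" "I \<subseteq> comb UNIV B"
    using noetherian_polys_in[OF finite[of "UNIV :: 'n set"]] unfolding U noetherian_on_def by blast
  have "ideal_in UNIV (gen_ideal B)" using is_ideal_gen_ideal[of B] by (auto simp: ideal_in_def is_ideal_def)
  then have "comb UNIV B \<subseteq> gen_ideal B" using gen_ideal_superset by (rule comb_subset_ideal)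
  then show ?thesis using B gen_ideal_minimal[OF B(2) I] by blast
qed

section \<open>Moment forms and the kernel of the Hankel operator\<close>

lemma polys_upto_iff: "p \<in> polys_upto d \<longleftrightarrow> (\<forall>m\<in>Poly_Mapping.keys p. (\<Sum>i\<in>UNIV. Poly_Mapping.lookup m i) \<le> d)"
  unfolding polys_upto_def pdegree_def by (subst mem_Collect_eq, subst Max_le_iff) auto

lemma polys_upto_add: "p \<in> polys_upto d \<Longrightarrow> q \<in> polys_upto d \<Longrightarrow> p + q \<in> polys_upto d"
  unfolding polys_upto_iff using Poly_Mapping.keys_add[of p q] by blast

lemma polys_upto_mult:
  assumes "p \<in> polys_upto a" "q \<in> polys_upto b"
  shows "p * q \<in> polys_upto (a + b)"
  unfolding polys_upto_iff
proof
  fix m assume "m \<in> Poly_Mapping.keys (p * q)"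
  then obtain k l where kl: "m = k + l" "k \<in> Poly_Mapping.keys p" "l \<in> Poly_Mapping.keys q"
    using keys_mult[of p q] by blast
  then have "(\<Sum>i\<in>UNIV. Poly_Mapping.lookup k i) \<le> a" "(\<Sum>i\<in>UNIV. Poly_Mapping.lookup l i) \<le> b"
    using assms unfolding polys_upto_iff by blast+
  then show "(\<Sum>i\<in>UNIV. Poly_Mapping.lookup m i) \<le> a + b"
    by (simp add: kl(1) lookup_add sum.distrib)
qed

lemma polys_upto_mono: "p \<in> polys_upto a \<Longrightarrow> a \<le> b \<Longrightarrow> p \<in> polys_upto b"
  by (simp add: polys_upto_def)

lemma polys_upto_cst: "cst c \<in> polys_upto d"
  by (auto simp: polys_upto_iff cst_def split: if_splits)

lemma cst_0: "cst 0 = 0" and cst_1: "cst 1 = 1"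
  by (rule is_ring_homD[OF cst_hom])+

lemma polys_upto_0: "0 \<in> polys_upto d" and polys_upto_1: "1 \<in> polys_upto d"
  using polys_upto_cst[of 0 d] polys_upto_cst[of 1 d] by (simp_all add: cst_0 cst_1)

lemma polys_upto_cst_mult: "p \<in> polys_upto d \<Longrightarrow> cst c * p \<in> polys_upto d"
  using polys_upto_mult[OF polys_upto_cst[of c 0], of p d] by simp

lemma scal_cst: "scal c p = cst c * p"
  by (simp add: scal_def cst_def)

lemma eventually_polys_upto: "\<forall>\<^sub>F t in sequentially. p \<in> polys_upto t"
  unfolding polys_upto_def mem_Collect_eq by (rule eventually_ge_at_top)

lemma moment_formsD:
  assumes "\<Lambda> \<in> moment_forms G t"
  shows "p \<in> polys_upto (2 * t) \<Longrightarrow> q \<in> polys_upto (2 * t) \<Longrightarrow> \<Lambda> (p + q) = \<Lambda> p + \<Lambda> q"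
    "p \<in> polys_upto (2 * t) \<Longrightarrow> \<Lambda> (cst c * p) = c * \<Lambda> p"
    "g \<in> trunc_ideal G (2 * t) \<Longrightarrow> \<Lambda> g = 0" "\<Lambda> 1 = 1" "p \<in> polys_upto t \<Longrightarrow> 0 \<le> \<Lambda> (p * p)"
  using assms by (auto simp: moment_forms_def dual_upto_def scal_cst power2_eq_square)

lemma moment_form_cst: "\<Lambda> \<in> moment_forms G t \<Longrightarrow> \<Lambda> (cst c) = c"
  using moment_formsD(2)[of \<Lambda> G t 1 c] moment_formsD(4)[of \<Lambda> G t] by (simp add: polys_upto_1)

lemma polys_upto_mult2: "p \<in> polys_upto t \<Longrightarrow> q \<in> polys_upto t \<Longrightarrow> p * q \<in> polys_upto (2 * t)"
  using polys_upto_mult[of p t q t] by (simp add: mult_2)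

text \<open>
  The Cauchy-Schwarz argument: \<open>\<Lambda> ((q + c * p)^2) \<ge> 0\<close> for all real \<open>c\<close>, and the quadratic term vanishes.
\<close>

lemma moment_form_kernel:
  assumes \<Lambda>: "\<Lambda> \<in> moment_forms G t" and pq: "p \<in> polys_upto t" "q \<in> polys_upto t" and 0: "\<Lambda> (p * p) = 0"
  shows "\<Lambda> (p * q) = 0"
proof -
  note D = moment_formsD[OF \<Lambda>]
  have ineq: "0 \<le> \<Lambda> (q * q) + 2 * c * \<Lambda> (p * q)" for c
  proof -
    let ?r = "q + cst c * p"
    have r: "?r \<in> polys_upto t" by (intro polys_upto_add polys_upto_cst_mult pq)
    have "?r * ?r = q * q + (cst (2 * c) * (p * q) + cst (c * c) * (p * p))"
    proof -
      define k :: "'a rpoly" where "k = cst c"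
      have 1: "cst (2 * c) = k + k" by (simp only: mult_2 is_ring_homD(2)[OF cst_hom] k_def)
      have 2: "cst (c * c) = k * k" by (simp only: is_ring_homD(3)[OF cst_hom] k_def)
      show ?thesis unfolding 1 2 k_def[symmetric] by (simp only: distrib_left distrib_right ac_simps)
    qed
    moreover have "p * q \<in> polys_upto (2 * t)" "p * p \<in> polys_upto (2 * t)" "q * q \<in> polys_upto (2 * t)"
      using pq polys_upto_mult2 by blast+
    ultimately have "\<Lambda> (?r * ?r) = \<Lambda> (q * q) + (2 * c * \<Lambda> (p * q) + c * c * \<Lambda> (p * p))"
      by (simp add: D(1) D(2) polys_upto_add polys_upto_cst_mult)
    then show ?thesis using D(5)[OF r] 0 by simp
  qed
  show ?thesis
  proof (rule ccontr)
    assume n: "\<not> ?thesis"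
    \<comment> \<open>this \<open>c\<close> makes the linear expression equal to \<open>- 1\<close>\<close>
    show False using ineq[of "- (\<Lambda> (q * q) + 1) / (2 * \<Lambda> (p * q))"] n by simp
  qed
qed

text \<open>
  Each step applies \<open>moment_form_kernel\<close> with \<open>q = 1\<close> to halve the exponent.
\<close>

lemma moment_form_root:
  assumes \<Lambda>: "\<Lambda> \<in> moment_forms G t" and p: "\<And>k. k \<le> 2 ^ j \<Longrightarrow> p ^ k \<in> polys_upto t"
    and "j > 0" "\<Lambda> (p ^ (2 ^ j)) = 0"
  shows "\<Lambda> (p * p) = 0"
  using assms(2-4)
proof (induction j)
  case (Suc j)
  show ?case
  proof (cases "j = 0")
    case True
    then show ?thesis using Suc.prems(3) by (simp add: power2_eq_square)
  next
    case False
    have le: "k \<le> 2 ^ j \<Longrightarrow> p ^ k \<in> polys_upto t" for k using Suc.prems(1)[of k] by simp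
    have "p ^ (2 ^ Suc j) = p ^ (2 ^ j) * p ^ (2 ^ j)" by (simp add: power_add[symmetric] mult_2)
    then have "\<Lambda> (p ^ (2 ^ j) * p ^ (2 ^ j)) = 0" using Suc.prems(3) by simp
    from moment_form_kernel[OF \<Lambda> le polys_upto_1 this] have "\<Lambda> (p ^ (2 ^ j)) = 0" by simp
    with Suc.IH[OF le] False show ?thesis by simp
  qed
qed simp

text \<open>
  A representation \<open>g = \<Sum> c a * a\<close> belongs to the truncated ideal once \<open>t\<close> exceeds the degrees of its terms.
\<close>

lemma eventually_moment_form_ideal:
  fixes G :: "'n::finite rpoly set"
  assumes "g \<in> gen_ideal G"
  shows "\<forall>\<^sub>F t in sequentially. \<forall>\<Lambda>\<in>moment_forms G t. \<Lambda> g = 0"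
proof -
  interpret Modules.module "(*) :: 'n rpoly \<Rightarrow> 'n rpoly \<Rightarrow> 'n rpoly" by (rule module_times)
  obtain F c where F: "finite F" "F \<subseteq> G" "g = (\<Sum>a\<in>F. c a * a)"
    using assms unfolding gen_ideal_def span_explicit by blast
  have "\<forall>\<^sub>F t in sequentially. \<forall>a\<in>F. pdegree (c a) + pdegree a \<le> t"
    using F(1) by (intro eventually_ball_finite ballI eventually_ge_at_top) auto
  then show ?thesis
  proof eventually_elim
    case (elim t)
    have "pdegree a \<le> 2 * t \<and> pdegree (c a) \<le> 2 * t - pdegree a" if "a \<in> F" for a
      using elim that by fastforce
    then have "g \<in> trunc_ideal G (2 * t)"
      unfolding trunc_ideal_def polys_upto_def using F by blast
    then show ?case using moment_formsD(3) by blast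
  qed
qed

lemma eventually_moment_form_sos:
  assumes "\<sigma> \<in> sos"
  shows "\<forall>\<^sub>F t in sequentially. \<forall>\<Lambda>\<in>moment_forms G t. 0 \<le> \<Lambda> \<sigma>"
  using assms
proof induction
  case zero
  have "\<Lambda> 0 = 0" if "\<Lambda> \<in> moment_forms G t" for \<Lambda> t using moment_form_cst[OF that, of 0] by (simp add: cst_0)
  then have "\<forall>t. \<forall>\<Lambda>\<in>moment_forms G t. 0 \<le> \<Lambda> 0" by (metis order_refl)
  then show ?case by (rule always_eventually)
next
  case (add \<sigma> a)
  show ?case using add.IH eventually_polys_upto[of a] eventually_polys_upto[of \<sigma>]
  proof eventually_elim
    case (elim t)
    show ?case
    proof
      fix \<Lambda> assume \<Lambda>: "\<Lambda> \<in> moment_forms G t"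
      have "\<Lambda> (\<sigma> + a * a) = \<Lambda> \<sigma> + \<Lambda> (a * a)"
        using elim by (intro moment_formsD(1)[OF \<Lambda>]) (auto intro: polys_upto_mult2 polys_upto_mono)
      then show "0 \<le> \<Lambda> (\<sigma> + a * a)" using elim(1,2) \<Lambda> moment_formsD(5)[OF \<Lambda>] by simp
    qed
  qed
qed

lemma eventually_powers_upto: "\<forall>\<^sub>F t in sequentially. \<forall>k\<le>N. p ^ k \<in> polys_upto t"
proof -
  have "\<forall>\<^sub>F t in sequentially. \<forall>k\<in>{..N}. p ^ k \<in> polys_upto t"
    by (intro eventually_ball_finite ballI eventually_polys_upto) simp
  then show ?thesis by (simp only: Ball_def atMost_iff)
qed

text \<open>
  In \<open>\<Lambda> (p ^ (2 ^ j)) + \<Lambda> \<sigma> = 0\<close> both summands are nonnegative, so the first one vanishes. The condition \<open>Pr\<close> allows to restrict the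
  statement to optimal forms.
\<close>

lemma eventually_square_kernel:
  assumes "j > 0" "\<sigma> \<in> sos" "\<forall>\<^sub>F t in sequentially. \<forall>\<Lambda>\<in>moment_forms G t. Pr \<Lambda> t \<longrightarrow> \<Lambda> (p ^ (2 ^ j) + \<sigma>) = 0"
  shows "\<forall>\<^sub>F t in sequentially. \<forall>\<Lambda>\<in>moment_forms G t. Pr \<Lambda> t \<longrightarrow> \<Lambda> (p * p) = 0"
  using assms(3) eventually_powers_upto[of "2 ^ j" p] eventually_moment_form_sos[OF assms(2), of G]
    eventually_polys_upto[of \<sigma>]
proof eventually_elim
  case (elim t)
  show ?case
  proof (intro ballI impI)
    fix \<Lambda> assume \<Lambda>: "\<Lambda> \<in> moment_forms G t" and Pr: "Pr \<Lambda> t"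
    have pw: "p ^ k \<in> polys_upto t" if "k \<le> 2 ^ j" for k using elim(2) that by blast
    have "\<Lambda> (p ^ (2 ^ j) + \<sigma>) = \<Lambda> (p ^ (2 ^ j)) + \<Lambda> \<sigma>"
      using pw[of "2 ^ j"] elim(4) by (intro moment_formsD(1)[OF \<Lambda>]) (auto intro: polys_upto_mono)
    moreover have "0 \<le> \<Lambda> (p ^ (2 ^ j))"
    proof -
      obtain i where i: "j = Suc i" using assms(1) by (cases j) auto
      have "p ^ (2 ^ j) = p ^ (2 ^ i) * p ^ (2 ^ i)" by (simp add: i power_add[symmetric] mult_2)
      moreover have "p ^ (2 ^ i) \<in> polys_upto t" by (rule pw) (simp add: i)
      ultimately show ?thesis using moment_formsD(5)[OF \<Lambda>] by simp
    qed
    ultimately have "\<Lambda> (p ^ (2 ^ j)) = 0" using elim(1,3) \<Lambda> Pr by fastforce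
    then show "\<Lambda> (p * p) = 0" using moment_form_root[OF \<Lambda> pw assms(1)] by blast
  qed
qed

text \<open>
  Modulo the product \<open>b\<close> of the critical certificate, on whose multiples \<open>\<Lambda>\<close> vanishes, \<open>u\<close> equals \<open>\<delta> * u^2 + w^2\<close>.
\<close>

lemma eventually_minimum_bound:
  fixes f :: "'n::finite rpoly"
  assumes att: "\<exists>x0. \<forall>x. peval f x0 \<le> peval f x" and grad: "I_grad f \<subseteq> gen_ideal G"
  defines "u \<equiv> f - cst (min_value f)"
  shows "\<forall>\<^sub>F t in sequentially. \<forall>\<Lambda>\<in>moment_forms G t. 0 \<le> \<Lambda> u \<and> (\<Lambda> u = 0 \<longrightarrow> \<Lambda> (u * u) = 0)"
proof -
  obtain C j \<sigma> where C: "finite C" "\<And>c. c \<in> C \<Longrightarrow> 0 \<le> c" "j > 0" "\<sigma> \<in> sos"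
    "(\<Prod>c\<in>C. u - cst c) ^ (2 ^ j) + \<sigma> \<in> I_grad f"
    using critical_value_certificate[OF att] unfolding u_def by blast
  define b where "b = (\<Prod>c\<in>C. u - cst c)"
  obtain \<delta> w q where \<delta>: "\<delta> > 0" and eq: "u = cst \<delta> * (u * u) + w * w + b * q"
    using nonneg_modulo_roots_rpoly[OF C(1,2), of u] unfolding b_def by blast
  have "b ^ (2 ^ j) + \<sigma> \<in> gen_ideal G" using C(5) grad unfolding b_def by blast
  then have "\<forall>\<^sub>F t in sequentially. \<forall>\<Lambda>\<in>moment_forms G t. True \<longrightarrow> \<Lambda> (b ^ (2 ^ j) + \<sigma>) = 0"
    using eventually_moment_form_ideal by simp
  from eventually_square_kernel[OF C(3,4) this]
  have "\<forall>\<^sub>F t in sequentially. \<forall>\<Lambda>\<in>moment_forms G t. \<Lambda> (b * b) = 0" by simp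
  then show ?thesis
    using eventually_polys_upto[of u] eventually_polys_upto[of w] eventually_polys_upto[of b] eventually_polys_upto[of q]
  proof eventually_elim
    case (elim t)
    show ?case
    proof
      fix \<Lambda> assume \<Lambda>: "\<Lambda> \<in> moment_forms G t"
      note D = moment_formsD[OF \<Lambda>]
      have "\<Lambda> (b * q) = 0" using moment_form_kernel[OF \<Lambda>] elim \<Lambda> by blast
      moreover have "\<Lambda> (cst \<delta> * (u * u) + w * w + b * q) = \<delta> * \<Lambda> (u * u) + \<Lambda> (w * w) + \<Lambda> (b * q)"
        using elim by (simp add: D(1) D(2) polys_upto_mult2 polys_upto_add polys_upto_cst_mult)
      ultimately have "\<Lambda> u = \<delta> * \<Lambda> (u * u) + \<Lambda> (w * w)" using eq by simp
      moreover have "0 \<le> \<Lambda> (u * u)" "0 \<le> \<Lambda> (w * w)" using D(5) elim by blast+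
      ultimately show "0 \<le> \<Lambda> u \<and> (\<Lambda> u = 0 \<longrightarrow> \<Lambda> (u * u) = 0)"
        using \<delta> by (auto simp: add_nonneg_eq_0_iff)
    qed
  qed
qed

lemma hankel_ker_iff:
  assumes "\<Lambda> \<in> moment_forms G t"
  shows "p \<in> hankel_ker t \<Lambda> \<longleftrightarrow> p \<in> polys_upto t \<and> \<Lambda> (p * p) = 0"
  unfolding hankel_ker_def hankel_def fun_eq_iff using moment_form_kernel[OF assms, of p] by auto

lemma eventually_I_min_kernel:
  fixes f :: "'n::finite rpoly"
  assumes att: "\<exists>x0. \<forall>x. peval f x0 \<le> peval f x" and grad: "I_grad f \<subseteq> gen_ideal G" and p: "p \<in> I_min f"
  shows "\<forall>\<^sub>F t in sequentially. \<forall>\<Lambda>\<in>moment_forms G t.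
    \<Lambda> (f - cst (min_value f)) = 0 \<longrightarrow> p \<in> hankel_ker t \<Lambda>"
proof -
  define u where "u = f - cst (min_value f)"
  obtain j \<sigma> g q where j: "j > 0" "\<sigma> \<in> sos" "g \<in> I_grad f" "p ^ (2 ^ j) + \<sigma> = g + q * u"
    using I_min_certificate[OF p] unfolding u_def by blast
  have "\<forall>\<^sub>F t in sequentially. \<forall>\<Lambda>\<in>moment_forms G t. \<Lambda> u = 0 \<longrightarrow> \<Lambda> (p ^ (2 ^ j) + \<sigma>) = 0"
    using eventually_minimum_bound[OF att grad] eventually_moment_form_ideal[OF subsetD[OF grad j(3)]]
      eventually_polys_upto[of u] eventually_polys_upto[of q] eventually_polys_upto[of g]
  proof eventually_elim
    case (elim t)
    show ?case
    proof (intro ballI impI)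
      fix \<Lambda> assume \<Lambda>: "\<Lambda> \<in> moment_forms G t" and "\<Lambda> u = 0"
      then have "\<Lambda> (u * u) = 0" using elim(1) unfolding u_def by blast
      from moment_form_kernel[OF \<Lambda> elim(3,4) this] have "\<Lambda> (q * u) = 0" by (simp add: mult.commute)
      moreover have "\<Lambda> g = 0" using elim(2) \<Lambda> j(3) grad by blast
      moreover have "\<Lambda> (g + q * u) = \<Lambda> g + \<Lambda> (q * u)"
        using elim by (intro moment_formsD(1)[OF \<Lambda>]) (auto intro: polys_upto_mono polys_upto_mult2)
      ultimately show "\<Lambda> (p ^ (2 ^ j) + \<sigma>) = 0" by (simp add: j(4))
    qed
  qed
  from eventually_square_kernel[OF j(1,2) this] show ?thesis
    using eventually_polys_upto[of p] unfolding u_def[symmetric]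
  proof eventually_elim
    case (elim t)
    then show ?case using hankel_ker_iff by blast
  qed
qed

definition eval_form :: "nat \<Rightarrow> real ^ 'n::finite \<Rightarrow> 'n rpoly \<Rightarrow> real" where
  "eval_form t x p = (if p \<in> polys_upto (2 * t) then peval p x else 0)"

lemma eval_form_moment_form:
  assumes G: "gen_ideal G \<subseteq> I_min f" and x: "peval f x = min_value f"
  shows "eval_form t x \<in> moment_forms G t"
  unfolding moment_forms_def dual_upto_def mem_Collect_eq
proof (intro conjI ballI allI impI)
  fix p q :: "'a rpoly" assume "p \<in> polys_upto (2 * t)" "q \<in> polys_upto (2 * t)"
  then show "eval_form t x (p + q) = eval_form t x p + eval_form t x q"
    by (simp add: eval_form_def polys_upto_add)
next
  fix c and p :: "'a rpoly" assume "p \<in> polys_upto (2 * t)"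
  then show "eval_form t x (scal c p) = c * eval_form t x p"
    by (simp add: eval_form_def scal_cst polys_upto_cst_mult)
next
  fix p :: "'a rpoly" assume "p \<notin> polys_upto (2 * t)" then show "eval_form t x p = 0" by (simp add: eval_form_def)
next
  fix g assume "g \<in> trunc_ideal G (2 * t)"
  then obtain F c where F: "finite F" "F \<subseteq> G" "g = (\<Sum>a\<in>F. c a * a)" unfolding trunc_ideal_def by blast
  have "g \<in> gen_ideal G" unfolding F(3) using F(2)
  proof (induction F rule: infinite_finite_induct)
    case (insert a F)
    then show ?case
      using is_idealD(2)[OF is_ideal_gen_ideal is_idealD(3)[OF is_ideal_gen_ideal], of a G] gen_ideal_superset[of G] by auto
  qed (use is_idealD(1)[OF is_ideal_gen_ideal] in auto)
  then have "peval g x = 0" using G x by (auto simp: I_min_def)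
  then show "eval_form t x g = 0" by (simp add: eval_form_def)
next
  show "eval_form t x 1 = 1" by (simp add: eval_form_def polys_upto_1)
next
  fix p show "0 \<le> eval_form t x (p ^ 2)" by (simp add: eval_form_def)
qed

lemma moment_forms_average:
  assumes \<Lambda>: "\<Lambda> \<in> moment_forms G t" and M: "M \<in> moment_forms G t"
  shows "(\<lambda>p. (\<Lambda> p + M p) / 2) \<in> moment_forms G t"
  using assms unfolding moment_forms_def dual_upto_def
  by (auto simp: add_divide_distrib algebra_simps)

lemma hankel_add:
  assumes \<Lambda>: "\<Lambda> \<in> moment_forms G t" and "p \<in> polys_upto t" "q \<in> polys_upto t"
  shows "hankel t \<Lambda> (p + q) = hankel t \<Lambda> p + hankel t \<Lambda> q"
  using assms(2,3)
  by (simp add: hankel_def fun_eq_iff distrib_right moment_formsD(1)[OF \<Lambda>] polys_upto_mult2)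

lemma hankel_scal:
  assumes \<Lambda>: "\<Lambda> \<in> moment_forms G t" and "p \<in> polys_upto t"
  shows "hankel t \<Lambda> (cst c * p) = fun_scale c (hankel t \<Lambda> p)"
  using assms(2)
  by (simp add: hankel_def fun_eq_iff fun_scale_def mult.assoc moment_formsD(2)[OF \<Lambda>] polys_upto_mult2)

lemma hankel_0: "\<Lambda> \<in> moment_forms G t \<Longrightarrow> hankel t \<Lambda> 0 = 0"
  using moment_form_cst[of \<Lambda> G t 0] by (simp add: hankel_def fun_eq_iff cst_0)

lemma polys_upto_sum: "(\<And>i. i \<in> I \<Longrightarrow> q i \<in> polys_upto t) \<Longrightarrow> (\<Sum>i\<in>I. cst (c i) * q i) \<in> polys_upto t"
  by (induction I rule: infinite_finite_induct) (auto intro: polys_upto_0 polys_upto_add polys_upto_cst_mult)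

lemma hankel_sum:
  assumes \<Lambda>: "\<Lambda> \<in> moment_forms G t" and "\<And>i. i \<in> I \<Longrightarrow> q i \<in> polys_upto t"
  shows "hankel t \<Lambda> (\<Sum>i\<in>I. cst (c i) * q i) = (\<Sum>i\<in>I. fun_scale (c i) (hankel t \<Lambda> (q i)))"
  using assms(2)
  by (induction I rule: infinite_finite_induct)
    (simp_all add: hankel_0[OF \<Lambda>] hankel_add[OF \<Lambda>] hankel_scal[OF \<Lambda>] polys_upto_cst_mult polys_upto_sum)

lemma finite_monomials: "finite {m :: 'n::finite \<Rightarrow>\<^sub>0 nat. (\<Sum>i\<in>UNIV. Poly_Mapping.lookup m i) \<le> d}"
proof -
  have "Poly_Mapping.lookup ` {m :: 'n \<Rightarrow>\<^sub>0 nat. (\<Sum>i\<in>UNIV. Poly_Mapping.lookup m i) \<le> d} \<subseteq> (\<Pi>\<^sub>E i\<in>UNIV. {..d})"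
  proof
    fix g assume "g \<in> Poly_Mapping.lookup ` {m :: 'n \<Rightarrow>\<^sub>0 nat. (\<Sum>i\<in>UNIV. Poly_Mapping.lookup m i) \<le> d}"
    then obtain m :: "'n \<Rightarrow>\<^sub>0 nat" where m: "g = Poly_Mapping.lookup m" "(\<Sum>i\<in>UNIV. Poly_Mapping.lookup m i) \<le> d" by blast
    have "Poly_Mapping.lookup m i \<le> d" for i
      using m(2) member_le_sum[of i UNIV "Poly_Mapping.lookup m"] by simp
    then show "g \<in> (\<Pi>\<^sub>E i\<in>UNIV. {..d})" by (auto simp: m(1))
  qed
  then have "finite (Poly_Mapping.lookup ` {m :: 'n \<Rightarrow>\<^sub>0 nat. (\<Sum>i\<in>UNIV. Poly_Mapping.lookup m i) \<le> d})"
    by (rule finite_subset) (simp add: finite_PiE)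
  then show ?thesis by (rule finite_imageD) (simp add: inj_on_def lookup_inject)
qed

text \<open>
  If the inclusion of the kernels were strict, the induced map from the image of the Hankel operator of \<open>M\<close> onto that of \<open>\<Lambda>\<close> would be surjective but not
  injective, so \<open>M\<close> would have larger rank. Concretely, preimages \<open>q b\<close> of a basis \<open>B\<close> of the second image have, together with \<open>p\<close>, linearly independent
  images under the operator of \<open>M\<close>.
\<close>

lemma hankel_kernel_genericity:
  fixes G :: "'n::finite rpoly set"
  assumes \<Lambda>: "\<Lambda> \<in> moment_forms G t" and M: "M \<in> moment_forms G t"
    and ker: "hankel_ker t M \<subseteq> hankel_ker t \<Lambda>" and rank: "hankel_rank t M \<le> hankel_rank t \<Lambda>"
  shows "hankel_ker t \<Lambda> \<subseteq> hankel_ker t M"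
proof
  fix p assume p: "p \<in> hankel_ker t \<Lambda>"
  show "p \<in> hankel_ker t M"
  proof (rule ccontr)
    assume np: "p \<notin> hankel_ker t M"
    interpret V: Vector_Spaces.vector_space "fun_scale :: real \<Rightarrow> ('n rpoly \<Rightarrow> real) \<Rightarrow> _" by (rule vector_space_fun_scale)
    define Mon where "Mon = (\<lambda>m. Poly_Mapping.single m (1::real)) ` {m :: 'n \<Rightarrow>\<^sub>0 nat. (\<Sum>i\<in>UNIV. Poly_Mapping.lookup m i) \<le> t}"
    have fin: "finite Mon" unfolding Mon_def using finite_monomials by blast
    have spanning: "hankel t N ` polys_upto t \<subseteq> V.span (hankel t N ` Mon)" if N: "N \<in> moment_forms G t" for N
    proof (rule image_subsetI)
      fix q :: "'n rpoly" assume q: "q \<in> polys_upto t"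
      have single: "Poly_Mapping.single m c = cst c * Poly_Mapping.single m 1" for m :: "'n \<Rightarrow>\<^sub>0 nat" and c :: real
        by (simp add: cst_def mult_single)
      have "q = (\<Sum>m\<in>Poly_Mapping.keys q. cst (Poly_Mapping.lookup q m) * Poly_Mapping.single m 1)"
        unfolding single[symmetric] by (rule sum_monomials[symmetric])
      then have eq: "hankel t N q = hankel t N (\<Sum>m\<in>Poly_Mapping.keys q. cst (Poly_Mapping.lookup q m) * Poly_Mapping.single m 1)"
        by (rule arg_cong)
      have m: "Poly_Mapping.single m 1 \<in> Mon" "Poly_Mapping.single m (1::real) \<in> polys_upto t" if "m \<in> Poly_Mapping.keys q" for m
        using q that unfolding polys_upto_iff Mon_def by auto
      have "hankel t N q = (\<Sum>m\<in>Poly_Mapping.keys q. fun_scale (Poly_Mapping.lookup q m) (hankel t N (Poly_Mapping.single m 1)))"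
        unfolding eq by (rule hankel_sum[OF N]) (rule m(2))
      also have "\<dots> \<in> V.span (hankel t N ` Mon)"
        by (intro V.span_sum V.span_scale V.span_base imageI m(1))
      finally show "hankel t N q \<in> V.span (hankel t N ` Mon)" .
    qed
    have basis: "\<exists>B. B \<subseteq> hankel t N ` polys_upto t \<and> V.independent B \<and> hankel t N ` polys_upto t \<subseteq> V.span B
        \<and> card B = hankel_rank t N \<and> finite B" if N: "N \<in> moment_forms G t" for N
    proof -
      obtain B where B: "B \<subseteq> hankel t N ` polys_upto t" "V.independent B" "hankel t N ` polys_upto t \<subseteq> V.span B"
        "card B = V.dim (hankel t N ` polys_upto t)" using V.basis_exists by blast
      have "finite B" using V.independent_span_bound[OF _ B(2), of "hankel t N ` Mon"] spanning[OF N] B(1) fin by blast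
      then show ?thesis using B unfolding hankel_rank_def by blast
    qed
    obtain B where B: "B \<subseteq> hankel t \<Lambda> ` polys_upto t" "V.independent B" "card B = hankel_rank t \<Lambda>" "finite B"
      using basis[OF \<Lambda>] by blast
    obtain B2 where B2: "hankel t M ` polys_upto t \<subseteq> V.span B2" "card B2 = hankel_rank t M" "finite B2"
      using basis[OF M] by blast
    have "\<forall>b\<in>B. \<exists>q. q \<in> polys_upto t \<and> hankel t \<Lambda> q = b" using B(1) by blast
    from bchoice[OF this] obtain q where q: "\<And>b. b \<in> B \<Longrightarrow> q b \<in> polys_upto t" "\<And>b. b \<in> B \<Longrightarrow> hankel t \<Lambda> (q b) = b" by blast
    have pt: "p \<in> polys_upto t" using p by (simp add: hankel_ker_def)
    have zero_iff: "r \<in> hankel_ker t N \<longleftrightarrow> hankel t N r = 0" if "r \<in> polys_upto t" for r N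
      using that by (simp add: hankel_ker_def zero_fun_def)
    \<comment> \<open>the kernel inclusion turns relations in the image of \<open>M\<close> into relations in the image of \<open>\<Lambda>\<close>\<close>
    have rel: "(\<forall>b\<in>B. c b = 0) \<and> c0 = 0"
      if r: "(\<Sum>b\<in>B. fun_scale (c b) (hankel t M (q b))) + fun_scale c0 (hankel t M p) = 0" for c c0
    proof -
      let ?s = "\<Sum>b\<in>B. cst (c b) * q b"
      have s: "?s \<in> polys_upto t" using q(1) by (rule polys_upto_sum)
      have c0p: "cst c0 * p \<in> polys_upto t" by (rule polys_upto_cst_mult[OF pt])
      have "hankel t M (?s + cst c0 * p) = 0"
        using r hankel_sum[OF M q(1), of B] by (simp add: hankel_add[OF M s c0p] hankel_scal[OF M pt])
      then have "?s + cst c0 * p \<in> hankel_ker t \<Lambda>"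
        using zero_iff[OF polys_upto_add[OF s c0p]] ker by blast
      then have "hankel t \<Lambda> (?s + cst c0 * p) = 0" using zero_iff[OF polys_upto_add[OF s c0p]] by blast
      moreover have "hankel t \<Lambda> p = 0" using p zero_iff[OF pt] by blast
      ultimately have "hankel t \<Lambda> ?s = 0"
        by (simp add: hankel_add[OF \<Lambda> s c0p] hankel_scal[OF \<Lambda> pt])
      then have "(\<Sum>b\<in>B. fun_scale (c b) (hankel t \<Lambda> (q b))) = 0" using hankel_sum[OF \<Lambda> q(1), of B] by simp
      then have sum0: "(\<Sum>b\<in>B. fun_scale (c b) b) = 0" using q(2) by simp
      have cz: "\<forall>b\<in>B. c b = 0"
        using B(2) sum0 V.dependent_finite[OF B(4)] by blast
      then have "fun_scale c0 (hankel t M p) = 0" using r by simp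
      moreover have "hankel t M p \<noteq> 0" using np zero_iff[OF pt] by blast
      ultimately show ?thesis using cz by (metis V.scale_eq_0_iff)
    qed
    define g where "g b = hankel t M (q b)" for b
    have inj: "inj_on g B"
    proof (rule inj_onI, rule ccontr)
      fix a b assume ab: "a \<in> B" "b \<in> B" "g a = g b" "a \<noteq> b"
      define c where "c v = (if v = a then 1 else if v = b then - 1 else 0 :: real)" for v
      have "(\<Sum>v\<in>B. fun_scale (c v) (g v)) = (\<Sum>v\<in>{a, b}. fun_scale (c v) (g v))"
        by (rule sum.mono_neutral_right) (use B(4) ab in \<open>auto simp: c_def\<close>)
      also have "\<dots> = 0" using ab by (simp add: c_def)
      finally have "(\<Sum>v\<in>B. fun_scale (c v) (hankel t M (q v))) + fun_scale 0 (hankel t M p) = 0"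
        by (simp add: g_def)
      from rel[OF this] show False using ab(1) by (auto simp: c_def)
    qed
    have reindex: "(\<Sum>v\<in>g ` B. fun_scale (c v) v) = (\<Sum>b\<in>B. fun_scale (c (g b)) (hankel t M (q b)))" for c
      unfolding sum.reindex[OF inj] o_def unfolding g_def ..
    have ind: "V.independent (g ` B)"
    proof
      assume "V.dependent (g ` B)"
      then obtain c where c: "\<exists>v\<in>g ` B. c v \<noteq> 0" "(\<Sum>v\<in>g ` B. fun_scale (c v) v) = 0"
        using V.dependent_finite[of "g ` B"] B(4) by auto
      have "(\<Sum>b\<in>B. fun_scale (c (g b)) (hankel t M (q b))) + fun_scale 0 (hankel t M p) = 0"
        using c(2) unfolding reindex by simp
      from rel[OF this] show False using c(1) by blast
    qed
    have notin: "hankel t M p \<notin> V.span (g ` B)"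
    proof
      assume "hankel t M p \<in> V.span (g ` B)"
      then obtain c where c: "hankel t M p = (\<Sum>v\<in>g ` B. fun_scale (c v) v)"
        using V.span_finite[of "g ` B"] B(4) by auto
      have "(\<Sum>b\<in>B. fun_scale (c (g b)) (hankel t M (q b))) + fun_scale (- 1) (hankel t M p) = 0"
        unfolding c reindex by simp
      from rel[OF this] show False by simp
    qed
    have "V.independent (insert (hankel t M p) (g ` B))"
      using ind notin by (simp add: V.independent_insert)
    moreover have "insert (hankel t M p) (g ` B) \<subseteq> V.span B2"
      using B2(1) pt q(1) unfolding g_def by blast
    ultimately have "card (insert (hankel t M p) (g ` B)) \<le> card B2"
      using V.independent_span_bound[OF B2(3)] by blast
    moreover have "hankel t M p \<notin> g ` B" using notin by (rule contrapos_nn) (rule V.span_base)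
    ultimately have "Suc (card B) \<le> card B2" using B(4) card_image[OF inj] by simp
    then show False using rank B(3) B2(2) by simp
  qed
qed

theorem theorem3p19:
  fixes f :: "'n::finite rpoly" and G :: "'n rpoly set"
  assumes attained: "\<exists>x0. \<forall>x. peval f x0 \<le> peval f x"
    and grad: "I_grad f \<subseteq> gen_ideal G"
    and min: "gen_ideal G \<subseteq> I_min f"
  shows "\<exists>t2. pdegree f \<le> 2 * t2 \<and>
    (\<forall>t\<ge>t2. \<forall>\<Lambda>. generic_form G t f \<Lambda> \<longrightarrow>
       \<Lambda> f = min_value f \<and> gen_ideal (hankel_ker t \<Lambda>) = I_min f)"
proof -
  define u where "u = f - cst (min_value f)"
  have I_min: "is_ideal (I_min f)" by (auto simp: is_ideal_def I_min_def)
  then obtain B where B: "finite B" "B \<subseteq> I_min f" "gen_ideal B = I_min f"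
    using ideal_finitely_generated by blast
  have "\<forall>\<^sub>F t in sequentially. \<forall>p\<in>B. \<forall>\<Lambda>\<in>moment_forms G t. \<Lambda> u = 0 \<longrightarrow> p \<in> hankel_ker t \<Lambda>"
    using B(2) eventually_I_min_kernel[OF attained grad] unfolding u_def
    by (intro eventually_ball_finite B(1)) blast
  moreover have "\<forall>\<^sub>F t in sequentially. \<forall>\<Lambda>\<in>moment_forms G t. 0 \<le> \<Lambda> u"
    using eventually_minimum_bound[OF attained grad] unfolding u_def by eventually_elim blast
  ultimately have "\<forall>\<^sub>F t in sequentially. f \<in> polys_upto t \<and> (\<forall>p\<in>B. \<forall>\<Lambda>\<in>moment_forms G t. \<Lambda> u = 0 \<longrightarrow> p \<in> hankel_ker t \<Lambda>)
      \<and> (\<forall>\<Lambda>\<in>moment_forms G t. 0 \<le> \<Lambda> u)"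
    using eventually_polys_upto[of f] by eventually_elim blast
  then obtain t2 where t2: "\<And>t. t \<ge> t2 \<Longrightarrow> f \<in> polys_upto t"
    "\<And>t p \<Lambda>. t \<ge> t2 \<Longrightarrow> p \<in> B \<Longrightarrow> \<Lambda> \<in> moment_forms G t \<Longrightarrow> \<Lambda> u = 0 \<Longrightarrow> p \<in> hankel_ker t \<Lambda>"
    "\<And>t \<Lambda>. t \<ge> t2 \<Longrightarrow> \<Lambda> \<in> moment_forms G t \<Longrightarrow> 0 \<le> \<Lambda> u"
    unfolding eventually_sequentially by blast
  obtain x0 where x0: "peval f x0 = min_value f" using min_value_attained(2)[OF attained] by blast
  have main: "\<Lambda> f = min_value f \<and> gen_ideal (hankel_ker t \<Lambda>) = I_min f"
    if t: "t \<ge> t2" and gen: "generic_form G t f \<Lambda>" for t \<Lambda>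
  proof -
    have ft: "f \<in> polys_upto (2 * t)" using polys_upto_mono[OF t2(1)[OF t]] by simp
    have uf: "M f = M u + min_value f" if M: "M \<in> moment_forms G t" for M
    proof -
      have "u = f + cst (- min_value f)" by (simp add: u_def is_ring_homD[OF cst_hom])
      then have "M u = M f + M (cst (- min_value f))"
        using moment_formsD(1)[OF M ft polys_upto_cst] by simp
      then show ?thesis using moment_form_cst[OF M] by simp
    qed
    have lower: "min_value f \<le> M f" if "M \<in> moment_forms G t" for M using uf[OF that] t2(3)[OF t that] by simp
    have ev: "eval_form t x \<in> moment_forms G t" "eval_form t x f = min_value f" if "peval f x = min_value f" for x
      using eval_form_moment_form[OF min that] that ft by (simp_all add: eval_form_def)
    have fmu: "f_mu G t f = ereal (min_value f)"
      unfolding f_mu_def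
    proof (rule antisym)
      show "(INF \<Lambda>\<in>moment_forms G t. ereal (\<Lambda> f)) \<le> ereal (min_value f)"
        using INF_lower[OF ev(1)[OF x0], of "\<lambda>\<Lambda>. ereal (\<Lambda> f)"] ev(2)[OF x0] by simp
      show "ereal (min_value f) \<le> (INF \<Lambda>\<in>moment_forms G t. ereal (\<Lambda> f))"
        by (rule INF_greatest) (simp add: lower)
    qed
    have \<Lambda>: "\<Lambda> \<in> moment_forms G t" "\<Lambda> f = min_value f"
      and maxrank: "\<And>M. M \<in> moment_forms G t \<Longrightarrow> M f = min_value f \<Longrightarrow> hankel_rank t M \<le> hankel_rank t \<Lambda>"
      using gen unfolding generic_form_def fmu by auto
    have "\<Lambda> u = 0" using uf[OF \<Lambda>(1)] \<Lambda>(2) by simp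
    then have "B \<subseteq> hankel_ker t \<Lambda>" using t2(2)[OF t _ \<Lambda>(1)] by blast
    then have 1: "I_min f \<subseteq> gen_ideal (hankel_ker t \<Lambda>)"
      using gen_ideal_minimal[OF _ is_ideal_gen_ideal, of B "hankel_ker t \<Lambda>"] gen_ideal_superset B(3) by blast
    have "hankel_ker t \<Lambda> \<subseteq> I_min f"
    proof
      fix p assume p: "p \<in> hankel_ker t \<Lambda>"
      have "peval p x = 0" if x: "peval f x = min_value f" for x
      proof -
        define M where "M = (\<lambda>q. (\<Lambda> q + eval_form t x q) / 2)"
        have M: "M \<in> moment_forms G t" unfolding M_def by (rule moment_forms_average[OF \<Lambda>(1) ev(1)[OF x]])
        have Msq: "\<Lambda> (q * q) = 0 \<and> eval_form t x (q * q) = 0" if "q \<in> hankel_ker t M" for q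
        proof -
          have q: "q \<in> polys_upto t" "M (q * q) = 0" using that hankel_ker_iff[OF M] by blast+
          then show ?thesis
            using moment_formsD(5)[OF \<Lambda>(1) q(1)] moment_formsD(5)[OF ev(1)[OF x] q(1)] by (simp add: M_def)
        qed
        have "hankel_ker t M \<subseteq> hankel_ker t \<Lambda>"
          using Msq hankel_ker_iff[OF M] hankel_ker_iff[OF \<Lambda>(1)] by blast
        moreover have "hankel_rank t M \<le> hankel_rank t \<Lambda>"
          by (rule maxrank[OF M]) (simp add: M_def \<Lambda>(2) ev(2)[OF x])
        ultimately have pM: "p \<in> hankel_ker t M" using hankel_kernel_genericity[OF \<Lambda>(1) M] p by blast
        then have "p * p \<in> polys_upto (2 * t)" using polys_upto_mult2 by (auto simp: hankel_ker_def)
        then show ?thesis using Msq[OF pM] by (simp add: eval_form_def)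
      qed
      then show "p \<in> I_min f" by (simp add: I_min_def)
    qed
    then have "gen_ideal (hankel_ker t \<Lambda>) \<subseteq> I_min f" by (rule gen_ideal_minimal[OF _ I_min])
    then show ?thesis using 1 \<Lambda>(2) by blast
  qed
  have "pdegree f \<le> 2 * t2" using polys_upto_mono[OF t2(1)[OF order_refl], of "2 * t2"] by (simp add: polys_upto_def)
  then show ?thesis using main by blast
qed

end
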